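(* In the i.i.d. sieve setting described in the context (sample size $n$, data from $P=P_{\theta^*,f^*}$, correctly specified model), suppose that for all $m\ge m_0$ (some $m_0\in\mathbb N$), with $p^*=p+m$, with $\mathcal D_m^2=-\nabla^2_{p+m}\mathbb E\mathcal L_m(\upsilon_m^* )$ and $\mathcal V_m^2=\operatorname{Cov}[\nabla_{p+m}\mathcal L_m(\upsilon_m^* )]$ positive definite, and with constants $\delta(\mathtt r),\nu_0>0,\mathtt g>0,\omega\le1/2$ (possibly depending on $n,m$): (1) $\|\mathcal D_m^{-1}\{-\nabla^2_{p+m}\mathbb E\mathcal L_m(\upsilon)\}\mathcal D_m^{-1}-I_{p^*}\|\le\delta(\mathtt r)$ for $\mathtt r\le\mathtt r_0$, $\upsilon\in\Upsilon_{0,m}(\mathtt r)$; (2) $\log \mathbb E\exp\{\mu\langle\nabla\zeta_m(\upsilon_m^* ),\gamma\rangle/\|\mathcal V_m\gamma\|\}\le\nu_0^2\mu^2/2$ for $|\mu|\le\mathtt g$, $\gamma\ne0$; (3) $\log \mathbb E\exp\Bigl\{\dfrac{\mu\gamma^\top\mathcal D_m^{-1}\{\nabla\zeta_m(\upsilon)-\nabla\zeta_m(\upsilon')\}}{\omega\|\mathcal D_m(\upsilon-\upsilon')\|}\Bigr\}\le\nu_0^2\mu^2/2$ for $|\mu|\le\mathtt g$, $0<\mathtt r<\mathtt r_0$, $\upsilon\ne\upsilon'$ in $\Upsilon_{0,m}(\mathtt r)$, $\|\gamma\|=1$; (4) there is a decreasing function $\alpha:\mathbb N\to\mathbb R_+$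 with $\|\breve D_m(\theta^*_m-\theta^* )\|\le\alpha(m)$; (5) as $m\to\infty$, in spectral norm, $\|I-\breve D_m(\upsilon^* )^{-1}\breve D(\upsilon^* )^2\breve D_m(\upsilon^* )^{-1}\|=o(1)$ and $\|I-\breve D_m(\upsilon_m^* )^{-1}\breve D_m(\upsilon^* )^2\breve D_m(\upsilon^*_m)^{-1}\|=o(1)$; (6) as $m\to\infty$, in spectral norm, $\|\breve D_m^{-1}\,(n\breve V_m^2)\,\breve D_m^{-1}-I_p\|\to0$, where $\breve V_m^2=\operatorname{Cov}\bigl(\nabla_\theta\ell_1(\upsilon_m^* )-A_mH_m^{-2}\nabla_\eta\ell_1(\upsilon_m^* )\bigr)$. Assume that there exist sequences $m=m_n\in\mathbb N$ and $\mathtt x_n\to\infty$ such that, as $n\to\infty$, $$\Diamond(\mathtt r_0,\mathtt x_n)+\alpha(m)\to0,$$ where $\mathtt r_0=\mathtt r_0(\mathtt x_n)>0$ is chosen such that $\mathbb P(\tilde\upsilon_m,\tilde\upsilon_{\theta^*_m,m}\in\Upsilon_{0,m}(\mathtt r_0(\mathtt x_n)))\ge1-e^{-\mathtt x_n}$. Then as $n\to\infty$ $$(n\breve F)^{1/2}(\tilde\theta_m-\theta^* )-\breve\xi\to0\ \text{ in probability},\qquad(n\breve F)^{1/2}(\tilde\theta_m-\theta^* )\to\mathcal N(0,I_p)\ \text{ in distribution}.$$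
   Context: Setting. $\mathcal X$ is an infinite dimensional Hilbert space with countable orthonormal basis $e_1,e_2,\dots$; parameters $(\theta,f)$, $\theta\in\Theta\subseteq\mathbb R^p$, $f\in\mathcal X$, are identified with $\upsilon=(\theta,\eta)\in l^2$ through $f=\sum_j\eta_je_j$; $\Upsilon$ is the parameter set. Data $Y_1,\dots,Y_n$ are i.i.d. from $P_{\theta^*,f^*}$ (expectation $\mathbb E$), $\ell_i(\upsilon)$ is the log-likelihood of observation $i$ (and $\ell$ that of a single observation), $\mathcal L(\upsilon)=\sum_{i=1}^n\ell_i(\upsilon)$, sufficiently smooth. $\upsilon^*=\operatorname{argmax}_{l^2}\mathbb E\mathcal L(\upsilon)$ with $\theta$-component $\theta^*$. For $m\in\mathbb N$: $f_m(\eta)=\sum_{j\le m}\eta_je_j$, $\Upsilon_m=\{(\theta,\eta)\in\mathbb R^{p+m}:(\theta,f_m(\eta))\in\Upsilon\}$, $\mathcal L_m(\theta,\eta)=\mathcal L(\theta,f_m(\eta))$, $\zeta_m=\mathcal L_m-\mathbb E\mathcal L_m$ (separable process), $\Pi_0(\theta,\eta)=\theta$, $\tilde\upsilon_m=\operatorname{argmax}_{\Upsilon_m}\mathcal L_m$, $\tilde\theta_m=\Pi_0\tilde\upsilon_m$, $\upsilon_m^*=\operatorname{argmax}_{\Upsilon_m}\mathbb E\mathcal L_m$, $\theta_m^*=\Pi_0\upsilon_m^*$, $\tilde\upsilon_{\theta_m^*,m}=\operatorname{argmax}_{\upsilon\in\Upsilon_m,\Pi_0\upsilon=\theta_m^*}\mathcal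 L_m$. Points of $\mathbb R^{p+m}$ are embedded in $l^2$ by zero padding. $\nabla_{p+m}=(\nabla_\theta,\nabla_\eta)$ differentiates in the first $p+m$ coordinates. Matrices: $\mathcal D_m^2(\upsilon)=-\nabla^2_{p+m}\mathbb E\mathcal L(\upsilon)$, $\breve D_m(\upsilon)^2=(\Pi_0\mathcal D_m^{-2}(\upsilon)\Pi_0^\top)^{-1}$; $\mathcal D_m=\mathcal D_m(\upsilon_m^* )$, $\breve D_m=\breve D_m(\upsilon_m^* )$; $\mathcal D_m^2=\begin{pmatrix} D^2 & A_m \\ A_m^\top & H_m^2 \end{pmatrix}$. The full operator on $l^2$ is $\mathcal D^2=\mathcal D^2(\upsilon^* )=-\nabla^2\mathbb E\mathcal L(\upsilon^* )$, with blocks $\begin{pmatrix} D_*^2 & A \\ A^\top & H^2 \end{pmatrix}$ for $(\theta,\eta)$, and $\breve D^2=\breve D(\upsilon^* )^2=(\Pi_0\mathcal D^{-2}\Pi_0^\top)^{-1}$. $\breve F=\bigl(\Pi_0\operatorname{Cov}\{\nabla\ell(\upsilon^* )\}^{-1}\Pi_0^\top\bigr)^{-1}$ is the efficient information of one observation, and under correct specification $\breve D^2=n\breve F$. $\breve\xi=\breve D^{-1}(\nabla_\theta-AH^{-2}\nabla_\eta)\mathcal L(\upsilon^* )$ is the normalized efficient score of the full model. $\Upsilon_{0,m}(\mathtt r)=\{\upsilon\in\Upsilon_m:\|\mathcal D_m(\upsilon-\upsilon_m^* )\|\le\mathtt r\}$. Spread: $\Diamond(\mathtt r,\mathtt x)=\{\delta(\mathtt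 r)+6\nu_0\mathfrak z_0(\mathtt x,p^* )\omega\}\mathtt r$, where, with $\mathtt g_0=\nu_0\mathtt g$, $\mathbb Q=4p^*$, $\mathfrak z_0(\mathtt x,p^* )=\sqrt{2(\mathtt x+\mathbb Q)}$ if $\sqrt{2(\mathtt x+\mathbb Q)}\le\mathtt g_0$ and $\mathtt g_0^{-1}(\mathtt x+\mathbb Q)+\mathtt g_0/2$ otherwise.
   Formalization: Added: m_n→∞; the local sets Υ_{0,m}(r_0) are convex and lie in the relative interior of Υ_m; and the sieve efficient score functional of ∇ℓ(υ_m* )−∇ℓ(υ* ) tends to 0 in mean square. Without these the claim can fail. *)

theory Defs
  imports "HOL-Probability.Probability"
begin

text \<open>
  The parameter pair (theta, f) lives in the real inner product space real^'p \<times> 'x, where 'x is a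
  real Hilbert space with orthonormal basis e 0, e 1, ...; the expansion of f in this basis
  identifies that space with l2, and R^(p+m), embedded by zero padding, with
  UNIV \<times> span (e ` {..<m}).  A (p+m)-vector is therefore an element of this subspace, and a
  (p+m) \<times> (p+m)-matrix is a linear map of which only the values on this subspace matter.
\<close>

definition orthonormal_basis :: "(nat \<Rightarrow> 'a::real_inner) \<Rightarrow> bool" where
  "orthonormal_basis e \<longleftrightarrow>
     (\<forall>i j. e i \<bullet> e j = (if i = j then 1 else 0)) \<and> closure (span (range e)) = UNIV"

definition sieve_space :: "(nat \<Rightarrow> 'x::real_inner) \<Rightarrow> nat \<Rightarrow> 'x set" where
  "sieve_space e m = span (e ` {..<m})"

text \<open>The coordinate projection of l2 onto R^(p+m).\<close>

definition sieve_proj ::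
    "(nat \<Rightarrow> 'x::real_inner) \<Rightarrow> nat \<Rightarrow> 't \<times> 'x \<Rightarrow> 't \<times> 'x" where
  "sieve_proj e m u = (fst u, \<Sum>j<m. (snd u \<bullet> e j) *\<^sub>R e j)"

definition grad :: "('a::real_inner \<Rightarrow> real) \<Rightarrow> 'a \<Rightarrow> 'a" where
  "grad f x = (THE d. GDERIV f x :> d)"

definition hess :: "('a::real_inner \<Rightarrow> real) \<Rightarrow> 'a \<Rightarrow> 'a \<Rightarrow> 'a" where
  "hess f x = frechet_derivative (grad f) (at x)"

definition pos_def_on :: "'a::real_inner set \<Rightarrow> ('a \<Rightarrow> 'a) \<Rightarrow> bool" where
  "pos_def_on V T \<longleftrightarrow>
     (\<forall>x\<in>V. \<forall>y\<in>V. x \<bullet> T y = T x \<bullet> y) \<and> (\<forall>x\<in>V. x \<noteq> 0 \<longrightarrow> 0 < x \<bullet> T x)"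

text \<open>
  The positive semidefinite square root of T on V, padded by zero on the orthogonal complement of
  V (which follows from symmetry and the range condition).
\<close>

definition sqrt_on :: "'a::real_inner set \<Rightarrow> ('a \<Rightarrow> 'a) \<Rightarrow> 'a \<Rightarrow> 'a" where
  "sqrt_on V T = (THE S. linear S \<and> range S \<subseteq> V \<and> (\<forall>x y. x \<bullet> S y = S x \<bullet> y) \<and>
                         (\<forall>x. 0 \<le> x \<bullet> S x) \<and> (\<forall>x\<in>V. S (S x) = T x))"

definition msqrt :: "real^'p^'p \<Rightarrow> real^'p^'p" where
  "msqrt B = matrix (sqrt_on UNIV (\<lambda>v. B *v v))"

definition spectral_norm :: "real^'p^'p \<Rightarrow> real" where
  "spectral_norm B = onorm (\<lambda>v. B *v v)"

text \<open>
  For an operator T on UNIV \<times> W, with W a sieve space or the whole Hilbert space, this is the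
  inverse of the theta-block of the inverse of T.  For W = UNIV the operator T may be compact, as
  covariance operators often are, so its inverse is only evaluated on the theta-directions.
\<close>

definition eff_info ::
    "'x::real_inner set \<Rightarrow> ((real^'p) \<times> 'x \<Rightarrow> (real^'p) \<times> 'x) \<Rightarrow> real^'p^'p" where
  "eff_info W T = matrix_inv (matrix (\<lambda>t. fst (inv_into (UNIV \<times> W) T (t, 0))))"

text \<open>
  With blocks A (upper right) and H2 (lower right) of the symmetric operator T, this is
  g_theta - A H2^(-1) g_eta.  The operator A H2^(-1) is evaluated as the transpose of
  H2^(-1) A^T, which is the same when H2 is invertible and stays meaningful for all g_eta when
  the inverse of H2 is unbounded.
\<close>

definition eff_score ::
    "'x::real_inner set \<Rightarrow> ((real^'p) \<times> 'x \<Rightarrow> (real^'p) \<times> 'x) \<Rightarrow> (real^'p) \<times> 'x \<Rightarrow> real^'p" where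
  "eff_score W T g =
     fst g - (\<chi> k. inv_into W (\<lambda>f. snd (T (0, f))) (snd (T (axis k 1, 0))) \<bullet> snd g)"

definition covar :: "'w measure \<Rightarrow> ('w \<Rightarrow> real) \<Rightarrow> ('w \<Rightarrow> real) \<Rightarrow> real" where
  "covar M X Z = (\<integral>w. (X w - (\<integral>v. X v \<partial>M)) * (Z w - (\<integral>v. Z v \<partial>M)) \<partial>M)"

definition cov_op :: "'w measure \<Rightarrow> ('w \<Rightarrow> 'a::real_inner) \<Rightarrow> 'a \<Rightarrow> 'a" where
  "cov_op M X u = (THE v. \<forall>z. v \<bullet> z = covar M (\<lambda>w. X w \<bullet> u) (\<lambda>w. X w \<bullet> z))"

text \<open>
  The bound log E exp (c X) \<le> nu^2 c^2 / 2 for |c| \<le> g, including finiteness of the left side.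
\<close>

definition log_mgf_bound :: "'w measure \<Rightarrow> ('w \<Rightarrow> real) \<Rightarrow> real \<Rightarrow> real \<Rightarrow> bool" where
  "log_mgf_bound M X \<nu> g \<longleftrightarrow>
     (\<forall>c. \<bar>c\<bar> \<le> g \<longrightarrow> integrable M (\<lambda>w. exp (c * X w)) \<and>
                     ln (\<integral>w. exp (c * X w) \<partial>M) \<le> \<nu>\<^sup>2 * c\<^sup>2 / 2)"

definition conv_in_prob ::
    "'w measure \<Rightarrow> (nat \<Rightarrow> 'w \<Rightarrow> 'a::metric_space) \<Rightarrow> 'a \<Rightarrow> bool" where
  "conv_in_prob M X c \<longleftrightarrow>
     (\<forall>\<epsilon>>0. (\<lambda>n. measure M {w \<in> space M. dist (X n w) c > \<epsilon>}) \<longlonglongrightarrow> 0)"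

text \<open>Weak convergence; the library's notion covers real-valued variables only.\<close>

definition conv_in_distr ::
    "(nat \<Rightarrow> 'a::topological_space measure) \<Rightarrow> 'a measure \<Rightarrow> bool" where
  "conv_in_distr Q R \<longleftrightarrow>
     (\<forall>h::'a \<Rightarrow> real. continuous_on UNIV h \<and> bounded (range h) \<longrightarrow>
        (\<lambda>n. \<integral>x. h x \<partial>Q n) \<longlonglongrightarrow> (\<integral>x. h x \<partial>R))"

definition std_gaussian :: "(real^'p) measure" where
  "std_gaussian = density lborel (\<lambda>x. ennreal (\<Prod>i\<in>UNIV. std_normal_density (x $ i)))"

definition z_quantile :: "real \<Rightarrow> real \<Rightarrow> real \<Rightarrow> real" where
  "z_quantile g0 x pstar =
     (let Q = 4 * pstar in
      if sqrt (2 * (x + Q)) \<le> g0 then sqrt (2 * (x + Q)) else (x + Q) / g0 + g0 / 2)"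

definition spread :: "(real \<Rightarrow> real) \<Rightarrow> real \<Rightarrow> real \<Rightarrow> real \<Rightarrow> real \<Rightarrow> real \<Rightarrow> real \<Rightarrow> real" where
  "spread \<delta> \<nu>0 g \<omega> pstar r x = (\<delta> r + 6 * \<nu>0 * z_quantile (\<nu>0 * g) x pstar * \<omega>) * r"

text \<open>lik y u is the log-likelihood of the observation y at u, relative to a dominating measure.\<close>

definition model :: "'y measure \<Rightarrow> ('y \<Rightarrow> 'u \<Rightarrow> real) \<Rightarrow> 'u \<Rightarrow> 'y measure" where
  "model \<mu> lik u = density \<mu> (\<lambda>y. ennreal (exp (lik y u)))"

text \<open>
  P is the sampling distribution.  The last two conjuncts state that differentiation and expectation
  may be interchanged; the expectation of the Hilbert space valued score is taken weakly.
\<close>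

definition smooth_loglik :: "'y measure \<Rightarrow> ('y \<Rightarrow> 'u::real_inner \<Rightarrow> real) \<Rightarrow> 'u set \<Rightarrow> bool" where
  "smooth_loglik P lik U \<longleftrightarrow> open U \<and>
     (\<forall>y\<in>space P. (\<forall>u\<in>U. GDERIV (lik y) u :> grad (lik y) u) \<and> continuous_on U (grad (lik y))) \<and>
     (\<forall>u\<in>U. integrable P (\<lambda>y. lik y u) \<and>
            GDERIV (\<lambda>v. \<integral>y. lik y v \<partial>P) u :> grad (\<lambda>v. \<integral>y. lik y v \<partial>P) u \<and>
            grad (\<lambda>v. \<integral>y. lik y v \<partial>P) differentiable (at u) \<and>
            (\<forall>h. integrable P (\<lambda>y. grad (lik y) u \<bullet> h) \<and>
                 grad (\<lambda>v. \<integral>y. lik y v \<partial>P) u \<bullet> h = (\<integral>y. grad (lik y) u \<bullet> h \<partial>P)))"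

end

theory Submission
  imports Defs
begin

text \<open>
  For a direction t in the theta-space let h be the least favourable direction of the sieve
  information at the sieve target, so that the information maps h to (E t, 0). Testing the score
  equation of the sieve estimator against h and expanding the expected score around the target
  isolates t \<bullet> E (theta-tilde - theta-m) minus the efficient sieve score; the curvature condition (1)
  bounds the bias and chaining of the increments in (3) bounds the centred remainder, both by the
  spread. As only p directions matter and they are fixed, no supremum over directions is needed.

  It remains to replace the sieve quantities by those of the full model. Condition (5) makes the
  sieve information matrices converge to the full one. The sieve direction a and the full
  least favourable direction b have the same theta-component, hence a - b is orthogonal to b in
  the metric of the full information D and the variance of the score difference is
  a \<bullet> D a - b \<bullet> D b; condition (6) and the mean-square smoothness of the score force this excess to
  vanish. Asymptotic normality follows from the one-dimensional central limit theorem for all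
  linear functionals and the density of trigonometric sums.
\<close>

section \<open>Finite-dimensional subspaces, spectral theorem and square roots\<close>

text \<open>The quantile in the spread leaves room for only 4 times the dimension
  \<open>d = p + m\<close>, so the entropy of the local set has to be linear in \<open>d\<close>;
  counting the net cells in a cube would cost an extra term of order \<open>d log d\<close>.
  Counting the integer points of an l1 ball avoids it. The constants of chaining are not matched to
  the factor 6 of the spread: the expansion error is bounded by 8 p times the spread, which is
  harmless because p is fixed. Conditions (5) and (6) are limits in the sieve dimension at a fixed
  sample size, but they are needed along \<open>m n\<close> with \<open>n\<close> growing. The
  expected Hessian of \<open>n\<close> observations is \<open>n\<close> times that of one, so
  information matrices are proportional to \<open>n\<close>, while least favourable directions and
  efficient scores do not depend on it; the limits for one observation, composed with
  \<open>m\<close>, therefore serve all sample sizes. Finally, condition (6) controls the variance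
  of the score at the sieve target, whereas the orthogonality argument needs the variance of the
  score at the truth along the sieve direction; mean-square smoothness converts one into the
  other.\<close>

definition orthonormal_set :: "'a::real_inner set \<Rightarrow> bool" where
  "orthonormal_set B \<longleftrightarrow> finite B \<and> (\<forall>u\<in>B. \<forall>v\<in>B. u \<bullet> v = of_bool (u = v))"

lemma orthonormal_setD:
  assumes "orthonormal_set B"
  shows "finite B" "u \<in> B \<Longrightarrow> v \<in> B \<Longrightarrow> u \<bullet> v = of_bool (u = v)" "u \<in> B \<Longrightarrow> norm u = 1"
  using assms by (auto simp: orthonormal_set_def norm_eq_sqrt_inner)

lemma orthonormal_sum_inner:
  assumes B: "orthonormal_set B" and c: "c \<in> B"
  shows "(\<Sum>b\<in>B. f b *\<^sub>R b) \<bullet> c = f c"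
proof -
  have "(\<Sum>b\<in>B. f b *\<^sub>R b) \<bullet> c = (\<Sum>b\<in>B. f b * (b \<bullet> c))"
    by (simp add: inner_sum_left)
  also have "\<dots> = (\<Sum>b\<in>B. if b = c then f b else 0)"
    using c by (intro sum.cong) (auto simp: orthonormal_setD(2)[OF B])
  finally show ?thesis using orthonormal_setD(1)[OF B] c by simp
qed

text \<open>Sieve spaces are finite-dimensional subspaces of an infinite-dimensional type, so they
  are handled throughout as spans of explicit finite orthonormal sets, with inner products as
  coordinates.\<close>

lemma orthonormal_expansion:
  assumes B: "orthonormal_set B" and v: "v \<in> span B"
  shows "v = (\<Sum>b\<in>B. (v \<bullet> b) *\<^sub>R b)"
proof -
  obtain f where f: "v = (\<Sum>b\<in>B. f b *\<^sub>R b)"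
    using v span_finite[OF orthonormal_setD(1)[OF B]] by auto
  then have "\<And>c. c \<in> B \<Longrightarrow> v \<bullet> c = f c" using orthonormal_sum_inner[OF B] by blast
  then show ?thesis using f by simp
qed

lemma orthonormal_inner:
  assumes B: "orthonormal_set B" and v: "v \<in> span B"
  shows "v \<bullet> w = (\<Sum>b\<in>B. (v \<bullet> b) * (w \<bullet> b))"
proof -
  have "v \<bullet> w = (\<Sum>b\<in>B. (v \<bullet> b) *\<^sub>R b) \<bullet> w" using orthonormal_expansion[OF B v] by simp
  then show ?thesis by (simp add: inner_sum_left inner_commute[of w])
qed

lemma orthonormal_norm:
  assumes "orthonormal_set B" "v \<in> span B"
  shows "(norm v)\<^sup>2 = (\<Sum>b\<in>B. (v \<bullet> b)\<^sup>2)"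
  unfolding power2_norm_eq_inner using orthonormal_inner[OF assms, of v] by (simp only: power2_eq_square)

lemma orthonormal_proj:
  assumes B: "orthonormal_set B"
  shows "(\<Sum>b\<in>B. (v \<bullet> b) *\<^sub>R b) \<in> span B"
    and "w \<in> span B \<Longrightarrow> (v - (\<Sum>b\<in>B. (v \<bullet> b) *\<^sub>R b)) \<bullet> w = 0"
proof -
  show 1: "(\<Sum>b\<in>B. (v \<bullet> b) *\<^sub>R b) \<in> span B" by (intro span_sum span_scale span_base)
  assume w: "w \<in> span B"
  have "(\<Sum>b\<in>B. (v \<bullet> b) *\<^sub>R b) \<bullet> w = (\<Sum>b\<in>B. (v \<bullet> b) * (w \<bullet> b))"
    by (simp add: inner_sum_left inner_commute[of w])
  also have "\<dots> = v \<bullet> w" using orthonormal_inner[OF B w, of v] by (simp add: inner_commute mult.commute)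
  finally show "(v - (\<Sum>b\<in>B. (v \<bullet> b) *\<^sub>R b)) \<bullet> w = 0" by (simp add: inner_diff_left)
qed

text \<open>A linear map on the whole type need not be continuous; on a finite-dimensional span this
  formula displays its values as a continuous function of the argument.\<close>

lemma linear_on_span_expansion:
  assumes B: "orthonormal_set B" and T: "linear T" and v: "v \<in> span B"
  shows "T v = (\<Sum>b\<in>B. (v \<bullet> b) *\<^sub>R T b)"
proof -
  have "T v = T (\<Sum>b\<in>B. (v \<bullet> b) *\<^sub>R b)" using orthonormal_expansion[OF B v] by simp
  also have "\<dots> = (\<Sum>b\<in>B. (v \<bullet> b) *\<^sub>R T b)" using T by (simp add: linear_sum linear_scale)
  finally show ?thesis .
qed

section \<open>Compactness and the spectral theorem on finite-dimensional spans\<close>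

lemma orthonormal_set_independent:
  assumes B: "orthonormal_set B"
  shows "independent B"
proof (rule pairwise_orthogonal_independent)
  show "pairwise orthogonal B"
    using B by (auto simp: pairwise_def orthogonal_def orthonormal_set_def)
  show "0 \<notin> B" using orthonormal_setD(3)[OF B] by force
qed

text \<open>Each further vector turns the box into the continuous image of an interval times the
  smaller box. It is the compact set in which unit balls of spans are caught.\<close>

lemma compact_coordinate_box:
  fixes B :: "'a::real_normed_vector set"
  assumes "finite B"
  shows "compact {\<Sum>b\<in>B. f b *\<^sub>R b | f. \<forall>b\<in>B. \<bar>f b\<bar> \<le> (1::real)}"
  using assms
proof (induction B rule: finite_induct)
  case (insert a B)
  let ?K = "\<lambda>B::'a set. {\<Sum>b\<in>B. f b *\<^sub>R b | f. \<forall>b\<in>B. \<bar>f b\<bar> \<le> (1::real)}"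
  have "compact ((\<lambda>(t, x). t *\<^sub>R a + x) ` ({-1..1} \<times> ?K B))"
    by (intro compact_continuous_image compact_Times insert.IH)
       (auto simp: case_prod_beta intro!: continuous_intros)
  also have "(\<lambda>(t, x). t *\<^sub>R a + x) ` ({-1..1} \<times> ?K B) = ?K (insert a B)"
  proof (intro equalityI subsetI)
    fix y assume "y \<in> (\<lambda>(t, x). t *\<^sub>R a + x) ` ({-1..1} \<times> ?K B)"
    then obtain t f where tf: "t \<in> {-1..1}" "\<forall>b\<in>B. \<bar>f b\<bar> \<le> 1" "y = t *\<^sub>R a + (\<Sum>b\<in>B. f b *\<^sub>R b)"
      by auto
    have "(\<Sum>b\<in>insert a B. (f(a := t)) b *\<^sub>R b) = t *\<^sub>R a + (\<Sum>b\<in>B. (f(a := t)) b *\<^sub>R b)"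
      using insert.hyps by simp
    also have "(\<Sum>b\<in>B. (f(a := t)) b *\<^sub>R b) = (\<Sum>b\<in>B. f b *\<^sub>R b)"
      using insert.hyps by (intro sum.cong) auto
    finally have "(\<Sum>b\<in>insert a B. (f(a := t)) b *\<^sub>R b) = y" using tf by simp
    moreover have "\<forall>b\<in>insert a B. \<bar>(f(a := t)) b\<bar> \<le> 1" using tf by auto
    ultimately show "y \<in> ?K (insert a B)" by blast
  next
    fix y assume "y \<in> ?K (insert a B)"
    then obtain f where f: "\<forall>b\<in>insert a B. \<bar>f b\<bar> \<le> 1" "y = (\<Sum>b\<in>insert a B. f b *\<^sub>R b)" by auto
    then have "y = f a *\<^sub>R a + (\<Sum>b\<in>B. f b *\<^sub>R b)" using insert.hyps by simp
    moreover have "(\<Sum>b\<in>B. f b *\<^sub>R b) \<in> ?K B" using f by auto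
    moreover have "f a \<in> {-1..1}" using f by (auto simp: abs_le_iff)
    ultimately show "y \<in> (\<lambda>(t, x). t *\<^sub>R a + x) ` ({-1..1} \<times> ?K B)" by force
  qed
  finally show ?case .
qed simp

text \<open>The span is the fixed-point set of the orthogonal projection, which is continuous as a
  finite sum.\<close>

lemma closed_span_orthonormal:
  assumes B: "orthonormal_set B"
  shows "closed (span B)"
proof -
  have "span B = {v. v = (\<Sum>b\<in>B. (v \<bullet> b) *\<^sub>R b)}"
    using orthonormal_expansion[OF B] orthonormal_proj(1)[OF B] by (metis (mono_tags, lifting) Collect_cong Collect_mem_eq)
  moreover have "closed {v. v = (\<Sum>b\<in>B. (v \<bullet> b) *\<^sub>R b)}"
    by (intro closed_Collect_eq continuous_intros)
  ultimately show ?thesis by simp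
qed

lemma compact_span_cball:
  assumes B: "orthonormal_set B"
  shows "compact (span B \<inter> cball 0 1)"
proof -
  have "span B \<inter> cball 0 1 \<subseteq> {\<Sum>b\<in>B. f b *\<^sub>R b | f. \<forall>b\<in>B. \<bar>f b\<bar> \<le> (1::real)}"
  proof
    fix v assume v: "v \<in> span B \<inter> cball 0 1"
    have "\<bar>v \<bullet> b\<bar> \<le> 1" if "b \<in> B" for b
      using Cauchy_Schwarz_ineq2[of v b] orthonormal_setD(3)[OF B that] v by simp
    then show "v \<in> {\<Sum>b\<in>B. f b *\<^sub>R b | f. \<forall>b\<in>B. \<bar>f b\<bar> \<le> (1::real)}"
      using orthonormal_expansion[OF B, of v] v by blast
  qed
  then have "span B \<inter> cball 0 1 = {\<Sum>b\<in>B. f b *\<^sub>R b | f. \<forall>b\<in>B. \<bar>f b\<bar> \<le> (1::real)} \<inter> (span B \<inter> cball 0 1)"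
    by blast
  moreover have "compact \<dots>"
    by (intro compact_Int_closed compact_coordinate_box closed_Int closed_cball
        closed_span_orthonormal[OF B] orthonormal_setD(1)[OF B])
  ultimately show ?thesis by simp
qed

text \<open>The form \<open>x \<bullet> T x\<close> attains its maximum over the unit sphere of
  \<open>V\<close> by compactness, and a maximiser is an eigenvector. The invariant subspace
  \<open>V\<close> is kept apart from \<open>span B\<close> so that the lemma applies to orthogonal
  complements of eigenvectors already found.\<close>

lemma eigenvector_exists:
  assumes B: "orthonormal_set B" and T: "linear T"
    and V: "subspace V" "closed V" "V \<subseteq> span B" "T ` V \<subseteq> V"
    and sym: "\<And>x y. x \<in> V \<Longrightarrow> y \<in> V \<Longrightarrow> x \<bullet> T y = T x \<bullet> y"
    and nz: "v \<in> V" "v \<noteq> 0"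
  obtains c l where "c \<in> V" "norm c = 1" "T c = l *\<^sub>R c"
proof -
  let ?K = "V \<inter> sphere 0 1"
  have "sphere (0::'a) 1 = {x. norm x = 1}" by auto
  moreover have "closed {x::'a. norm x = 1}" by (intro closed_Collect_eq continuous_intros)
  ultimately have cls: "closed (sphere (0::'a) 1)" by simp
  have "?K = (span B \<inter> cball 0 1) \<inter> (V \<inter> sphere 0 1)" using V(3) by auto
  moreover have "compact \<dots>"
    by (rule compact_Int_closed) (auto intro!: compact_span_cball[OF B] closed_Int V(2) cls)
  ultimately have K: "compact ?K" by simp
  have "v /\<^sub>R norm v \<in> ?K" using nz V(1) by (auto simp: subspace_scale)
  then have ne: "?K \<noteq> {}" by blast
  have "continuous_on ?K (\<lambda>x. x \<bullet> (\<Sum>b\<in>B. (x \<bullet> b) *\<^sub>R T b))"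
    by (intro continuous_intros)
  then have "continuous_on ?K (\<lambda>x. x \<bullet> T x)"
    by (rule continuous_on_eq) (use linear_on_span_expansion[OF B T] V(3) in auto)
  from continuous_attains_sup[OF K ne this] obtain c
    where c: "c \<in> V" "norm c = 1" and max: "\<And>y. y \<in> ?K \<Longrightarrow> y \<bullet> T y \<le> c \<bullet> T c" by auto
  define l where "l = c \<bullet> T c"
  have le: "y \<bullet> T y \<le> l * (y \<bullet> y)" if y: "y \<in> V" for y
  proof (cases "y = 0")
    case False
    let ?y = "y /\<^sub>R norm y"
    have "?y \<in> ?K" using y False V(1) by (auto simp: subspace_scale)
    then have "?y \<bullet> T ?y \<le> l" using max l_def by blast
    then have "(y \<bullet> T y) / (norm y)\<^sup>2 \<le> l"
      by (simp add: linear_scale[OF T] power2_eq_square divide_inverse mult_ac)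
    then show ?thesis using False by (simp add: divide_le_eq power2_norm_eq_inner)
  qed (use linear_0[OF T] in simp)
  \<comment> \<open>The residual of the eigenvalue equation. The form
    \<open>l * (x \<bullet> x) - x \<bullet> T x\<close> is nonnegative on \<open>V\<close> and
    vanishes at \<open>c\<close>; along \<open>c + t *\<^sub>R r\<close> its linear coefficient is
    \<open>2 * (r \<bullet> r)\<close>.\<close>
  define r where "r = l *\<^sub>R c - T c"
  have r: "r \<in> V" unfolding r_def using V c by (auto intro!: subspace_diff subspace_scale)
  have cc: "c \<bullet> c = 1" using c(2) by (simp add: norm_eq_1)
  have quad: "0 \<le> 2 * t * (r \<bullet> r) + t\<^sup>2 * (l * (r \<bullet> r) - r \<bullet> T r)" for t
  proof -
    have "c + t *\<^sub>R r \<in> V" using c r V(1) by (auto intro: subspace_add subspace_scale)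
    from le[OF this] have
      "0 \<le> l * ((c + t *\<^sub>R r) \<bullet> (c + t *\<^sub>R r)) - (c + t *\<^sub>R r) \<bullet> (T c + t *\<^sub>R T r)"
      by (simp add: linear_add[OF T] linear_scale[OF T])
    also have "\<dots> = (l * (c \<bullet> c) - c \<bullet> T c) + t * (2 * l * (c \<bullet> r) - c \<bullet> T r - r \<bullet> T c)
                    + t\<^sup>2 * (l * (r \<bullet> r) - r \<bullet> T r)"
      by (simp add: inner_add_left inner_add_right inner_commute power2_eq_square algebra_simps)
    also have "c \<bullet> T r = r \<bullet> T c" using sym[OF c(1) r] by (simp add: inner_commute)
    also have "2 * l * (c \<bullet> r) - r \<bullet> T c - r \<bullet> T c = 2 * (r \<bullet> r)"
      by (simp add: r_def inner_diff_right inner_diff_left inner_commute algebra_simps)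
    finally show ?thesis by (simp add: cc l_def algebra_simps)
  qed
  have "r \<bullet> r = 0"
  proof (rule ccontr)
    assume "r \<bullet> r \<noteq> 0"
    then have p: "r \<bullet> r > 0" by simp
    \<comment> \<open>\<open>a\<close> dominates the quadratic coefficient, and \<open>t\<close>
      minimises \<open>2 * t * (r \<bullet> r) + t\<^sup>2 * a\<close>, whose minimum is
      negative.\<close>
    define a where "a = \<bar>l * (r \<bullet> r) - r \<bullet> T r\<bar> + 1"
    define t where "t = - (r \<bullet> r) / a"
    have a: "a > 0" "l * (r \<bullet> r) - r \<bullet> T r \<le> a" by (auto simp: a_def)
    have "0 \<le> 2 * t * (r \<bullet> r) + t\<^sup>2 * a" using quad[of t] a mult_left_mono[OF a(2), of "t\<^sup>2"] by simp
    also have "\<dots> = - (r \<bullet> r)\<^sup>2 / a" using a by (simp add: t_def power2_eq_square field_simps)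
    also have "\<dots> < 0" using a p by (simp add: divide_neg_pos)
    finally show False by simp
  qed
  then have "T c = l *\<^sub>R c" by (simp add: r_def)
  with c show ?thesis by (rule that)
qed

text \<open>An orthonormal set of eigenvectors of largest cardinality spans: by symmetry its
  orthogonal complement in \<open>span B\<close> is invariant, so a nonzero vector there would yield
  one more eigenvector.\<close>

lemma orthonormal_spectral:
  assumes B: "orthonormal_set B" and T: "linear T" "T ` span B \<subseteq> span B"
    and sym: "\<And>x y. x \<in> span B \<Longrightarrow> y \<in> span B \<Longrightarrow> x \<bullet> T y = T x \<bullet> y"
  obtains C l where "orthonormal_set C" "span C = span B" "\<And>c. c \<in> C \<Longrightarrow> T c = l c *\<^sub>R c"
proof -
  define Q where "Q C \<longleftrightarrow> orthonormal_set C \<and> C \<subseteq> span B \<and> (\<forall>c\<in>C. \<exists>l. T c = l *\<^sub>R c)" for C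
  have bound: "card C \<le> card B" if "Q C" for C
    using independent_span_bound[of B C] that orthonormal_set_independent[of C] orthonormal_setD(1)[OF B]
    by (auto simp: Q_def)
  have "Q {}" by (auto simp: Q_def orthonormal_set_def)
  then obtain C where C: "Q C" and max: "\<And>C'. Q C' \<Longrightarrow> card C' \<le> card C"
    using ex_has_greatest_nat[of Q "{}" card "Suc (card B)"] bound by (auto simp: less_Suc_eq_le)
  have oC: "orthonormal_set C" "C \<subseteq> span B" using C by (auto simp: Q_def)
  define V where "V = span B \<inter> {v. \<forall>c\<in>C. v \<bullet> c = 0}"
  have sV: "subspace V" unfolding V_def subspace_def
    by (auto simp: span_add span_scale span_zero inner_add_left)
  have "{v. \<forall>c\<in>C. v \<bullet> c = 0} = (\<Inter>c\<in>C. {v. v \<bullet> c = 0})" by auto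
  moreover have "closed \<dots>" by (intro closed_INT ballI closed_Collect_eq continuous_intros)
  ultimately have clV: "closed V"
    unfolding V_def by (intro closed_Int closed_span_orthonormal[OF B]) simp
  have TV: "T ` V \<subseteq> V"
  proof
    fix y assume "y \<in> T ` V"
    then obtain x where x: "x \<in> span B" "\<And>c. c \<in> C \<Longrightarrow> x \<bullet> c = 0" "y = T x" by (auto simp: V_def)
    have "T x \<bullet> c = 0" if c: "c \<in> C" for c
    proof -
      obtain l where "T c = l *\<^sub>R c" using C c by (auto simp: Q_def)
      then show ?thesis using sym[OF x(1), of c] oC(2) c x(2)[OF c] by auto
    qed
    then show "y \<in> V" using x T(2) by (auto simp: V_def)
  qed
  have "V \<subseteq> {0}"
  proof
    fix v assume v: "v \<in> V"
    show "v \<in> {0}"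
    proof (rule ccontr)
      assume "v \<notin> {0}"
      then have "v \<noteq> 0" by simp
      moreover have "V \<subseteq> span B" by (auto simp: V_def)
      ultimately obtain c l where c: "c \<in> V" "norm c = 1" "T c = l *\<^sub>R c"
        using eigenvector_exists[OF B T(1) sV clV _ TV _ v] sym by blast
      have nin: "c \<notin> C" using c(1,2) by (auto simp: V_def norm_eq_sqrt_inner)
      have "c \<bullet> c = 1" using c(2) by (simp add: norm_eq_1)
      moreover have "c \<bullet> d = 0" "d \<bullet> c = 0" if "d \<in> C" for d
        using c(1) that by (auto simp: V_def inner_commute)
      ultimately have "orthonormal_set (insert c C)"
        using oC nin by (auto simp: orthonormal_set_def)
      then have "Q (insert c C)" using C c by (auto simp: Q_def V_def)
      then show False using max[of "insert c C"] nin orthonormal_setD(1)[OF oC(1)] by simp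
    qed
  qed
  have "span B \<subseteq> span C"
  proof
    fix v assume v: "v \<in> span B"
    let ?p = "\<Sum>b\<in>C. (v \<bullet> b) *\<^sub>R b"
    have "?p \<in> span B" using oC(2) by (intro span_sum span_scale) auto
    then have "v - ?p \<in> V"
      using orthonormal_proj(2)[OF oC(1)] v by (auto simp: V_def span_diff span_base)
    then have "v = ?p" using \<open>V \<subseteq> {0}\<close> by auto
    then show "v \<in> span C" using orthonormal_proj(1)[OF oC(1)] by metis
  qed
  moreover have "span C \<subseteq> span B" using oC(2) by (metis span_mono span_span)
  moreover obtain l where "\<forall>c\<in>C. T c = l c *\<^sub>R c" using C unfolding Q_def by metis
  ultimately show ?thesis using that[OF oC(1)] by auto
qed

text \<open>The predicate under the description in \<open>sqrt_on\<close>, named so that existence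
  and uniqueness can be proved for it. Symmetry and the range condition fix the root off
  \<open>V\<close> as well, as uniqueness on the whole type requires.\<close>

definition is_sqrt_on :: "'a::real_inner set \<Rightarrow> ('a \<Rightarrow> 'a) \<Rightarrow> ('a \<Rightarrow> 'a) \<Rightarrow> bool" where
  "is_sqrt_on V T S \<longleftrightarrow> linear S \<and> range S \<subseteq> V \<and> (\<forall>x y. x \<bullet> S y = S x \<bullet> y) \<and>
     (\<forall>x. 0 \<le> x \<bullet> S x) \<and> (\<forall>x\<in>V. S (S x) = T x)"

locale pos_def_operator =
  fixes B :: "'a::real_inner set" and T :: "'a \<Rightarrow> 'a"
  assumes orthonormal: "orthonormal_set B"
    and linear: "linear T" and range: "T ` span B \<subseteq> span B" and pos_def: "pos_def_on (span B) T"
begin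

lemma spectral:
  obtains C l where "orthonormal_set C" "span C = span B" "\<And>c. c \<in> C \<Longrightarrow> T c = l c *\<^sub>R c"
    "\<And>c. c \<in> C \<Longrightarrow> 0 < l c"
proof -
  obtain C l where C: "orthonormal_set C" "span C = span B" "\<And>c. c \<in> C \<Longrightarrow> T c = l c *\<^sub>R c"
    using orthonormal_spectral[OF orthonormal linear range] pos_def by (auto simp: pos_def_on_def)
  have "0 < l c" if c: "c \<in> C" for c
  proof -
    have "c \<in> span B" using c C(2) span_base by blast
    moreover have "c \<bullet> c = 1" using orthonormal_setD(2)[OF C(1) c c] by simp
    moreover from this have "c \<noteq> 0" by auto
    ultimately show ?thesis using pos_def C(3)[OF c] by (auto simp: pos_def_on_def)
  qed
  with C show ?thesis by (rule that)
qed

lemma surj_on: 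
  assumes "y \<in> span B"
  shows "\<exists>x\<in>span B. T x = y"
proof -
  obtain C l where C: "orthonormal_set C" "span C = span B" "\<And>c. c \<in> C \<Longrightarrow> T c = l c *\<^sub>R c"
    "\<And>c. c \<in> C \<Longrightarrow> 0 < l c" by (rule spectral) blast
  let ?x = "\<Sum>c\<in>C. ((y \<bullet> c) / l c) *\<^sub>R c"
  have "T ?x = (\<Sum>c\<in>C. ((y \<bullet> c) / l c) *\<^sub>R T c)"
    using linear by (simp add: linear_sum linear_scale)
  also have "\<dots> = (\<Sum>c\<in>C. (y \<bullet> c) *\<^sub>R c)"
    using C(3) C(4) by (intro sum.cong) (auto simp: less_imp_neq[symmetric])
  also have "\<dots> = y" using orthonormal_expansion[OF C(1)] assms C(2) by simp
  finally have "T ?x = y" .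
  moreover have "?x \<in> span B" unfolding C(2)[symmetric] by (intro span_sum span_scale span_base)
  ultimately show ?thesis by blast
qed

lemma is_sqrt_on_exists: "\<exists>S. is_sqrt_on (span B) T S"
proof -
  obtain C l where C: "orthonormal_set C" "span C = span B" "\<And>c. c \<in> C \<Longrightarrow> T c = l c *\<^sub>R c"
    "\<And>c. c \<in> C \<Longrightarrow> 0 < l c" by (rule spectral) blast
  define S where "S x = (\<Sum>c\<in>C. (sqrt (l c) * (x \<bullet> c)) *\<^sub>R c)" for x
  have lin: "linear S" unfolding S_def
    by (intro linearI)
       (auto simp: inner_add_left scaleR_left_distrib distrib_left sum.distrib scaleR_sum_right mult_ac)
  have rng: "S x \<in> span B" for x
    unfolding S_def C(2)[symmetric] by (intro span_sum span_scale span_base)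
  have sym: "x \<bullet> S y = S x \<bullet> y" for x y
    by (simp add: S_def inner_sum_left inner_sum_right inner_commute mult_ac)
  have psd: "0 \<le> x \<bullet> S x" for x
    unfolding S_def inner_sum_right using C(4) 
    by (intro sum_nonneg) (auto simp: less_imp_le inner_commute mult.assoc)
  have SC: "S c = sqrt (l c) *\<^sub>R c" if c: "c \<in> C" for c
  proof -
    have "S c = (\<Sum>d\<in>C. if d = c then sqrt (l d) *\<^sub>R d else 0)"
      unfolding S_def using orthonormal_setD(2)[OF C(1) c] by (intro sum.cong) auto
    then show ?thesis using c orthonormal_setD(1)[OF C(1)] by simp
  qed
  have sq: "S (S x) = T x" if x: "x \<in> span B" for x
  proof -
    have "S (S x) = (\<Sum>c\<in>C. (sqrt (l c) * (x \<bullet> c)) *\<^sub>R S c)"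
      unfolding S_def[of x] using lin by (simp add: linear_sum linear_scale)
    also have "\<dots> = (\<Sum>c\<in>C. (x \<bullet> c) *\<^sub>R T c)"
      using C(3) C(4) SC by (intro sum.cong) (auto simp: less_imp_le mult_ac real_sqrt_mult_self)
    also have "\<dots> = T x" using linear_on_span_expansion[OF C(1) linear] x C(2) by simp
    finally show ?thesis .
  qed
  show ?thesis unfolding is_sqrt_on_def using lin rng sym psd sq by blast
qed

text \<open>On an eigenvector \<open>c\<close> of \<open>T\<close> with eigenvalue \<open>l\<close>,
  the defect \<open>y\<close> of a root \<open>R\<close>, that is \<open>R c\<close> minus
  \<open>sqrt l\<close> times \<open>c\<close>, is mapped by \<open>R\<close> to
  \<open>- sqrt l\<close> times itself; this is compatible with
  \<open>0 \<le> y \<bullet> R y\<close> only for \<open>y = 0\<close>. Symmetry and the range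
  condition then determine \<open>R\<close> everywhere.\<close>

lemma is_sqrt_on_unique:
  assumes S: "is_sqrt_on (span B) T S" and S': "is_sqrt_on (span B) T S'"
  shows "S = S'"
proof -
  obtain C l where C: "orthonormal_set C" "span C = span B" "\<And>c. c \<in> C \<Longrightarrow> T c = l c *\<^sub>R c"
    "\<And>c. c \<in> C \<Longrightarrow> 0 < l c" by (rule spectral) blast
  have *: "R x = (\<Sum>c\<in>C. (x \<bullet> c) *\<^sub>R sqrt (l c) *\<^sub>R c)" if R: "is_sqrt_on (span B) T R" for R x
  proof -
    have lin: "linear R" using R by (simp add: is_sqrt_on_def)
    have eig: "R c = sqrt (l c) *\<^sub>R c" if c: "c \<in> C" for c
    proof -
      define y where "y = R c - sqrt (l c) *\<^sub>R c"
      have "c \<in> span B" using c C(2) span_base by blast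
      then have "R (R c) = l c *\<^sub>R c" using R C(3)[OF c] by (simp add: is_sqrt_on_def)
      then have "R y = - (sqrt (l c) *\<^sub>R y)"
        using C(4)[OF c] by (simp add: y_def linear_diff[OF lin] linear_scale[OF lin] scaleR_diff_right)
      then have "y \<bullet> R y = - sqrt (l c) * (y \<bullet> y)" by simp
      moreover have "0 \<le> y \<bullet> R y" using R unfolding is_sqrt_on_def by blast
      ultimately have "sqrt (l c) * (y \<bullet> y) \<le> 0" by simp
      then have "y \<bullet> y \<le> 0" using C(4)[OF c] by (simp add: mult_le_0_iff)
      then have "y = 0" using inner_ge_zero[of y] by (metis inner_eq_zero_iff order_antisym)
      then show ?thesis by (simp add: y_def)
    qed
    have "R x \<in> span C" using R C(2) by (auto simp: is_sqrt_on_def)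
    from orthonormal_expansion[OF C(1) this] have "R x = (\<Sum>c\<in>C. (R x \<bullet> c) *\<^sub>R c)" .
    also have "\<dots> = (\<Sum>c\<in>C. (x \<bullet> c) *\<^sub>R sqrt (l c) *\<^sub>R c)"
    proof (intro sum.cong refl)
      fix c assume c: "c \<in> C"
      have "R x \<bullet> c = x \<bullet> R c" using R by (simp add: is_sqrt_on_def)
      then show "(R x \<bullet> c) *\<^sub>R c = (x \<bullet> c) *\<^sub>R sqrt (l c) *\<^sub>R c" using eig[OF c] by (simp add: mult.commute)
    qed
    finally show ?thesis .
  qed
  show ?thesis using *[OF S] *[OF S'] by auto
qed

lemma sqrt_on_eq:
  assumes "is_sqrt_on (span B) T S"
  shows "sqrt_on (span B) T = S"
  unfolding sqrt_on_def is_sqrt_on_def[symmetric]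
  using assms is_sqrt_on_unique by blast

lemma is_sqrt_on_sqrt_on: "is_sqrt_on (span B) T (sqrt_on (span B) T)"
  using is_sqrt_on_exists sqrt_on_eq by metis

abbreviation "S \<equiv> sqrt_on (span B) T"

lemma sqrt_linear: "Real_Vector_Spaces.linear S"
  and sqrt_range: "S x \<in> span B"
  and sqrt_sym: "x \<bullet> S y = S x \<bullet> y"
  and sqrt_sqrt: "x \<in> span B \<Longrightarrow> S (S x) = T x"
  using is_sqrt_on_sqrt_on by (auto simp: is_sqrt_on_def)

lemma sqrt_inner: "y \<in> span B \<Longrightarrow> S x \<bullet> S y = x \<bullet> T y"
  using sqrt_sym[of x "S y"] sqrt_sqrt by simp

lemma norm_sqrt: "x \<in> span B \<Longrightarrow> (norm (S x))\<^sup>2 = x \<bullet> T x"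
  by (simp add: power2_norm_eq_inner sqrt_inner)

lemma sqrt_inj_on: "inj_on S (span B)"
proof (rule inj_onI)
  fix x y assume xy: "x \<in> span B" "y \<in> span B" "S x = S y"
  then have v: "x - y \<in> span B" and "S (x - y) = 0"
    by (auto simp: span_diff linear_diff[OF sqrt_linear])
  then have "(x - y) \<bullet> T (x - y) = 0" using norm_sqrt[OF v] by simp
  then show "x = y" using pos_def v unfolding pos_def_on_def by force
qed

lemma sqrt_surj_on: "S ` span B = span B"
proof (intro equalityI subsetI)
  fix y assume "y \<in> span B"
  then obtain x where "x \<in> span B" "T x = y" using surj_on by blast
  then have "y = S (S x)" using sqrt_sqrt by simp
  then show "y \<in> S ` span B" using sqrt_range by blast
qed (use sqrt_range in auto)

abbreviation "S_inv \<equiv> inv_into (span B) S"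

lemma sqrt_inv: "x \<in> span B \<Longrightarrow> S_inv (S x) = x"
  and sqrt_inv_in: "y \<in> span B \<Longrightarrow> S_inv y \<in> span B"
  and sqrt_of_inv: "y \<in> span B \<Longrightarrow> S (S_inv y) = y"
  using sqrt_inj_on sqrt_surj_on by (auto simp: inv_into_into f_inv_into_f)

lemma sqrt_inv_sum:
  assumes "finite I" "\<And>i. i \<in> I \<Longrightarrow> y i \<in> span B"
  shows "S_inv (\<Sum>i\<in>I. f i *\<^sub>R y i) = (\<Sum>i\<in>I. f i *\<^sub>R S_inv (y i))"
proof -
  have "(\<Sum>i\<in>I. f i *\<^sub>R y i) = S (\<Sum>i\<in>I. f i *\<^sub>R S_inv (y i))"
    using assms by (simp add: linear_sum[OF sqrt_linear] linear_scale[OF sqrt_linear] sqrt_of_inv)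
  moreover have "(\<Sum>i\<in>I. f i *\<^sub>R S_inv (y i)) \<in> span B"
    using assms by (intro span_sum span_scale sqrt_inv_in)
  ultimately show ?thesis using sqrt_inv by simp
qed

text \<open>Expresses the inverse root by its finitely many values on \<open>B\<close>, which makes
  it visibly continuous on the span.\<close>

lemma sqrt_inv_expansion:
  assumes "y \<in> span B"
  shows "S_inv y = (\<Sum>b\<in>B. (y \<bullet> b) *\<^sub>R S_inv b)"
proof -
  have "S_inv y = S_inv (\<Sum>b\<in>B. (y \<bullet> b) *\<^sub>R b)" using orthonormal_expansion[OF orthonormal assms] by simp
  also have "\<dots> = (\<Sum>b\<in>B. (y \<bullet> b) *\<^sub>R S_inv b)"
    by (rule sqrt_inv_sum[OF orthonormal_setD(1)[OF orthonormal] span_base])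
  finally show ?thesis .
qed

lemma sqrt_inv_sym:
  assumes "x \<in> span B" "y \<in> span B"
  shows "x \<bullet> S_inv y = S_inv x \<bullet> y"
  using sqrt_sym[of "S_inv x" "S_inv y"] sqrt_of_inv assms by simp

end

lemma orthonormal_Basis: "orthonormal_set (Basis :: 'a::euclidean_space set)"
  by (auto simp: orthonormal_set_def inner_Basis)

section \<open>Efficient information and least favourable directions\<close>

abbreviation pos_def_matrix :: "real^'p^'p \<Rightarrow> bool" where
  "pos_def_matrix A \<equiv> pos_def_on UNIV (\<lambda>v. A *v v)"

lemma pos_def_matrixD:
  assumes "pos_def_matrix A"
  shows "x \<bullet> (A *v y) = (A *v x) \<bullet> y" "x \<noteq> 0 \<Longrightarrow> 0 < x \<bullet> (A *v x)" "0 \<le> x \<bullet> (A *v x)"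
proof -
  show "x \<bullet> (A *v y) = (A *v x) \<bullet> y" using assms unfolding pos_def_on_def by blast
  show 1: "0 < x \<bullet> (A *v x)" if "x \<noteq> 0" for x using assms that unfolding pos_def_on_def by blast
  show "0 \<le> x \<bullet> (A *v x)" using 1[of x] by (cases "x = 0") (auto simp: less_imp_le)
qed

lemma pos_def_matrix_invertible:
  fixes A :: "real^'p^'p"
  assumes "pos_def_matrix A"
  shows "invertible A"
  unfolding invertible_left_inverse matrix_left_invertible_ker
  using pos_def_matrixD(2)[OF assms] by force

lemma matrix_inv_vector:
  fixes A :: "real^'n^'n"
  assumes "invertible A"
  shows "A *v (matrix_inv A *v x) = x" "matrix_inv A *v (A *v x) = x"
  using someI_ex[OF assms[unfolded invertible_def], folded matrix_inv_def]
  by (simp_all add: matrix_vector_mul_assoc)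

lemma pos_def_operator_matrix:
  fixes A :: "real^'p^'p"
  assumes "pos_def_matrix A"
  shows "pos_def_operator Basis (\<lambda>v. A *v v)"
  by (rule pos_def_operator.intro) (use assms in \<open>auto simp: orthonormal_Basis\<close>)

lemma is_sqrt_on_msqrt:
  fixes A :: "real^'p^'p"
  assumes "pos_def_matrix A"
  shows "is_sqrt_on UNIV (\<lambda>v. A *v v) (\<lambda>v. msqrt A *v v)"
proof -
  interpret pos_def_operator Basis "\<lambda>v. A *v v" by (rule pos_def_operator_matrix[OF assms])
  show ?thesis using is_sqrt_on_sqrt_on sqrt_linear by (simp add: msqrt_def matrix_works)
qed

lemma msqrt_sym: "pos_def_matrix A \<Longrightarrow> x \<bullet> (msqrt A *v y) = (msqrt A *v x) \<bullet> y"
  and msqrt_msqrt: "pos_def_matrix A \<Longrightarrow> msqrt A *v (msqrt A *v x) = A *v x"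
  using is_sqrt_on_msqrt[of A] unfolding is_sqrt_on_def by blast+

lemma norm_msqrt: "pos_def_matrix A \<Longrightarrow> (norm (msqrt A *v x))\<^sup>2 = x \<bullet> (A *v x)"
  by (metis msqrt_msqrt msqrt_sym power2_norm_eq_inner)

lemma msqrt_invertible:
  fixes A :: "real^'p^'p"
  assumes A: "pos_def_matrix A"
  shows "invertible (msqrt A)"
  unfolding invertible_left_inverse matrix_left_invertible_ker
proof (intro allI impI)
  fix x assume "msqrt A *v x = 0"
  then have "x \<bullet> (A *v x) = 0" using norm_msqrt[OF A, of x] by simp
  then show "x = 0" using pos_def_matrixD(2)[OF A, of x] by force
qed

lemma matrix_inv_msqrt_sym:
  assumes A: "pos_def_matrix A"
  shows "x \<bullet> (matrix_inv (msqrt A) *v y) = (matrix_inv (msqrt A) *v x) \<bullet> y"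
  using msqrt_sym[OF A, of "matrix_inv (msqrt A) *v x" "matrix_inv (msqrt A) *v y"]
  by (simp add: matrix_inv_vector[OF msqrt_invertible[OF A]])

lemma scaleR_matrix_vector: "(c *\<^sub>R A) *v x = c *\<^sub>R (A *v (x::real^'n))"
  by (simp add: vec_eq_iff matrix_vector_mult_def sum_distrib_left mult_ac)

lemma pos_def_matrix_scaleR:
  fixes A :: "real^'p^'p"
  assumes "pos_def_matrix A" "0 < c"
  shows "pos_def_matrix (c *\<^sub>R A)"
  using assms by (auto simp: pos_def_on_def scaleR_matrix_vector)

text \<open>By uniqueness it is enough that \<open>sqrt c\<close> times the root is again a root.
  Used to pass between one and \<open>n\<close> observations.\<close>

lemma msqrt_scaleR:
  fixes A :: "real^'p^'p"
  assumes A: "pos_def_matrix A" and c: "0 < c"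
  shows "msqrt (c *\<^sub>R A) = sqrt c *\<^sub>R msqrt A"
proof -
  interpret pos_def_operator Basis "\<lambda>v. (c *\<^sub>R A) *v v"
    by (rule pos_def_operator_matrix[OF pos_def_matrix_scaleR[OF A c]])
  have "is_sqrt_on UNIV (\<lambda>v. (c *\<^sub>R A) *v v) (\<lambda>v. (sqrt c *\<^sub>R msqrt A) *v v)"
    using is_sqrt_on_msqrt[OF A] c unfolding is_sqrt_on_def
    by (auto simp: scaleR_matrix_vector matrix_vector_mult_scaleR)
  then have "sqrt_on UNIV (\<lambda>v. (c *\<^sub>R A) *v v) = (\<lambda>v. (sqrt c *\<^sub>R msqrt A) *v v)"
    using sqrt_on_eq by simp
  then show ?thesis by (simp add: msqrt_def)
qed

lemma matrix_inv_unique: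
  fixes A :: "real^'n^'n"
  assumes "A ** B = mat 1"
  shows "matrix_inv A = B"
proof -
  have "invertible A" using assms invertible_right_inverse by blast
  from matrix_inv_vector(2)[OF this] have "matrix_inv A *v x = B *v x" for x
    using assms by (metis matrix_vector_mul_assoc matrix_vector_mul_lid)
  then show ?thesis by (simp add: matrix_eq)
qed

lemma matrix_inv_scaleR:
  fixes A :: "real^'n^'n"
  assumes A: "invertible A" and c: "c \<noteq> 0"
  shows "matrix_inv (c *\<^sub>R A) = (1 / c) *\<^sub>R matrix_inv A"
proof (rule matrix_inv_unique)
  have "((c *\<^sub>R A) ** ((1 / c) *\<^sub>R matrix_inv A)) *v x = mat 1 *v x" for x
    using c by (simp add: matrix_vector_mul_assoc[symmetric] scaleR_matrix_vector
        matrix_vector_mult_scaleR matrix_inv_vector[OF A])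
  then show "(c *\<^sub>R A) ** ((1 / c) *\<^sub>R matrix_inv A) = mat 1"
    by (simp add: matrix_eq)
qed

lemma spectral_norm_bound: "norm (A *v x) \<le> spectral_norm A * norm x"
  unfolding spectral_norm_def by (rule onorm) simp

text \<open>The substitution \<open>s = msqrt A *v t\<close> turns a spectral-norm bound on a
  normalised difference into a relative bound on quadratic forms, the shape in which conditions (5)
  and (6) are used.\<close>

lemma spectral_norm_quadratic:
  assumes A: "pos_def_matrix A"
    and N: "spectral_norm (mat 1 - matrix_inv (msqrt A) ** N ** matrix_inv (msqrt A)) \<le> \<epsilon>"
  shows "\<bar>t \<bullet> (A *v t) - t \<bullet> (N *v t)\<bar> \<le> \<epsilon> * (t \<bullet> (A *v t))"
proof -
  let ?R = "msqrt A" and ?J = "matrix_inv (msqrt A)"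
  define s where "s = ?R *v t"
  have Js: "?J *v s = t" by (simp add: s_def matrix_inv_vector[OF msqrt_invertible[OF A]])
  have ss: "s \<bullet> s = t \<bullet> (A *v t)" using norm_msqrt[OF A, of t] by (simp add: s_def power2_norm_eq_inner)
  have "t \<bullet> (A *v t) - t \<bullet> (N *v t) = s \<bullet> ((mat 1 - ?J ** N ** ?J) *v s)"
    by (simp add: ss[symmetric] matrix_vector_mult_diff_rdistrib inner_diff_right
        matrix_vector_mul_assoc[symmetric] Js matrix_inv_msqrt_sym[OF A])
  also have "\<bar>\<dots>\<bar> \<le> norm s * norm ((mat 1 - ?J ** N ** ?J) *v s)" by (rule Cauchy_Schwarz_ineq2)
  also have "\<dots> \<le> norm s * (\<epsilon> * norm s)"
    using spectral_norm_bound[of "mat 1 - ?J ** N ** ?J" s] N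
    by (intro mult_left_mono) (auto elim!: order_trans intro!: mult_right_mono)
  also have "\<dots> = \<epsilon> * (s \<bullet> s)" by (simp add: power2_norm_eq_inner[symmetric] power2_eq_square)
  finally show ?thesis by (simp add: ss)
qed

text \<open>
  The vector lfd t is the least favourable direction: it minimises the quadratic form of T among
  all vectors with the same theta-component.
\<close>

locale eff_block =
  fixes W :: "'x::real_inner set" and T :: "(real^'p) \<times> 'x \<Rightarrow> (real^'p) \<times> 'x"
  assumes subspace: "subspace W" and linear: "linear T"
    and range: "T ` (UNIV \<times> W) \<subseteq> UNIV \<times> W" and pos_def: "pos_def_on (UNIV \<times> W) T"
    and solvable: "\<And>t. (t, 0) \<in> T ` (UNIV \<times> W)"
begin

text \<open>Full inverses are avoided: in the full model \<open>T\<close> may fail to be onto, and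
  \<open>solvable\<close> provides just the preimages of \<open>(t, 0)\<close>, which positive
  definiteness makes unique.\<close>

definition "dir t = inv_into (UNIV \<times> W) T (t, 0)"

abbreviation "E \<equiv> eff_info W T"

definition "lfd t = dir (E *v t)"

lemma sym: "x \<in> UNIV \<times> W \<Longrightarrow> y \<in> UNIV \<times> W \<Longrightarrow> x \<bullet> T y = T x \<bullet> y"
  and pos: "x \<in> UNIV \<times> W \<Longrightarrow> x \<noteq> 0 \<Longrightarrow> 0 < x \<bullet> T x"
  using pos_def unfolding pos_def_on_def by blast+

lemma subspace_UNIV_Times: "subspace (UNIV \<times> W)"
  using subspace by (rule subspace_Times[OF subspace_UNIV])

lemma inj_on: "inj_on T (UNIV \<times> W)"
proof (rule inj_onI)
  fix x y assume xy: "x \<in> UNIV \<times> W" "y \<in> UNIV \<times> W" "T x = T y"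
  then have "x - y \<in> UNIV \<times> W" using subspace_diff[OF subspace_UNIV_Times] by blast
  moreover have "T (x - y) = 0" using xy by (simp add: linear_diff[OF linear])
  ultimately show "x = y" using pos[of "x - y"] by force
qed

lemma dir_in: "dir t \<in> UNIV \<times> W" and T_dir: "T (dir t) = (t, 0)"
  using solvable[of t] by (simp_all add: dir_def inv_into_into f_inv_into_f)

lemma dir_eqI: "x \<in> UNIV \<times> W \<Longrightarrow> T x = (t, 0) \<Longrightarrow> dir t = x"
  using inv_into_f_f[OF inj_on, of x] by (simp add: dir_def)

lemma linear_dir: "Real_Vector_Spaces.linear dir"
proof (rule linearI)
  fix s t
  show "dir (s + t) = dir s + dir t"
    by (rule dir_eqI) (auto simp: linear_add[OF linear] T_dir intro!: subspace_add[OF subspace_UNIV_Times] dir_in)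
next
  fix c t
  show "dir (c *\<^sub>R t) = c *\<^sub>R dir t"
    by (rule dir_eqI) (auto simp: linear_scale[OF linear] T_dir intro!: subspace_scale[OF subspace_UNIV_Times] dir_in)
qed

lemma inner_T_dir: "x \<in> UNIV \<times> W \<Longrightarrow> T x \<bullet> dir t = fst x \<bullet> t"
  using sym[of x "dir t"] dir_in T_dir by (simp add: inner_prod_def)

abbreviation "N \<equiv> matrix (\<lambda>t. fst (dir t))"

lemma N_apply: "N *v t = fst (dir t)"
proof -
  have "Real_Vector_Spaces.linear (\<lambda>t. fst (dir t))"
    using linear_compose[OF linear_dir linear_fst] by (simp add: o_def)
  then show ?thesis by (simp add: matrix_works)
qed

lemma pos_def_N: "pos_def_matrix N"
  unfolding pos_def_on_def
proof (intro conjI ballI impI)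
  fix s t :: "real^'p"
  show "s \<bullet> (N *v t) = (N *v s) \<bullet> t"
    using inner_T_dir[OF dir_in, of s t] inner_T_dir[OF dir_in, of t s]
    by (simp add: T_dir N_apply inner_prod_def inner_commute)
next
  fix t :: "real^'p" assume t: "t \<noteq> 0"
  have "dir t \<noteq> 0" using T_dir[of t] t linear_0[OF linear] by (metis fst_conv fst_zero)
  then have "0 < dir t \<bullet> T (dir t)" using pos dir_in by blast
  then show "0 < t \<bullet> (N *v t)" by (simp add: T_dir N_apply inner_prod_def inner_commute)
qed

lemma E_eq: "E = matrix_inv N"
  by (simp add: eff_info_def dir_def[abs_def])

lemma fst_dir_E: "fst (dir (E *v t)) = t" and E_fst_dir: "E *v fst (dir t) = t"
  using matrix_inv_vector[OF pos_def_matrix_invertible[OF pos_def_N], of t] by (simp_all add: E_eq N_apply)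

lemma fst_lfd: "fst (lfd t) = t"
  by (simp add: lfd_def fst_dir_E)

lemma lfd_in: "lfd t \<in> UNIV \<times> W" and T_lfd: "T (lfd t) = (E *v t, 0)"
  by (simp_all add: lfd_def dir_in T_dir)

lemma linear_lfd: "Real_Vector_Spaces.linear lfd"
  unfolding lfd_def[abs_def]
  using linear_compose[OF matrix_vector_mul_linear linear_dir, of E] by (simp add: o_def)

lemma inner_T_lfd: "x \<in> UNIV \<times> W \<Longrightarrow> x \<bullet> T (lfd t) = fst x \<bullet> (E *v t)"
  by (simp add: T_lfd inner_prod_def)

lemma pos_def_E: "pos_def_matrix E"
  unfolding pos_def_on_def
proof (intro conjI ballI impI)
  fix s t :: "real^'p"
  have "lfd s \<bullet> T (lfd t) = T (lfd s) \<bullet> lfd t" by (intro sym lfd_in)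
  then show "s \<bullet> (E *v t) = (E *v s) \<bullet> t" by (simp add: T_lfd inner_prod_def fst_lfd)
next
  fix t :: "real^'p" assume t: "t \<noteq> 0"
  then have "lfd t \<noteq> 0" using fst_lfd[of t] by (metis fst_zero)
  from pos[OF lfd_in this] show "0 < t \<bullet> (E *v t)" by (simp add: inner_T_lfd[OF lfd_in] fst_lfd)
qed

lemma inner_lfd: "lfd t \<bullet> T (lfd t) = t \<bullet> (E *v t)"
  using inner_T_lfd[OF lfd_in] by (simp add: fst_lfd)

text \<open>Writing \<open>lfd a = (a, - f)\<close> gives
  \<open>T (a, 0) = T (lfd a) + T (0, f)\<close>, where the second component of
  \<open>T (lfd a)\<close> vanishes. So \<open>f\<close> is the vector that the block inverse in
  \<open>eff_score\<close> returns, and the efficient score is the score tested against the least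
  favourable direction.\<close>

lemma eff_score_nth: "eff_score W T g $ k = lfd (axis k 1) \<bullet> g"
proof -
  define a where "a = axis k (1::real)"
  define f where "f = - snd (lfd a)"
  let ?S = "\<lambda>f. snd (T (0, f))"
  have lfd: "lfd a = (a, - f)" by (simp add: prod_eq_iff f_def fst_lfd)
  have fW: "f \<in> W" using lfd_in[of a] lfd subspace_neg[OF subspace] by (metis SigmaE2 minus_minus)
  have inj: "inj_on ?S W"
  proof (rule inj_onI)
    fix x y assume xy: "x \<in> W" "y \<in> W" "?S x = ?S y"
    have in': "(0, x - y) \<in> UNIV \<times> W" using xy subspace_diff[OF subspace] by auto
    have "(0, x - y) = (0, x) - ((0::real^'p), y)" by simp
    then have "?S (x - y) = 0" using xy(3) by (simp only: linear_diff[OF linear] snd_diff) simp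
    then have "(0, x - y) \<bullet> T (0, x - y) = 0" by (simp add: inner_prod_def)
    then show "x = y" using pos[OF in'] by (force simp: zero_prod_def)
  qed
  have "(a, 0) = lfd a + (0, f)" by (simp add: lfd)
  then have "T (a, 0) = T (lfd a) + T (0, f)" using linear_add[OF linear] by metis
  then have "snd (T (a, 0)) = ?S f" by (simp add: T_lfd)
  then have "inv_into W ?S (snd (T (axis k 1, 0))) = f"
    using inv_into_f_f[OF inj fW] by (simp add: a_def)
  then have "eff_score W T g $ k = fst g $ k - f \<bullet> snd g" by (simp add: eff_score_def)
  also have "\<dots> = (a, - f) \<bullet> g" by (simp add: inner_prod_def a_def inner_axis')
  also have "\<dots> = lfd a \<bullet> g" by (simp only: lfd)
  finally show ?thesis by (simp add: a_def)
qed

lemma eff_score_inner: "t \<bullet> eff_score W T g = lfd t \<bullet> g"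
proof -
  have "lfd t = lfd (\<Sum>k\<in>UNIV. t $ k *\<^sub>R axis k 1)"
    using basis_expansion[of t] by (simp add: scalar_mult_eq_scaleR)
  also have "\<dots> = (\<Sum>k\<in>UNIV. t $ k *\<^sub>R lfd (axis k 1))"
    by (simp add: linear_sum[OF linear_lfd] linear_scale[OF linear_lfd])
  finally show ?thesis by (simp add: inner_vec_def eff_score_nth inner_sum_left)
qed

text \<open>The information of \<open>n\<close> observations is \<open>n\<close> times that of one.
  Under such a factor \<open>dir\<close> scales inversely and the efficient information linearly,
  while least favourable directions and efficient scores do not change.\<close>

lemma eff_block_scaleR:
  assumes "0 < c"
  shows "eff_block W (\<lambda>u. c *\<^sub>R T u)"
proof (rule eff_block.intro)
  show "subspace W" by (rule subspace)
  show "Real_Vector_Spaces.linear (\<lambda>u. c *\<^sub>R T u)" using linear by (rule linear_compose_scale_right)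
  show "(\<lambda>u. c *\<^sub>R T u) ` (UNIV \<times> W) \<subseteq> UNIV \<times> W"
    using range subspace_scale[OF subspace_UNIV_Times] by blast
  show "pos_def_on (UNIV \<times> W) (\<lambda>u. c *\<^sub>R T u)" using pos_def assms by (auto simp: pos_def_on_def)
  show "(t, 0) \<in> (\<lambda>u. c *\<^sub>R T u) ` (UNIV \<times> W)" for t
  proof (rule image_eqI)
    show "(t, 0) = c *\<^sub>R T (dir ((1 / c) *\<^sub>R t))" using assms by (simp add: T_dir)
  qed (rule dir_in)
qed

lemma dir_scaleR:
  assumes "0 < c"
  shows "eff_block.dir W (\<lambda>u. c *\<^sub>R T u) t = (1 / c) *\<^sub>R dir t"
  using assms subspace_scale[OF subspace_UNIV_Times dir_in]
  by (intro eff_block.dir_eqI[OF eff_block_scaleR[OF assms]])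
     (simp_all add: linear_scale[OF linear] T_dir)

lemma eff_info_scaleR:
  assumes c: "0 < c"
  shows "eff_info W (\<lambda>u. c *\<^sub>R T u) = c *\<^sub>R E"
proof -
  interpret c: eff_block W "\<lambda>u. c *\<^sub>R T u" by (rule eff_block_scaleR[OF c])
  have "c.E *v fst (dir t) = c *\<^sub>R t" for t
    using c.E_fst_dir[of "c *\<^sub>R t"] c linear_scale[OF linear_dir, of c t] by (simp add: dir_scaleR[OF c])
  from this[of "E *v _"] have "c.E *v t = c *\<^sub>R (E *v t)" for t by (simp add: fst_dir_E)
  then show ?thesis by (simp add: matrix_eq scaleR_matrix_vector)
qed

lemma lfd_scaleR:
  assumes c: "0 < c"
  shows "eff_block.lfd W (\<lambda>u. c *\<^sub>R T u) t = lfd t"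
  using c linear_scale[OF linear_dir]
  by (simp add: eff_block.lfd_def[OF eff_block_scaleR[OF c]] dir_scaleR[OF c] eff_info_scaleR[OF c]
      lfd_def scaleR_matrix_vector)

lemma eff_score_scaleR:
  assumes c: "0 < c"
  shows "eff_score W (\<lambda>u. c *\<^sub>R T u) g = eff_score W T g"
  by (simp add: vec_eq_iff eff_score_nth eff_block.eff_score_nth[OF eff_block_scaleR[OF c]] lfd_scaleR[OF c])

end

text \<open>In finite dimension solvability is automatic, since positive definite operators are
  onto.\<close>

lemma eff_blockI:
  fixes W :: "'x::real_inner set" and B :: "((real^'p) \<times> 'x) set" and T
  assumes "pos_def_operator B T" "span B = UNIV \<times> W" "subspace W"
  shows "eff_block W T"
proof -
  interpret pos_def_operator B T by fact
  show ?thesis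
  proof (rule eff_block.intro)
    show "(t, 0) \<in> T ` (UNIV \<times> W)" for t
    proof -
      have "(t, 0) \<in> span B" using assms(2) subspace_0[OF assms(3)] by simp
      from surj_on[OF this] show ?thesis unfolding assms(2)[symmetric] by (metis imageI)
    qed
  qed (use assms linear range pos_def in auto)
qed

section \<open>Chaining for processes with sub-exponential increments\<close>

text \<open>For positive \<open>g\<close> and \<open>y\<close> this is the minimum of
  \<open>y / s + s / 2\<close> over \<open>0 < s \<le> g\<close>, the best threshold of a Chernoff
  bound whose exponents are limited by \<open>g\<close>; the branches are the interior and the
  boundary minimum.\<close>

definition zq :: "real \<Rightarrow> real \<Rightarrow> real" where
  "zq g y = (if sqrt (2 * y) \<le> g then sqrt (2 * y) else y / g + g / 2)"

lemma z_quantile_eq: "z_quantile g x p = zq g (x + 4 * p)"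
  by (simp add: z_quantile_def zq_def Let_def)

lemma zq_le:
  assumes "0 < s" "s \<le> g" "0 \<le> y"
  shows "zq g y \<le> y / s + s / 2"
proof (cases "sqrt (2 * y) \<le> g")
  case True
  have "0 \<le> (sqrt (2 * y) - s)\<^sup>2" by simp
  also have "\<dots> = 2 * y - 2 * s * sqrt (2 * y) + s\<^sup>2" using assms by (simp add: power2_diff)
  finally show ?thesis using True assms by (simp add: zq_def field_simps power2_eq_square)
next
  case False
  have "g * g < sqrt (2 * y) * sqrt (2 * y)"
    by (rule mult_strict_mono) (use False assms in \<open>linarith+\<close>)
  moreover have "g * s \<le> g * g" using assms by (intro mult_left_mono) auto
  moreover have "sqrt (2 * y) * sqrt (2 * y) = 2 * y" using assms by simp
  ultimately have "g * s \<le> 2 * y" by linarith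
  then have "0 \<le> (g - s) * (2 * y - g * s)" using assms by simp
  then show ?thesis using False assms by (simp add: zq_def field_simps power2_eq_square)
qed

lemma zq_attained:
  assumes "0 < g" "0 < y"
  obtains s where "0 < s" "s \<le> g" "zq g y = y / s + s / 2"
proof (cases "sqrt (2 * y) \<le> g")
  case True
  have "sqrt (2 * y) = y / sqrt (2 * y) + sqrt (2 * y) / 2"
    using assms by (simp add: field_simps)
  with True show ?thesis using that[of "sqrt (2 * y)"] assms by (simp add: zq_def)
qed (use that[of g] assms in \<open>auto simp: zq_def\<close>)

lemma zq_nonneg: "0 < g \<Longrightarrow> 0 < y \<Longrightarrow> 0 \<le> zq g y"
  by (simp add: zq_def)

text \<open>The minimiser for \<open>y\<close> is inserted at level \<open>c * y\<close>, where only
  the first summand grows.\<close>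

lemma zq_mult_le:
  assumes "0 < g" "0 < y" "1 \<le> c"
  shows "zq g (c * y) \<le> c * zq g y"
proof -
  obtain s where s: "0 < s" "s \<le> g" "zq g y = y / s + s / 2" using zq_attained assms(1,2) .
  have "zq g (c * y) \<le> c * y / s + s / 2" using s assms by (intro zq_le) auto
  also have "\<dots> \<le> c * (y / s + s / 2)"
    using s assms mult_right_mono[of 1 c s] by (simp add: distrib_left)
  finally show ?thesis using s by simp
qed

text \<open>Integrability of one exponential moment already contains measurability, recovered
  through the logarithm.\<close>

lemma log_mgf_bound_measurable:
  assumes "log_mgf_bound M X \<nu> g" "0 < g"
  shows "X \<in> borel_measurable M"
proof -
  have "integrable M (\<lambda>w. exp (g * X w))" using assms by (auto simp: log_mgf_bound_def)
  then have "(\<lambda>w. exp (g * X w)) \<in> borel_measurable M" by simp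
  then have "(\<lambda>w. ln (exp (g * X w)) / g) \<in> borel_measurable M" by measurable
  then show ?thesis using assms by simp
qed

lemma (in prob_space) log_mgf_bound_tail:
  assumes X: "log_mgf_bound M X \<nu> g" and pos: "0 < \<nu>" "0 < g" "0 < y"
  shows "measure M {w \<in> space M. \<bar>X w\<bar> > \<nu> * zq (\<nu> * g) y} \<le> 2 * exp (- y)"
proof -
  note [measurable] = log_mgf_bound_measurable[OF X pos(2)]
  obtain s where s: "0 < s" "s \<le> \<nu> * g" "zq (\<nu> * g) y = y / s + s / 2"
    using zq_attained[of "\<nu> * g" y] pos by auto
  let ?a = "\<nu> * zq (\<nu> * g) y" and ?c = "s / \<nu>"
  \<comment> \<open>With the exponent \<open>s / \<nu>\<close> the threshold contributes
    \<open>y\<close> plus exactly the term \<open>s\<^sup>2 / 2\<close> that the moment bound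
    costs.\<close>
  have sa: "?c * ?a = y + s\<^sup>2 / 2" using pos s by (simp add: field_simps power2_eq_square)
  have *: "measure M {w \<in> space M. ?a \<le> e * X w} \<le> exp (- y)" if e: "\<bar>e\<bar> = 1" for e
  proof -
    have c: "\<bar>?c * e\<bar> \<le> g" using s pos e by (simp add: abs_mult field_simps)
    have int: "integrable M (\<lambda>w. exp (?c * e * X w))"
      and ln: "ln (\<integral>w. exp (?c * e * X w) \<partial>M) \<le> \<nu>\<^sup>2 * (?c * e)\<^sup>2 / 2"
      using X c unfolding log_mgf_bound_def by blast+
    have e2: "e\<^sup>2 = 1" using e by (metis power2_abs one_power2)
    \<comment> \<open>The bound on \<open>ln\<close> restrains the integral only once the integral
      is known to be positive.\<close>
    have "0 < (\<integral>w. exp (?c * e * X w) \<partial>M)"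
      using integral_less_AE_space[of "\<lambda>_. 0" "\<lambda>w. exp (?c * e * X w)"] int emeasure_space_1 by simp
    then have le: "(\<integral>w. exp (?c * e * X w) \<partial>M) \<le> exp (s\<^sup>2 / 2)"
      using ln pos exp_le_cancel_iff[of "ln (\<integral>w. exp (?c * e * X w) \<partial>M)" "s\<^sup>2 / 2"]
      by (simp add: power_mult_distrib power_divide e2)
    have "{w \<in> space M. ?a \<le> e * X w} = {w \<in> space M. exp (?c * ?a) \<le> exp (?c * e * X w)}"
      using pos s by (simp add: mult.assoc pos_divide_le_eq field_simps)
    also have "measure M \<dots> \<le> (\<integral>w. exp (?c * e * X w) \<partial>M) / exp (?c * ?a)"
      by (rule integral_Markov_inequality_measure[OF int, of "{}"]) auto
    also have "\<dots> \<le> exp (s\<^sup>2 / 2) / exp (?c * ?a)" using le by (simp add: divide_right_mono)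
    also have "\<dots> = exp (- y)" unfolding sa by (simp add: exp_diff[symmetric])
    finally show ?thesis .
  qed
  have "measure M {w \<in> space M. \<bar>X w\<bar> > ?a}
      \<le> measure M ({w \<in> space M. ?a \<le> 1 * X w} \<union> {w \<in> space M. ?a \<le> (-1) * X w})"
    by (rule finite_measure_mono) auto
  also have "\<dots> \<le> measure M {w \<in> space M. ?a \<le> 1 * X w} + measure M {w \<in> space M. ?a \<le> (-1) * X w}"
    by (rule measure_Un_le) auto
  also have "\<dots> \<le> exp (- y) + exp (- y)" by (intro add_mono *) auto
  finally show ?thesis by simp
qed

lemma sum_Suc_div_power2: "(\<Sum>j<n. real (j + 1) / 2 ^ j) \<le> 4"
proof -
  have "(\<Sum>j<n. real (j + 1) / 2 ^ j) = 4 - (2 * real n + 4) / 2 ^ n"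
  proof (induction n)
    case (Suc n)
    have "(2 * real n + 4) / 2 ^ n = (4 * real n + 8) / 2 ^ Suc n"
      "real (n + 1) / 2 ^ n = (2 * real n + 2) / 2 ^ Suc n" by (auto simp: field_simps)
    then show ?case using Suc by (simp add: add_divide_distrib)
  qed simp
  then show ?thesis by simp
qed

text \<open>
  The j-th link of a chain is allowed to exceed its scale by the quantile at level
  3 (j + 1) (x + 4 D), whose tail beats the number exp (D (2 j + 9)) of possible links;
  sublinearity of the quantile makes these thresholds summable.
\<close>

lemma (in prob_space) chaining_bound:
  fixes f :: "'u \<Rightarrow> 'a \<Rightarrow> real" and \<pi> :: "nat \<Rightarrow> 'u \<Rightarrow> 'u"
  assumes pos: "0 < \<nu>" "0 < g" "0 \<le> \<rho>" "0 \<le> D" "1 \<le> x"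
    and inc: "\<And>u v. u \<in> S \<Longrightarrow> v \<in> S \<Longrightarrow> u \<noteq> v \<Longrightarrow>
        0 < d u v \<and> log_mgf_bound M (\<lambda>w. (f u w - f v w) / d u v) \<nu> g"
    and \<pi>: "\<And>j u. u \<in> S \<Longrightarrow> \<pi> j u \<in> S" "\<And>u. u \<in> S \<Longrightarrow> \<pi> 0 u = u0"
    and step: "\<And>j u. u \<in> S \<Longrightarrow> d (\<pi> j u) (\<pi> (Suc j) u) \<le> \<rho> / 2 ^ j"
    and fin: "\<And>j. finite (\<pi> j ` S)" "\<And>j. real (card (\<pi> j ` S)) \<le> exp (D * (real j + 4))"
    and conv: "\<And>w u. w \<in> space M \<Longrightarrow> u \<in> S \<Longrightarrow> (\<lambda>j. f (\<pi> j u) w) \<longlonglongrightarrow> f u w"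
  obtains A where "A \<in> sets M" "measure M A \<le> 2 * exp (- x)"
    "\<And>w u. w \<in> space M - A \<Longrightarrow> u \<in> S \<Longrightarrow> \<bar>f u w - f u0 w\<bar> \<le> 12 * \<rho> * \<nu> * zq (\<nu> * g) (x + 4 * D)"
proof -
  define y where "y = x + 4 * D"
  have y: "0 < y" using pos by (simp add: y_def)
  define z where "z j = \<nu> * zq (\<nu> * g) (3 * real (j + 1) * y)" for j
  \<comment> \<open>The increment hypothesis covers distinct points, so trivial links are left out;
    they contribute nothing to the chain.\<close>
  define L where "L j = {p \<in> (\<lambda>u. (\<pi> j u, \<pi> (Suc j) u)) ` S. fst p \<noteq> snd p}" for j
  define E where "E p j = {w \<in> space M. \<bar>(f (fst p) w - f (snd p) w) / d (fst p) (snd p)\<bar> > z j}" for p j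
  define A where "A j = (\<Union>p\<in>L j. E p j)" for j
  have Lsub: "L j \<subseteq> (\<pi> j ` S) \<times> (\<pi> (Suc j) ` S)" for j by (auto simp: L_def)
  have finL: "finite (L j)" for j using Lsub fin(1) by (meson finite_SigmaI finite_subset)
  have LS: "fst p \<in> S" "snd p \<in> S" "fst p \<noteq> snd p" if "p \<in> L j" for p j
    using that \<pi>(1) by (auto simp: L_def)
  have cardL: "real (card (L j)) \<le> exp (D * (2 * j + 9))" for j
  proof -
    have "card (L j) \<le> card ((\<pi> j ` S) \<times> (\<pi> (Suc j) ` S))"
      by (intro card_mono finite_cartesian_product fin Lsub)
    then have "real (card (L j)) \<le> real (card (\<pi> j ` S)) * real (card (\<pi> (Suc j) ` S))"
      by (simp add: card_cartesian_product flip: of_nat_mult)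
    also have "\<dots> \<le> exp (D * (real j + 4)) * exp (D * (real (Suc j) + 4))" by (intro mult_mono fin) auto
    also have "\<dots> = exp (D * (2 * j + 9))" by (simp add: exp_add[symmetric] algebra_simps)
    finally show ?thesis .
  qed
  have Emeas: "E p j \<in> sets M" "measure M (E p j) \<le> 2 * exp (- (3 * real (j + 1) * y))" if p: "p \<in> L j" for p j
  proof -
    have mgf: "log_mgf_bound M (\<lambda>w. (f (fst p) w - f (snd p) w) / d (fst p) (snd p)) \<nu> g"
      using inc LS[OF p] by blast
    note [measurable] = log_mgf_bound_measurable[OF mgf pos(2)]
    show "E p j \<in> sets M" unfolding E_def by measurable
    show "measure M (E p j) \<le> 2 * exp (- (3 * real (j + 1) * y))"
      unfolding E_def z_def using log_mgf_bound_tail[OF mgf pos(1,2)] y by simp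
  qed
  have Ameas: "A j \<in> sets M" for j unfolding A_def using Emeas finL by blast
  have Abound: "measure M (A j) \<le> 2 * exp (- x) * (1 / 2) ^ Suc j" for j
  proof -
    have "measure M (A j) \<le> (\<Sum>p\<in>L j. measure M (E p j))"
      unfolding A_def using Emeas finL by (intro finite_measure_subadditive_finite) auto
    also have "\<dots> \<le> real (card (L j)) * (2 * exp (- (3 * real (j + 1) * y)))"
      using sum_bounded_above[of "L j" "\<lambda>p. measure M (E p j)"] Emeas(2) by simp
    also have "\<dots> \<le> exp (D * (2 * j + 9)) * (2 * exp (- (3 * real (j + 1) * y)))"
      by (intro mult_right_mono cardL) simp
    also have "\<dots> = 2 * exp (D * (2 * j + 9) - 3 * real (j + 1) * y)"
      by (simp add: exp_add[symmetric] exp_diff exp_minus field_simps)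
    \<comment> \<open>Of the exponent \<open>3 * (j + 1) * (x + 4 * D)\<close> the part
      \<open>12 * D * (j + 1)\<close> absorbs the number of links and leaves
      \<open>D * (10 * j + 3)\<close>. From the rest, one copy of \<open>(j + 1) * x\<close> yields
      \<open>x\<close> and another the geometric decay in \<open>j\<close>.\<close>
    also have "D * (2 * j + 9) - 3 * real (j + 1) * y \<le> - x - real (j + 1)"
    proof -
      have "D * (2 * j + 9) - 3 * real (j + 1) * y = - (D * (10 * j + 3)) - 3 * real (j + 1) * x"
        by (simp add: y_def algebra_simps)
      also have "- (D * (10 * j + 3)) - 3 * real (j + 1) * x \<le> - (real (j + 1) * x) - (real (j + 1) * x)"
      proof -
        have "0 \<le> D * (10 * j + 3)" "0 \<le> real (j + 1) * x" using pos by auto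
        then show ?thesis by linarith
      qed
      also have "\<dots> \<le> - x - real (j + 1)"
      proof -
        have "- (a * x) - (a * x) \<le> - x - a" if "1 \<le> a" for a
        proof -
          have "1 * x \<le> a * x" "a * 1 \<le> a * x"
            using pos that by (intro mult_right_mono mult_left_mono; simp)+
          then show ?thesis by linarith
        qed
        moreover have "1 \<le> real (j + 1)" by simp
        ultimately show ?thesis by blast
      qed
      finally show ?thesis by simp
    qed
    then have "2 * exp (D * (2 * j + 9) - 3 * real (j + 1) * y) \<le> 2 * exp (- x - real (j + 1))" by simp
    also have "\<dots> = 2 * exp (- x) * exp (-1) ^ Suc j"
      by (simp add: exp_of_nat_mult[symmetric] exp_add[symmetric] algebra_simps)
    also have "\<dots> \<le> 2 * exp (- x) * (1 / 2) ^ Suc j"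
    proof -
      have "exp (1::real) \<ge> 2" using exp_ge_add_one_self[of 1] by simp
      then have "exp (-1::real) \<le> 1 / 2" by (simp add: exp_minus field_simps)
      then show ?thesis by (intro mult_left_mono power_mono) auto
    qed
    finally show ?thesis .
  qed
  have sums: "(\<lambda>j. 2 * exp (- x) * (1 / 2) ^ Suc j) sums (2 * exp (- x) * 1)"
    by (intro sums_mult power_half_series)
  have summ: "summable (\<lambda>j. measure M (A j))"
    using Abound by (intro summable_comparison_test'[OF sums_summable[OF sums]]) auto
  have "measure M (\<Union>j. A j) \<le> (\<Sum>j. measure M (A j))"
    using Ameas summ by (intro finite_measure_subadditive_countably) auto
  also have "\<dots> \<le> (\<Sum>j. 2 * exp (- x) * (1 / 2) ^ Suc j)"
    by (intro suminf_le Abound summ sums_summable[OF sums])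
  also have "\<dots> = 2 * exp (- x)" using sums_unique[OF sums, symmetric] by (simp only: mult_1_right)
  finally have PA: "measure M (\<Union>j. A j) \<le> 2 * exp (- x)" .
  have bound: "\<bar>f u w - f u0 w\<bar> \<le> 12 * \<rho> * \<nu> * zq (\<nu> * g) y"
    if w: "w \<in> space M - (\<Union>j. A j)" and u: "u \<in> S" for w u
  proof -
    let ?z = "\<nu> * zq (\<nu> * g) y"
    have z0: "0 \<le> ?z" using pos y by (simp add: zq_nonneg)
    \<comment> \<open>Sublinearity takes the factor \<open>3 * (j + 1)\<close> out of the quantile;
      the sum of \<open>(j + 1) / 2 ^ j\<close> is at most 4, which gives the constant 12.\<close>
    have link: "\<bar>f (\<pi> (Suc j) u) w - f (\<pi> j u) w\<bar> \<le> 3 * \<rho> * ?z * (real (j + 1) / 2 ^ j)" for j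
    proof (cases "\<pi> j u = \<pi> (Suc j) u")
      case True then show ?thesis using z0 pos by simp
    next
      case False
      then have p: "(\<pi> j u, \<pi> (Suc j) u) \<in> L j" using u by (auto simp: L_def)
      let ?d = "d (\<pi> j u) (\<pi> (Suc j) u)"
      have d0: "0 < ?d" using inc LS[OF p] by simp
      have "w \<notin> E (\<pi> j u, \<pi> (Suc j) u) j" using w p by (auto simp: A_def)
      then have "\<bar>f (\<pi> j u) w - f (\<pi> (Suc j) u) w\<bar> / ?d \<le> z j"
        using w d0 by (simp add: E_def not_less abs_divide)
      then have "\<bar>f (\<pi> (Suc j) u) w - f (\<pi> j u) w\<bar> \<le> z j * ?d"
        using d0 by (simp add: field_simps abs_minus_commute)
      also have "\<dots> \<le> (3 * real (j + 1) * ?z) * (\<rho> / 2 ^ j)"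
      proof (rule mult_mono)
        have "zq (\<nu> * g) (3 * real (j + 1) * y) \<le> 3 * real (j + 1) * zq (\<nu> * g) y"
          using pos y by (intro zq_mult_le) auto
        then show "z j \<le> 3 * real (j + 1) * ?z"
          using pos mult_left_mono[of _ _ \<nu>] by (fastforce simp: z_def mult_ac)
      qed (use d0 step[OF u] z0 in auto)
      also have "\<dots> = 3 * \<rho> * ?z * (real (j + 1) / 2 ^ j)" by (simp add: field_simps)
      finally show ?thesis .
    qed
    have "\<bar>f (\<pi> n u) w - f u0 w\<bar> \<le> 12 * \<rho> * ?z" for n
    proof -
      have "f (\<pi> n u) w - f u0 w = (\<Sum>j<n. f (\<pi> (Suc j) u) w - f (\<pi> j u) w)"
        using sum_lessThan_telescope[of "\<lambda>j. f (\<pi> j u) w" n] \<pi>(2)[OF u] by simp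
      also have "\<bar>\<dots>\<bar> \<le> (\<Sum>j<n. 3 * \<rho> * ?z * (real (j + 1) / 2 ^ j))"
        by (intro order_trans[OF sum_abs] sum_mono link)
      also have "\<dots> = 3 * \<rho> * ?z * (\<Sum>j<n. real (j + 1) / 2 ^ j)" by (simp add: sum_distrib_left)
      also have "\<dots> \<le> 3 * \<rho> * ?z * 4"
        using z0 pos sum_Suc_div_power2[of n] by (intro mult_left_mono) auto
      finally show ?thesis by simp
    qed
    \<comment> \<open>The bound passes from net points to \<open>u\<close> by continuity of the
      path, so the exceptional event is a countable union over links.\<close>
    moreover have "(\<lambda>n. \<bar>f (\<pi> n u) w - f u0 w\<bar>) \<longlonglongrightarrow> \<bar>f u w - f u0 w\<bar>"
      using conv[of w u] w u by (intro tendsto_intros) auto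
    ultimately show ?thesis using LIMSEQ_le_const2 by (fastforce simp: mult.assoc)
  qed
  show ?thesis
    by (rule that[of "\<Union>j. A j"]) (use Ameas PA bound in \<open>auto simp: y_def\<close>)
qed

section \<open>Metric entropy linear in the dimension\<close>

lemma sum_power_nat_abs_le:
  fixes q :: real
  assumes q: "0 \<le> q" "q < 1"
  shows "(\<Sum>k\<in>{-int N..int N}. q ^ nat \<bar>k\<bar>) \<le> 2 / (1 - q)"
proof -
  have geo: "(\<Sum>k\<le>N. q ^ k) \<le> 1 / (1 - q)"
  proof -
    have "(\<Sum>k\<le>N. q ^ k) \<le> (\<Sum>k. q ^ k)" using q by (intro sum_le_suminf summable_geometric) auto
    then show ?thesis using q by (simp add: suminf_geometric)
  qed
  have "{-int N..int N} \<subseteq> int ` {..N} \<union> (\<lambda>k. - int k) ` {..N}"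
  proof
    fix k assume "k \<in> {-int N..int N}"
    then have "k = int (nat k) \<and> nat k \<le> N \<or> k = - int (nat (- k)) \<and> nat (- k) \<le> N" by auto
    then show "k \<in> int ` {..N} \<union> (\<lambda>k. - int k) ` {..N}" by (metis UnI1 UnI2 atMost_iff image_eqI)
  qed
  then have "(\<Sum>k\<in>{-int N..int N}. q ^ nat \<bar>k\<bar>) \<le> (\<Sum>k\<in>int ` {..N} \<union> (\<lambda>k. - int k) ` {..N}. q ^ nat \<bar>k\<bar>)"
    using q by (intro sum_mono2) auto
  also have "\<dots> \<le> (\<Sum>k\<in>int ` {..N}. q ^ nat \<bar>k\<bar>) + (\<Sum>k\<in>(\<lambda>k. - int k) ` {..N}. q ^ nat \<bar>k\<bar>)"
    using q by (simp add: sum_Un sum_nonneg)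
  also have "\<dots> = (\<Sum>k\<le>N. q ^ k) + (\<Sum>k\<le>N. q ^ k)"
    by (simp add: sum.reindex inj_on_def)
  also have "\<dots> \<le> 2 / (1 - q)" using geo by simp
  finally show ?thesis .
qed

text \<open>Each point is weighted by \<open>q\<close> to the power of its l1 norm: every weight is
  at least \<open>q ^ (card I * K)\<close>, while the total weight factorises over coordinates into
  geometric sums. Unlike the enclosing cube, the l1 ball has a log-cardinality linear in
  \<open>card I\<close> for fixed \<open>K\<close>.\<close>

lemma card_lattice_points:
  fixes I :: "'i set" and K :: nat
  assumes I: "finite I" and K: "0 < K"
  defines "Z \<equiv> {z \<in> I \<rightarrow>\<^sub>E (UNIV :: int set). (\<Sum>i\<in>I. \<bar>z i\<bar>) \<le> int (card I * K)}"
  shows "finite Z" "real (card Z) \<le> (exp 1 * (2 * (K + 1))) ^ card I"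
proof -
  define N where "N = card I * K"
  let ?F = "I \<rightarrow>\<^sub>E {-int N..int N}"
  have sub: "Z \<subseteq> ?F"
  proof
    fix z assume z: "z \<in> Z"
    have "\<bar>z i\<bar> \<le> int N" if "i \<in> I" for i
      using member_le_sum[of i I "\<lambda>i. \<bar>z i\<bar>"] that I z by (auto simp: Z_def N_def)
    then show "z \<in> ?F" using z by (auto simp: Z_def PiE_def abs_le_iff Pi_def minus_le_iff)
  qed
  have finF: "finite ?F" using I by (intro finite_PiE) auto
  show "finite Z" using sub finF by (rule finite_subset)
  \<comment> \<open>This choice gives \<open>1 / (1 - q) = K + 1\<close> and keeps
    \<open>(1 / q) ^ K\<close>, which is \<open>(1 + 1 / K) ^ K\<close>, below
    \<open>exp 1\<close>.\<close>
  define q where "q = real K / real (K + 1)"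
  have q: "0 < q" "q < 1" using K by (auto simp: q_def)
  have "real (card Z) * q ^ N = (\<Sum>z\<in>Z. q ^ N)" by simp
  also have "\<dots> \<le> (\<Sum>z\<in>Z. \<Prod>i\<in>I. q ^ nat \<bar>z i\<bar>)"
  proof (intro sum_mono)
    fix z assume z: "z \<in> Z"
    have "int (\<Sum>i\<in>I. nat \<bar>z i\<bar>) = (\<Sum>i\<in>I. \<bar>z i\<bar>)" by simp
    also have "\<dots> \<le> int N" using z by (simp add: Z_def N_def)
    finally have "(\<Sum>i\<in>I. nat \<bar>z i\<bar>) \<le> N" by (simp only: of_nat_le_iff)
    then have "q ^ N \<le> q ^ (\<Sum>i\<in>I. nat \<bar>z i\<bar>)" using q by (intro power_decreasing) auto
    then show "q ^ N \<le> (\<Prod>i\<in>I. q ^ nat \<bar>z i\<bar>)" by (simp add: power_sum)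
  qed
  also have "\<dots> \<le> (\<Sum>z\<in>?F. \<Prod>i\<in>I. q ^ nat \<bar>z i\<bar>)"
    using q by (intro sum_mono2 finF sub prod_nonneg) auto
  also have "\<dots> = (\<Prod>i\<in>I. \<Sum>k\<in>{-int N..int N}. q ^ nat \<bar>k\<bar>)"
    using I by (subst prod_sum_PiE) auto
  also have "\<dots> = (\<Sum>k\<in>{-int N..int N}. q ^ nat \<bar>k\<bar>) ^ card I" by simp
  also have "\<dots> \<le> (2 / (1 - q)) ^ card I"
    using q by (intro power_mono sum_power_nat_abs_le sum_nonneg) auto
  also have "2 / (1 - q) = 2 * (K + 1)" by (simp add: q_def field_simps)
  finally have le: "real (card Z) * q ^ N \<le> (2 * real (K + 1)) ^ card I" by simp
  have "(1 / q) ^ K \<le> exp 1"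
  proof -
    have "1 / q = 1 + 1 / real K" using K by (simp add: q_def field_simps)
    then have "1 / q \<le> exp (1 / real K)" using exp_ge_add_one_self[of "1 / real K"] by simp
    then have "(1 / q) ^ K \<le> exp (1 / real K) ^ K" using q by (intro power_mono) auto
    also have "\<dots> = exp 1" using K by (simp add: exp_of_nat_mult[symmetric])
    finally show ?thesis .
  qed
  then have "((1 / q) ^ K) ^ card I \<le> exp 1 ^ card I" using q by (intro power_mono) auto
  then have qN: "(1 / q) ^ N \<le> exp 1 ^ card I" by (simp add: N_def power_mult[symmetric] mult.commute)
  have "real (card Z) = (real (card Z) * q ^ N) * (1 / q) ^ N" using q by (simp add: power_divide)
  also have "\<dots> \<le> (2 * real (K + 1)) ^ card I * exp 1 ^ card I"
    using q by (intro mult_mono le qN) auto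
  finally show "real (card Z) \<le> (exp 1 * (2 * (K + 1))) ^ card I"
    by (simp add: power_mult_distrib mult.commute)
qed

text \<open>Points are rounded to grid cells, and each occupied cell is represented by one of its
  points in \<open>S\<close>, so that the nets stay where increments are controlled. By
  Cauchy-Schwarz the integer keys of a Euclidean ball lie in an l1 ball, whose count is the entropy
  bound.\<close>

lemma nested_nets:
  fixes S :: "'a::real_inner set"
  assumes B: "orthonormal_set B" "B \<noteq> {}" and S: "S \<subseteq> span B" "\<And>u. u \<in> S \<Longrightarrow> norm u \<le> R"
    and R: "0 < R" and u0: "u0 \<in> S"
  obtains \<pi> :: "nat \<Rightarrow> 'a \<Rightarrow> 'a" where
    "\<And>j u. u \<in> S \<Longrightarrow> \<pi> j u \<in> S" "\<And>u. \<pi> 0 u = u0"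
    "\<And>j u. u \<in> S \<Longrightarrow> norm (\<pi> j u - \<pi> (Suc j) u) \<le> 4 * R / 2 ^ j"
    "\<And>j u. u \<in> S \<Longrightarrow> norm (\<pi> j u - u) \<le> 2 * R / 2 ^ j"
    "\<And>j. finite (\<pi> j ` S)" "\<And>j. real (card (\<pi> j ` S)) \<le> exp (card B * (real j + 4))"
proof -
  define d where "d = card B"
  have d: "0 < d" using B orthonormal_setD(1) by (auto simp: d_def card_gt_0_iff)
  \<comment> \<open>With this mesh, \<open>d\<close> coordinates that each differ by at most
    \<open>h j\<close> give a distance of at most \<open>R / 2 ^ j\<close>.\<close>
  define h where "h j = R / (2 ^ j * sqrt d)" for j :: nat
  have h: "0 < h j" for j using R d by (simp add: h_def)
  define key where "key j u = (\<lambda>b\<in>B. \<lfloor>(u \<bullet> b) / h j\<rfloor>)" for j u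
  define rep where "rep j k = (SOME v. v \<in> S \<and> key j v = k)" for j k
  \<comment> \<open>Level 0 is the single point \<open>u0\<close>, at distance up to
    \<open>2 * R\<close> from the others; hence the factor 2 in the closeness bound.\<close>
  define \<pi> where "\<pi> j u = (if j = 0 then u0 else rep j (key j u))" for j u
  have rep: "rep j (key j u) \<in> S" "key j (rep j (key j u)) = key j u" if "u \<in> S" for j u
    using someI[of "\<lambda>v. v \<in> S \<and> key j v = key j u" u] that by (auto simp: rep_def)
  have \<pi>S: "\<pi> j u \<in> S" if "u \<in> S" for j u using that rep u0 by (simp add: \<pi>_def)
  have close: "norm (\<pi> j u - u) \<le> 2 * R / 2 ^ j" if u: "u \<in> S" for j u
  proof (cases "j = 0")
    case True
    then show ?thesis using norm_triangle_ineq4[of u0 u] S(2)[OF u0] S(2)[OF u] by (simp add: \<pi>_def)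
  next
    case False
    let ?v = "\<pi> j u"
    have coord: "((?v - u) \<bullet> b)\<^sup>2 \<le> (h j)\<^sup>2" if b: "b \<in> B" for b
    proof -
      have "key j ?v b = key j u b" using rep(2)[OF u] False by (simp add: \<pi>_def)
      then have "\<lfloor>(?v \<bullet> b) / h j\<rfloor> = \<lfloor>(u \<bullet> b) / h j\<rfloor>" using b by (simp add: key_def)
      then have "\<bar>(?v \<bullet> b) / h j - (u \<bullet> b) / h j\<bar> \<le> 1" by linarith
      then have "\<bar>((?v - u) \<bullet> b) / h j\<bar> \<le> 1" by (simp add: inner_diff_left diff_divide_distrib)
      then have "\<bar>(?v - u) \<bullet> b\<bar> \<le> \<bar>h j\<bar>" using h[of j] by (simp add: abs_divide divide_le_eq)
      then show ?thesis by (rule abs_le_square_iff[THEN iffD1])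
    qed
    have "?v - u \<in> span B" using S(1) \<pi>S[OF u] u by (auto intro: span_diff)
    then have "(norm (?v - u))\<^sup>2 = (\<Sum>b\<in>B. ((?v - u) \<bullet> b)\<^sup>2)" by (rule orthonormal_norm[OF B(1)])
    also have "\<dots> \<le> real d * (h j)\<^sup>2" using sum_bounded_above[OF coord] by (simp add: d_def)
    also have "\<dots> = (R / 2 ^ j)\<^sup>2" using d by (simp add: h_def power_divide power_mult_distrib)
    finally have "norm (?v - u) \<le> R / 2 ^ j" by (rule power2_le_imp_le) (use R in auto)
    also have "\<dots> \<le> 2 * R / 2 ^ j" using R by (simp add: divide_right_mono)
    finally show ?thesis .
  qed
  have step: "norm (\<pi> j u - \<pi> (Suc j) u) \<le> 4 * R / 2 ^ j" if u: "u \<in> S" for j u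
  proof -
    have "norm (\<pi> j u - \<pi> (Suc j) u) \<le> norm (\<pi> j u - u) + norm (\<pi> (Suc j) u - u)"
      using norm_triangle_ineq4[of "\<pi> j u - u" "\<pi> (Suc j) u - u"] by simp
    also have "\<dots> \<le> 2 * R / 2 ^ j + 2 * R / 2 ^ Suc j" by (intro add_mono close u)
    also have "\<dots> \<le> 4 * R / 2 ^ j" using R by (simp add: field_simps)
    finally show ?thesis .
  qed
  have card: "finite (\<pi> j ` S) \<and> real (card (\<pi> j ` S)) \<le> exp (card B * (real j + 4))" for j
  proof (cases "j = 0")
    case True
    then have im: "\<pi> j ` S = {u0}" using u0 by (auto simp: \<pi>_def)
    show ?thesis unfolding im by simp
  next
    case False
    \<comment> \<open>The l1 norm of the scaled point is at most \<open>d * 2 ^ j\<close>, and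
      rounding adds at most 1 per coordinate.\<close>
    define K where "K = (2::nat) ^ j + 1"
    define Z where "Z = {z \<in> B \<rightarrow>\<^sub>E (UNIV :: int set). (\<Sum>i\<in>B. \<bar>z i\<bar>) \<le> int (card B * K)}"
    have Z: "finite Z" "real (card Z) \<le> (exp 1 * (2 * (K + 1))) ^ card B"
      unfolding Z_def using card_lattice_points[OF orthonormal_setD(1)[OF B(1)], of K] by (simp_all add: K_def)
    have "key j ` S \<subseteq> Z"
    proof
      fix k assume "k \<in> key j ` S"
      then obtain u where u: "u \<in> S" "k = key j u" by auto
      have "(\<Sum>b\<in>B. \<bar>u \<bullet> b\<bar>)\<^sup>2 \<le> (\<Sum>b\<in>B. \<bar>u \<bullet> b\<bar>\<^sup>2) * real d"
        unfolding d_def by (rule sum_squared_le_sum_of_squares)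
      also have "(\<Sum>b\<in>B. \<bar>u \<bullet> b\<bar>\<^sup>2) = (norm u)\<^sup>2"
        using orthonormal_norm[OF B(1)] u S(1) by (auto simp: power2_abs)
      also have "(norm u)\<^sup>2 * real d \<le> R\<^sup>2 * real d"
        using S(2)[OF u(1)] by (intro mult_right_mono power_mono) auto
      also have "\<dots> = (R * sqrt d)\<^sup>2" by (simp add: power_mult_distrib)
      finally have l1: "(\<Sum>b\<in>B. \<bar>u \<bullet> b\<bar>) \<le> R * sqrt d" by (rule power2_le_imp_le) (use R in auto)
      have "real_of_int (\<Sum>b\<in>B. \<bar>k b\<bar>) = (\<Sum>b\<in>B. \<bar>real_of_int \<lfloor>(u \<bullet> b) / h j\<rfloor>\<bar>)"
        by (simp add: u key_def)
      also have "\<dots> \<le> (\<Sum>b\<in>B. \<bar>u \<bullet> b\<bar> / h j + 1)"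
      proof (intro sum_mono)
        fix b
        have "\<bar>real_of_int \<lfloor>(u \<bullet> b) / h j\<rfloor>\<bar> \<le> \<bar>(u \<bullet> b) / h j\<bar> + 1" by linarith
        then show "\<bar>real_of_int \<lfloor>(u \<bullet> b) / h j\<rfloor>\<bar> \<le> \<bar>u \<bullet> b\<bar> / h j + 1" using h[of j] by (simp add: abs_divide)
      qed
      also have "\<dots> = (\<Sum>b\<in>B. \<bar>u \<bullet> b\<bar>) / h j + d" by (simp add: sum.distrib sum_divide_distrib d_def)
      also have "\<dots> \<le> R * sqrt d / h j + d" using l1 h[of j] by (simp add: divide_right_mono)
      also have "\<dots> = real d * K" using R d by (simp add: h_def K_def field_simps)
      finally have "real_of_int (\<Sum>b\<in>B. \<bar>k b\<bar>) \<le> real_of_int (int (card B * K))" by (simp add: d_def)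
      then have "(\<Sum>b\<in>B. \<bar>k b\<bar>) \<le> int (card B * K)" by (simp only: of_int_le_iff)
      then show "k \<in> Z" by (auto simp: Z_def u key_def)
    qed
    then have keys: "finite (key j ` S)" "card (key j ` S) \<le> card Z"
      using Z(1) by (auto intro: finite_subset card_mono)
    have im: "\<pi> j ` S = rep j ` key j ` S" using False by (auto simp: \<pi>_def)
    have "real (card (\<pi> j ` S)) \<le> real (card (key j ` S))"
      unfolding im using card_image_le[OF keys(1)] by simp
    also have "\<dots> \<le> real (card Z)" using keys by simp
    also have "\<dots> \<le> (exp 1 * (2 * (K + 1))) ^ card B" by (rule Z)
    \<comment> \<open>\<open>2 * (K + 1)\<close> equals \<open>2 * 2 ^ j + 4\<close>, which
      \<open>exp (j + 3)\<close> dominates; the factor \<open>exp 1\<close> of the lattice count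
      raises this to \<open>j + 4\<close>.\<close>
    also have "\<dots> \<le> (exp 1 * exp (real j + 3)) ^ card B"
    proof (intro power_mono mult_left_mono)
      have "exp (1::real) \<ge> 2" using exp_ge_add_one_self[of 1] by simp
      then have "(2::real) ^ (j + 3) \<le> exp 1 ^ (j + 3)" by (intro power_mono) auto
      also have "\<dots> = exp (real j + 3)" by (simp add: exp_of_nat_mult[symmetric])
      finally have "2 ^ j * 8 \<le> exp (real j + 3)" by (simp add: power_add)
      moreover have "(1::real) \<le> 2 ^ j" by simp
      ultimately have "4 + 2 * 2 ^ j \<le> exp (real j + 3)" by linarith
      then show "real (2 * (K + 1)) \<le> exp (real j + 3)" by (simp add: K_def)
    qed auto
    also have "\<dots> = exp (card B * (real j + 4))" 
      by (simp add: exp_add[symmetric] exp_of_nat_mult[symmetric] add_ac)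
    finally show ?thesis using keys im by simp
  qed
  show ?thesis
    by (rule that[of \<pi>]) (use \<pi>S close step card in \<open>auto simp: \<pi>_def\<close>)
qed

section \<open>Weak convergence to the Gaussian law\<close>

text \<open>Phases bring in sines, frequency 0 gives constants, and product-to-sum formulas make the
  class an algebra. So Stone-Weierstrass applies in real form, while the integrals of its members
  reduce to characteristic functions.\<close>

inductive trig_sum :: "('a::real_inner \<Rightarrow> real) \<Rightarrow> bool" where
  cos: "trig_sum (\<lambda>x. a * cos (t \<bullet> x + b))"
| add: "trig_sum f \<Longrightarrow> trig_sum g \<Longrightarrow> trig_sum (\<lambda>x. f x + g x)"

lemma trig_sum_const: "trig_sum (\<lambda>x. c)"
  using trig_sum.cos[of c 0 0] by simp

lemma trig_sum_mult_cos:
  assumes "trig_sum f"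
  shows "trig_sum (\<lambda>x. f x * (a * cos (t \<bullet> x + b)))"
  using assms
proof induction
  case (cos c s d)
  have "(\<lambda>x. c * cos (s \<bullet> x + d) * (a * cos (t \<bullet> x + b))) =
    (\<lambda>x. (c * a / 2) * cos ((s - t) \<bullet> x + (d - b)) + (c * a / 2) * cos ((s + t) \<bullet> x + (d + b)))"
  proof
    fix x
    have "cos (s \<bullet> x + d) * cos (t \<bullet> x + b)
        = (cos ((s - t) \<bullet> x + (d - b)) + cos ((s + t) \<bullet> x + (d + b))) / 2"
      by (subst cos_times_cos) (simp add: inner_add_left inner_diff_left algebra_simps)
    moreover have "c * p * (a * q) = (c * a / 2) * u + (c * a / 2) * v" if "p * q = (u + v) / 2" for p q u v
    proof -
      have "c * p * (a * q) = c * a * (p * q)" by simp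
      then show ?thesis using that by (simp add: distrib_left add_divide_distrib)
    qed
    ultimately show "c * cos (s \<bullet> x + d) * (a * cos (t \<bullet> x + b)) =
      (c * a / 2) * cos ((s - t) \<bullet> x + (d - b)) + (c * a / 2) * cos ((s + t) \<bullet> x + (d + b))"
      by blast
  qed
  then show ?case by (simp only: trig_sum.intros)
next
  case (add f g)
  then show ?case using trig_sum.add by (simp add: distrib_right)
qed

lemma trig_sum_mult:
  assumes "trig_sum f" "trig_sum g"
  shows "trig_sum (\<lambda>x. f x * g x)"
  using assms(2)
proof induction
  case cos
  then show ?case by (rule trig_sum_mult_cos[OF assms(1)])
next
  case (add g h)
  then show ?case using trig_sum.add by (simp add: distrib_left)
qed

lemma trig_sum_continuous: "trig_sum f \<Longrightarrow> continuous_on A f"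
  by (induction rule: trig_sum.induct) (auto intro!: continuous_intros)

lemma trig_sum_bounded: "trig_sum f \<Longrightarrow> \<exists>C. \<forall>x. \<bar>f x\<bar> \<le> C"
proof (induction rule: trig_sum.induct)
  case (cos a t b)
  have "\<bar>a * cos (t \<bullet> x + b)\<bar> \<le> \<bar>a\<bar> * 1" for x
    unfolding abs_mult by (intro mult_left_mono) auto
  then show ?case by blast
next
  case (add f g)
  then obtain C D where "\<forall>x. \<bar>f x\<bar> \<le> C" "\<forall>x. \<bar>g x\<bar> \<le> D" by blast
  then have "\<forall>x. \<bar>f x + g x\<bar> \<le> C + D" by (meson abs_triangle_ineq add_mono order_trans)
  then show ?case by blast
qed

text \<open>
  Approximating h by Stone--Weierstrass on a ball gives no control outside the ball; composing
  with a polynomial that is uniformly close to the clamping function restores a global bound and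
  stays within the algebra.
\<close>

lemma trig_sum_approx:
  fixes h :: "'a::euclidean_space \<Rightarrow> real"
  assumes h: "continuous_on UNIV h" "\<And>x. \<bar>h x\<bar> \<le> B" and \<epsilon>: "0 < \<epsilon>" and K: "0 < K"
  obtains T where "trig_sum T" "\<And>x. norm x \<le> K \<Longrightarrow> \<bar>h x - T x\<bar> \<le> \<epsilon>" "\<And>x. \<bar>T x\<bar> \<le> B + \<epsilon>"
proof -
  have "\<exists>T. trig_sum T \<and> (\<forall>x\<in>cball 0 K. \<bar>h x - T x\<bar> < \<epsilon> / 2)"
  proof (rule Stone_Weierstrass_HOL)
    show "continuous_on (cball 0 K) h" using h(1) continuous_on_subset by blast
    fix x y :: 'a assume xy: "x \<in> cball 0 K \<and> y \<in> cball 0 K \<and> x \<noteq> y"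
    \<comment> \<open>Scaled so that \<open>t \<bullet> z\<close> stays in \<open>[-1, 1]\<close> on
      the ball, where the sine is injective; the phase \<open>- pi / 2\<close> turns the cosine into
      that sine.\<close>
    define t where "t = (1 / (K * norm (x - y))) *\<^sub>R (x - y)"
    have t: "norm t = 1 / K" using xy K by (simp add: t_def)
    have small: "\<bar>t \<bullet> z\<bar> \<le> 1" if "z \<in> cball 0 K" for z
    proof -
      have "\<bar>t \<bullet> z\<bar> \<le> norm t * norm z" by (rule Cauchy_Schwarz_ineq2)
      also have "\<dots> \<le> (1 / K) * K" unfolding t using that K by (intro mult_left_mono) auto
      finally show ?thesis using K by simp
    qed
    have "t \<bullet> x - t \<bullet> y = t \<bullet> (x - y)" by (simp add: inner_diff_right)
    also have "\<dots> = (1 / (K * norm (x - y))) * ((x - y) \<bullet> (x - y))" by (simp add: t_def)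
    also have "\<dots> \<noteq> 0" using xy K by simp
    finally have ne: "t \<bullet> x \<noteq> t \<bullet> y" by simp
    have "sin (t \<bullet> x) \<noteq> sin (t \<bullet> y)"
    proof
      assume "sin (t \<bullet> x) = sin (t \<bullet> y)"
      moreover have "\<bar>t \<bullet> x\<bar> \<le> 1" "\<bar>t \<bullet> y\<bar> \<le> 1" using small xy by blast+
      then have "- (pi / 2) \<le> t \<bullet> x" "t \<bullet> x \<le> pi / 2" "- (pi / 2) \<le> t \<bullet> y" "t \<bullet> y \<le> pi / 2"
        using pi_gt3 by linarith+
      ultimately have "t \<bullet> x = t \<bullet> y" by (rule sin_inj_pi[rotated -1])
      then show False using ne by simp
    qed
    then have "1 * cos (t \<bullet> x + (- pi / 2)) \<noteq> 1 * cos (t \<bullet> y + (- pi / 2))"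
      by (simp add: cos_diff)
    then show "\<exists>f. trig_sum f \<and> f x \<noteq> f y"
      using trig_sum.cos[of 1 t "- pi / 2"] by blast
  qed (use \<epsilon> in \<open>auto intro: trig_sum_const trig_sum.add trig_sum_mult trig_sum_continuous\<close>)
  then obtain T where T: "trig_sum T" "\<And>x. x \<in> cball 0 K \<Longrightarrow> \<bar>h x - T x\<bar> < \<epsilon> / 2" by blast
  obtain C where C: "\<And>x. \<bar>T x\<bar> \<le> C" using trig_sum_bounded[OF T(1)] by blast
  define clamp where "clamp y = max (- B) (min B y)" for y :: real
  \<comment> \<open>The approximating class is the set of continuous \<open>g\<close> whose
    composition with \<open>T\<close> stays in the algebra. It is itself an algebra containing the
    identity, so polynomials need no separate treatment.\<close>
  have "\<exists>g. (continuous_on UNIV g \<and> trig_sum (\<lambda>x. g (T x))) \<and> (\<forall>y\<in>{-C..C}. \<bar>clamp y - g y\<bar> < \<epsilon> / 2)"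
  proof (rule Stone_Weierstrass_HOL)
    show "continuous_on {-C..C} clamp" unfolding clamp_def by (intro continuous_intros)
    fix x y :: real assume "x \<in> {-C..C} \<and> y \<in> {-C..C} \<and> x \<noteq> y"
    then show "\<exists>f. (continuous_on UNIV f \<and> trig_sum (\<lambda>x. f (T x))) \<and> f x \<noteq> f y"
      using T(1) by (intro exI[of _ "\<lambda>x. x"]) auto
  qed (use \<epsilon> in \<open>auto intro: trig_sum_const trig_sum.add trig_sum_mult continuous_intros continuous_on_subset\<close>)
  then obtain g where g: "trig_sum (\<lambda>x. g (T x))" "\<And>y. y \<in> {-C..C} \<Longrightarrow> \<bar>clamp y - g y\<bar> < \<epsilon> / 2" by blast
  have gT: "\<bar>clamp (T x) - g (T x)\<bar> < \<epsilon> / 2" for x using g(2)[of "T x"] C[of x] by (simp add: abs_le_iff minus_le_iff)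
  have B: "0 \<le> B" using h(2)[of 0] by linarith
  show ?thesis
  proof (rule that[OF g(1)])
    fix x
    have "\<bar>clamp (T x)\<bar> \<le> B" using B by (auto simp: clamp_def max_def min_def)
    then show "\<bar>g (T x)\<bar> \<le> B + \<epsilon>" using gT[of x] \<epsilon> by linarith
    assume "norm x \<le> K"
    then have "\<bar>h x - T x\<bar> < \<epsilon> / 2" using T(2) by simp
    \<comment> \<open>Clamping to \<open>[-B, B]\<close> cannot move \<open>T x\<close> away from
      \<open>h x\<close>, which lies in that interval.\<close>
    then have "\<bar>h x - clamp (T x)\<bar> < \<epsilon> / 2" using h(2)[of x] by (auto simp: clamp_def max_def min_def)
    then show "\<bar>h x - g (T x)\<bar> \<le> \<epsilon>" using gT[of x] by linarith
  qed
qed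

text \<open>Inside the ball the integrands differ by at most \<open>\<epsilon>\<close>; outside they
  are bounded by \<open>B\<close> and \<open>B + \<epsilon>\<close>.\<close>

lemma integral_bounded_continuous_diff:
  fixes h T :: "'a::euclidean_space \<Rightarrow> real"
  assumes Q: "prob_space Q" "sets Q = sets borel"
    and h: "continuous_on UNIV h" "\<And>x. \<bar>h x\<bar> \<le> B" and T: "continuous_on UNIV T" "\<And>x. \<bar>T x\<bar> \<le> B + \<epsilon>"
    and close: "\<And>x. norm x \<le> K \<Longrightarrow> \<bar>h x - T x\<bar> \<le> \<epsilon>" and \<epsilon>: "0 < \<epsilon>"
  shows "\<bar>(\<integral>x. h x \<partial>Q) - (\<integral>x. T x \<partial>Q)\<bar> \<le> \<epsilon> + (2 * B + \<epsilon>) * measure Q {x. norm x > K}"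
proof -
  interpret prob_space Q by fact
  have B: "0 \<le> B" using h(2)[of 0] by linarith
  have mb: "f \<in> borel_measurable Q" if "continuous_on UNIV f" for f :: "'a \<Rightarrow> real"
    using borel_measurable_continuous_onI[OF that] measurable_cong_sets[OF Q(2) refl] by blast
  have int: "integrable Q h" "integrable Q T"
    by (auto intro!: integrable_const_bound[where B="B + \<epsilon>"] mb h(1) T AE_I2 order_trans[OF h(2)])
       (use \<epsilon> in simp)
  have E[measurable]: "{x. norm x > K} \<in> sets Q" unfolding Q(2) by measurable
  have "\<bar>(\<integral>x. h x \<partial>Q) - (\<integral>x. T x \<partial>Q)\<bar> = \<bar>\<integral>x. h x - T x \<partial>Q\<bar>" using int by simp
  also have "\<dots> \<le> (\<integral>x. \<bar>h x - T x\<bar> \<partial>Q)" by (rule integral_abs_bound)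
  also have "\<dots> \<le> (\<integral>x. \<epsilon> + (2 * B + \<epsilon>) * indicator {x. norm x > K} x \<partial>Q)"
  proof (rule integral_mono)
    show "integrable Q (\<lambda>x. \<bar>h x - T x\<bar>)" using int by auto
    show "integrable Q (\<lambda>x. \<epsilon> + (2 * B + \<epsilon>) * indicator {x. norm x > K} x)"
      by (intro Bochner_Integration.integrable_add integrable_mult_right integrable_const)
         (auto simp: integrable_indicator_iff emeasure_eq_measure)
    fix x
    show "\<bar>h x - T x\<bar> \<le> \<epsilon> + (2 * B + \<epsilon>) * indicator {x. norm x > K} x"
    proof (cases "norm x \<le> K")
      case False
      then show ?thesis using h(2)[of x] T(2)[of x] \<epsilon> by (simp add: indicator_def abs_le_iff)
    qed (use close[of x] in \<open>auto simp: indicator_def\<close>)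
  qed
  also have "\<dots> = \<epsilon> + (2 * B + \<epsilon>) * measure Q {x. norm x > K}"
    by (subst Bochner_Integration.integral_add)
       (auto simp: integrable_indicator_iff emeasure_eq_measure prob_space)
  finally show ?thesis .
qed

lemma trig_sum_integral_tendsto:
  assumes T: "trig_sum T" and cos: "\<And>t b. (\<lambda>n. \<integral>x. cos (t \<bullet> x + b) \<partial>Q n) \<longlonglongrightarrow> (\<integral>x. cos (t \<bullet> x + b) \<partial>R)"
    and Q: "\<And>n. n \<ge> n0 \<Longrightarrow> prob_space (Q n) \<and> sets (Q n) = sets borel"
    and R: "prob_space R" "sets R = sets (borel :: 'a::euclidean_space measure)"
  shows "(\<lambda>n. \<integral>x. T x \<partial>Q n) \<longlonglongrightarrow> (\<integral>x. T x \<partial>(R::'a measure))"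
  using T
proof (induction rule: trig_sum.induct)
  case (cos a t b)
  then show ?case using assms(2)[of t b] by (simp add: tendsto_mult_left)
next
  case (add f g)
  have int: "integrable P f \<and> integrable P g" if P: "prob_space P" "sets P = sets (borel :: 'a measure)" for P
  proof -
    interpret prob_space P by fact
    have "integrable P f" if f: "trig_sum f" for f
    proof -
      obtain C where "\<And>x. \<bar>f x\<bar> \<le> C" using trig_sum_bounded[OF f] by blast
      moreover have "f \<in> borel_measurable P"
        using borel_measurable_continuous_onI[OF trig_sum_continuous[OF f]] measurable_cong_sets[OF P(2) refl] by blast
      ultimately show ?thesis by (intro integrable_const_bound[where B=C]) auto
    qed
    then show ?thesis using add.hyps by blast
  qed
  have "(\<lambda>n. (\<integral>x. f x \<partial>Q n) + (\<integral>x. g x \<partial>Q n)) \<longlonglongrightarrow> (\<integral>x. f x + g x \<partial>R)"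
    using tendsto_add[OF add.IH] int[OF R] by simp
  moreover have "eventually (\<lambda>n. (\<integral>x. f x \<partial>Q n) + (\<integral>x. g x \<partial>Q n) = (\<integral>x. f x + g x \<partial>Q n)) sequentially"
    using eventually_ge_at_top[of n0] by eventually_elim (use int Q in simp)
  ultimately show ?case using tendsto_cong by force
qed

text \<open>Tightness confines the laws to one ball up to small mass, where a trigonometric sum
  approximates the test function; integrals of such sums converge by linearity. The laws with index
  below \<open>n0\<close> need not be probability measures.\<close>

lemma conv_in_distr_trigI:
  fixes R :: "('a::euclidean_space) measure"
  assumes cos: "\<And>t b. (\<lambda>n. \<integral>x. cos (t \<bullet> x + b) \<partial>Q n) \<longlonglongrightarrow> (\<integral>x. cos (t \<bullet> x + b) \<partial>R)"
    and Q: "\<And>n. n \<ge> n0 \<Longrightarrow> prob_space (Q n) \<and> sets (Q n) = sets borel"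
    and R: "prob_space R" "sets R = sets borel"
    and tight: "\<And>\<epsilon>. 0 < \<epsilon> \<Longrightarrow> \<exists>K. \<forall>\<^sub>F n in sequentially. measure (Q n) {x. norm x > K} \<le> \<epsilon>"
  shows "conv_in_distr Q R"
  unfolding conv_in_distr_def
proof (intro allI impI)
  fix h :: "'a \<Rightarrow> real" assume h: "continuous_on UNIV h \<and> bounded (range h)"
  then obtain B0 where B0: "\<And>x. \<bar>h x\<bar> \<le> B0" unfolding bounded_iff by auto
  define B where "B = max B0 1"
  have B: "\<And>x. \<bar>h x\<bar> \<le> B" "1 \<le> B" using B0 by (auto simp: B_def le_max_iff_disj)
  interpret R: prob_space R by fact
  show "(\<lambda>n. \<integral>x. h x \<partial>Q n) \<longlonglongrightarrow> (\<integral>x. h x \<partial>R)"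
  proof (rule LIMSEQ_I)
    fix e :: real assume e: "0 < e"
    \<comment> \<open>As \<open>1 \<le> B\<close> and \<open>\<epsilon> \<le> 1\<close>, the error
      \<open>\<epsilon> + (2 * B + \<epsilon>) * \<epsilon>\<close> is at most
      \<open>4 * B * \<epsilon>\<close>, hence at most \<open>e / 3\<close>.\<close>
    define \<epsilon> where "\<epsilon> = min 1 (e / 12 / B)"
    have \<epsilon>: "0 < \<epsilon>" "\<epsilon> \<le> 1" "\<epsilon> * B \<le> e / 12" using e B by (auto simp: \<epsilon>_def min_def field_simps)
    obtain K1 where K1: "\<forall>\<^sub>F n in sequentially. measure (Q n) {x. norm x > K1} \<le> \<epsilon>" using tight \<epsilon> by blast
    have "(\<lambda>k. measure R {x. norm x > real k}) \<longlonglongrightarrow> measure R (\<Inter>k. {x. norm x > real k})"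
    proof (rule R.finite_Lim_measure_decseq)
      have "{x::'a. norm x > real k} \<in> sets borel" for k by measurable
      then show "range (\<lambda>k. {x::'a. norm x > real k}) \<subseteq> sets R" by (auto simp: R(2))
      show "decseq (\<lambda>k. {x::'a. norm x > real k})" by (auto simp: decseq_def)
    qed
    moreover have "(\<Inter>k. {x::'a. norm x > real k}) = {}"
    proof -
      have "x \<notin> (\<Inter>k. {x::'a. norm x > real k})" for x
      proof -
        obtain k where "norm x \<le> real k" using real_arch_simple by blast
        then have "x \<notin> {x::'a. norm x > real k}" by simp
        then show ?thesis by blast
      qed
      then show ?thesis by blast
    qed
    ultimately have "(\<lambda>k. measure R {x. norm x > real k}) \<longlonglongrightarrow> 0" by simp
    then have "\<forall>\<^sub>F k in sequentially. measure R {x. norm x > real k} < \<epsilon>"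
      using \<epsilon> by (simp add: order_tendstoD)
    then obtain k where k: "measure R {x. norm x > real k} < \<epsilon>" by (auto simp: eventually_sequentially)
    define K where "K = max 1 (max K1 (real k))"
    obtain T where T: "trig_sum T" "\<And>x. norm x \<le> K \<Longrightarrow> \<bar>h x - T x\<bar> \<le> \<epsilon>" "\<And>x. \<bar>T x\<bar> \<le> B + \<epsilon>"
      using trig_sum_approx[of h B \<epsilon> K] h B \<epsilon> K_def by (metis less_max_iff_disj zero_less_one)
    have diff: "\<bar>(\<integral>x. h x \<partial>P) - (\<integral>x. T x \<partial>P)\<bar> \<le> e / 3"
      if P: "prob_space P" "sets P = sets borel" and m: "measure P {x. norm x > K'} \<le> \<epsilon>" "K' \<le> K" for P K'
    proof -
      interpret prob_space P by fact
      have "{x::'a. norm x > K'} \<in> sets borel" by measurable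
      then have "measure P {x. norm x > K} \<le> measure P {x. norm x > K'}"
        using m(2) by (intro finite_measure_mono) (auto simp: P(2))
      then have mK: "measure P {x. norm x > K} \<le> \<epsilon>" using m by simp
      have "\<bar>(\<integral>x. h x \<partial>P) - (\<integral>x. T x \<partial>P)\<bar> \<le> \<epsilon> + (2 * B + \<epsilon>) * measure P {x. norm x > K}"
        using h B T \<epsilon> trig_sum_continuous[OF T(1)] by (intro integral_bounded_continuous_diff P) auto
      also have "\<dots> \<le> \<epsilon> + (2 * B + \<epsilon>) * \<epsilon>" using mK B \<epsilon> by (intro add_mono mult_left_mono) auto
      also have "\<dots> \<le> \<epsilon> * B + (3 * B) * \<epsilon>" using B \<epsilon> by (intro add_mono mult_right_mono) auto
      also have "\<dots> \<le> e / 3" using \<epsilon>(3) by (simp add: mult.commute)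
      finally show ?thesis .
    qed
    have Rd: "\<bar>(\<integral>x. h x \<partial>R) - (\<integral>x. T x \<partial>R)\<bar> \<le> e / 3"
      using k by (intro diff[OF R, of "real k"]) (auto simp: K_def)
    have "\<forall>\<^sub>F n in sequentially. dist (\<integral>x. T x \<partial>Q n) (\<integral>x. T x \<partial>R) < e / 3"
      using trig_sum_integral_tendsto[OF T(1) cos Q R] e by (intro tendstoD) auto
    with K1 eventually_ge_at_top[of n0]
    have "\<forall>\<^sub>F n in sequentially. norm ((\<integral>x. h x \<partial>Q n) - (\<integral>x. h x \<partial>R)) < e"
    proof eventually_elim
      case (elim n)
      have "\<bar>(\<integral>x. h x \<partial>Q n) - (\<integral>x. T x \<partial>Q n)\<bar> \<le> e / 3"
        using elim Q by (intro diff[of "Q n" K1]) (auto simp: K_def)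
      moreover have "\<bar>(\<integral>x. T x \<partial>Q n) - (\<integral>x. T x \<partial>R)\<bar> < e / 3" using elim by (simp add: dist_real_def)
      ultimately have "\<bar>(\<integral>x. h x \<partial>Q n) - (\<integral>x. h x \<partial>R)\<bar> < e" using Rd by linarith
      then show ?case by simp
    qed
    then show "\<exists>no. \<forall>n\<ge>no. norm ((\<integral>x. h x \<partial>Q n) - (\<integral>x. h x \<partial>R)) < e"
      by (simp add: eventually_sequentially)
  qed
qed

section \<open>The standard Gaussian law and its characteristic function\<close>

lemma std_gaussian_basis:
  "std_gaussian = density (lborel :: (real^'p) measure) (\<lambda>x. ennreal (\<Prod>b\<in>Basis. std_normal_density (x \<bullet> b)))"
proof -
  have "(\<Prod>i\<in>UNIV. std_normal_density (x $ i)) = (\<Prod>b\<in>Basis. std_normal_density (x \<bullet> b))" for x :: "real^'p"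
  proof -
    have B: "(Basis :: (real^'p) set) = (\<lambda>i. axis i 1) ` UNIV" by (auto simp: Basis_vec_def)
    show ?thesis unfolding B
      by (subst prod.reindex) (auto simp: inj_on_def axis_eq_axis inner_axis)
  qed
  then show ?thesis by (simp add: std_gaussian_def)
qed

lemma sets_std_gaussian: "sets std_gaussian = sets borel"
  by (simp add: std_gaussian_def)

lemma prob_space_std_gaussian: "prob_space (std_gaussian :: (real^'p) measure)"
proof
  have "emeasure (std_gaussian :: (real^'p) measure) (space std_gaussian)
      = (\<integral>\<^sup>+x. ennreal (\<Prod>b\<in>Basis. std_normal_density (x \<bullet> b)) \<partial>(lborel :: (real^'p) measure))"
    by (simp add: std_gaussian_basis emeasure_density)
  also have "\<dots> = (\<integral>\<^sup>+x. (\<Prod>b\<in>Basis. ennreal (std_normal_density (x \<bullet> b))) \<partial>(lborel :: (real^'p) measure))"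
    by (simp add: prod_ennreal normal_density_nonneg)
  also have "\<dots> = (\<Prod>b\<in>(Basis::(real^'p) set). \<integral>\<^sup>+x. ennreal (std_normal_density x) \<partial>lborel)"
    by (rule nn_integral_lborel_prod) auto
  also have "\<dots> = 1"
  proof -
    have "(\<integral>\<^sup>+x. ennreal (std_normal_density x) \<partial>lborel) = 1"
      using prob_space.emeasure_space_1[OF prob_space_normal_density[of 1 0]] by (simp add: emeasure_density)
    then show ?thesis by simp
  qed
  finally show "emeasure (std_gaussian :: (real^'p) measure) (space std_gaussian) = 1" .
qed

text \<open>Density and exponential are both products over coordinates, so the integral factorises
  into one-dimensional characteristic functions.\<close>

lemma iexp_std_gaussian:
  fixes t :: "real^'p"
  shows "(\<integral>x. iexp (t \<bullet> x) \<partial>std_gaussian) = exp (- (norm t)\<^sup>2 / 2)"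
proof -
  interpret product_sigma_finite "\<lambda>_::real^'p. lborel :: real measure" ..
  define F where "F b y = complex_of_real (std_normal_density y) * iexp ((t \<bullet> b) * y)" for b and y :: real
  have F_meas[measurable]: "F b \<in> borel_measurable borel" for b unfolding F_def by measurable
  have F_int: "integrable lborel (F b)" for b
    unfolding F_def
    by (rule Bochner_Integration.integrable_bound[OF integrable_normal_density[of 1 0]])
       (auto simp: norm_mult normal_density_nonneg)
  have F_integral: "(\<integral>y. F b y \<partial>lborel) = exp (- (t \<bullet> b)\<^sup>2 / 2)" for b
  proof -
    have "char std_normal_distribution (t \<bullet> b) = (\<integral>y. std_normal_density y *\<^sub>R iexp ((t \<bullet> b) * y) \<partial>lborel)"
      unfolding char_def by (subst integral_density) (auto simp: normal_density_nonneg)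
    also have "\<dots> = (\<integral>y. F b y \<partial>lborel)" by (simp add: F_def scaleR_conv_of_real)
    finally show ?thesis by (simp add: char_std_normal_distribution)
  qed
  have prodF: "(\<Prod>b\<in>Basis. std_normal_density (x \<bullet> b)) *\<^sub>R iexp (t \<bullet> x) = (\<Prod>b\<in>Basis. F b (x \<bullet> b))" for x :: "real^'p"
  proof -
    have "iexp (t \<bullet> x) = (\<Prod>b\<in>Basis. iexp ((t \<bullet> b) * (x \<bullet> b)))"
      by (simp add: euclidean_inner[of t x] sum_distrib_left exp_sum)
    then show ?thesis by (simp add: F_def prod.distrib scaleR_conv_of_real)
  qed
  have "(\<integral>x. iexp (t \<bullet> x) \<partial>std_gaussian) = (\<integral>x. (\<Prod>b\<in>Basis. F b (x \<bullet> b)) \<partial>(lborel :: (real^'p) measure))"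
    unfolding std_gaussian_basis
    by (subst integral_density) (auto simp: prodF intro!: prod_nonneg normal_density_nonneg)
  also have "\<dots> = (\<integral>f. (\<Prod>b\<in>Basis. F b ((\<Sum>c\<in>Basis. f c *\<^sub>R c) \<bullet> b)) \<partial>(\<Pi>\<^sub>M b\<in>(Basis :: (real^'p) set). lborel))"
    by (subst lborel_eq, subst integral_distr) auto
  also have "\<dots> = (\<integral>f. (\<Prod>b\<in>Basis. F b (f b)) \<partial>(\<Pi>\<^sub>M b\<in>(Basis :: (real^'p) set). lborel))"
    by (intro Bochner_Integration.integral_cong prod.cong) (auto simp: orthonormal_sum_inner[OF orthonormal_Basis])
  also have "\<dots> = (\<Prod>b\<in>Basis. \<integral>y. F b y \<partial>lborel)"
    by (rule product_integral_prod) (auto intro: F_int)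
  also have "\<dots> = (\<Prod>b\<in>Basis. complex_of_real (exp (- (t \<bullet> b)\<^sup>2 / 2)))" by (simp add: F_integral)
  also have "\<dots> = complex_of_real (exp (\<Sum>b\<in>Basis. - (t \<bullet> b)\<^sup>2 / 2))" by (simp add: exp_sum)
  also have "(\<Sum>b\<in>Basis. - (t \<bullet> b)\<^sup>2 / 2) = - (norm t)\<^sup>2 / 2"
    using orthonormal_norm[OF orthonormal_Basis, of t]
    by (simp add: sum_negf sum_divide_distrib)
  finally show ?thesis by simp
qed

lemma integral_cos_eq:
  fixes Q :: "('a::euclidean_space) measure"
  assumes Q: "prob_space Q" "sets Q = sets borel"
  shows "(\<integral>x. cos (t \<bullet> x + b) \<partial>Q) = Re (iexp b * (\<integral>x. iexp (t \<bullet> x) \<partial>Q))"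
proof -
  interpret prob_space Q by fact
  have "continuous_on UNIV (\<lambda>x. iexp (t \<bullet> x))" by (intro continuous_intros)
  then have "(\<lambda>x. iexp (t \<bullet> x)) \<in> borel_measurable Q"
    using borel_measurable_continuous_onI measurable_cong_sets[OF Q(2) refl] by blast
  then have int: "integrable Q (\<lambda>x. iexp (t \<bullet> x))" by (intro integrable_const_bound[where B=1]) auto
  have "cos (t \<bullet> x + b) = Re (iexp b * iexp (t \<bullet> x))" for x
    by (simp add: exp_add[symmetric] distrib_left[symmetric] of_real_add[symmetric] Re_exp add.commute del: of_real_add)
  then show ?thesis using int by simp
qed

section \<open>Second moments, Slutsky's argument and the central limit theorem\<close>

lemma (in prob_space) expectation_sum_square:
  fixes X :: "nat \<Rightarrow> 'a \<Rightarrow> real"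
  assumes indep: "indep_vars (\<lambda>_. borel) X UNIV" and sq: "\<And>i. integrable M (\<lambda>w. (X i w)\<^sup>2)"
    and mean: "\<And>i. expectation (X i) = 0" and var: "\<And>i. expectation (\<lambda>w. (X i w)\<^sup>2) = v"
  shows "integrable M (\<lambda>w. (\<Sum>i<n. X i w)\<^sup>2) \<and> expectation (\<lambda>w. (\<Sum>i<n. X i w)\<^sup>2) = real n * v"
proof (induction n)
  case (Suc n)
  have meas[measurable]: "X i \<in> borel_measurable M" for i using indep by (auto simp: indep_vars_def2)
  have int: "integrable M (X i)" for i by (rule square_integrable_imp_integrable[OF meas sq])
  have cross: "integrable M (\<lambda>w. X i w * X n w) \<and> expectation (\<lambda>w. X i w * X n w) = 0" if i: "i < n" for i
  proof -
    have "indep_vars (\<lambda>_. borel) X {i, n}" using indep_vars_subset[OF indep] by blast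
    from indep_vars_lebesgue_integral[OF _ this] indep_vars_integrable[OF _ this] int i mean
    show ?thesis by simp
  qed
  have "(\<lambda>w. (\<Sum>i<Suc n. X i w)\<^sup>2) = (\<lambda>w. (\<Sum>i<n. X i w)\<^sup>2 + 2 * (\<Sum>i<n. X i w * X n w) + (X n w)\<^sup>2)"
    by (auto simp: power2_sum sum_distrib_right)
  moreover have "integrable M (\<lambda>w. \<Sum>i<n. X i w * X n w)" "expectation (\<lambda>w. \<Sum>i<n. X i w * X n w) = 0"
    using cross by (auto simp: Bochner_Integration.integral_sum)
  ultimately show ?case using Suc.IH sq[of n] var[of n] by (simp add: algebra_simps)
qed simp

lemma (in prob_space) markov_norm:
  fixes Z :: "'a \<Rightarrow> real^'p"
  assumes meas: "Z \<in> borel_measurable M" and int: "\<And>k. integrable M (\<lambda>w. (Z w $ k)\<^sup>2)" and K: "0 < K"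
  shows "measure M {w \<in> space M. norm (Z w) \<ge> K} \<le> (\<Sum>k\<in>UNIV. expectation (\<lambda>w. (Z w $ k)\<^sup>2)) / K\<^sup>2"
proof -
  have n2: "(norm x)\<^sup>2 = (\<Sum>k\<in>UNIV. (x $ k)\<^sup>2)" for x :: "real^'p"
    unfolding power2_norm_eq_inner inner_vec_def by (simp add: power2_eq_square)
  have "{w \<in> space M. norm (Z w) \<ge> K} = {w \<in> space M. K\<^sup>2 \<le> (\<Sum>k\<in>UNIV. (Z w $ k)\<^sup>2)}"
    using K by (auto simp: n2[symmetric])
  also have "measure M \<dots> \<le> expectation (\<lambda>w. \<Sum>k\<in>UNIV. (Z w $ k)\<^sup>2) / K\<^sup>2"
    by (rule integral_Markov_inequality_measure[of _ _ "{}"]) (use int K in \<open>auto intro!: sum_nonneg\<close>)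
  finally show ?thesis using int by (simp add: Bochner_Integration.integral_sum)
qed

text \<open>A Slutsky argument: cosines are Lipschitz, so \<open>Z\<close> may be replaced by
  \<open>\<xi>\<close> in every cosine integral, and tightness passes from \<open>\<xi>\<close> to
  \<open>Z\<close>.\<close>

lemma (in prob_space) conv_in_distr_std_gaussianI:
  fixes Z \<xi> :: "nat \<Rightarrow> 'a \<Rightarrow> real^'p"
  assumes Z: "\<And>n. n \<ge> n0 \<Longrightarrow> Z n \<in> borel_measurable M" and \<xi>: "\<And>n. n \<ge> n0 \<Longrightarrow> \<xi> n \<in> borel_measurable M"
    and diff: "conv_in_prob M (\<lambda>n w. Z n w - \<xi> n w) 0"
    and char: "\<And>t. (\<lambda>n. \<integral>w. iexp (t \<bullet> \<xi> n w) \<partial>M) \<longlonglongrightarrow> exp (- (norm t)\<^sup>2 / 2)"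
    and tight: "\<And>n K. n \<ge> n0 \<Longrightarrow> 0 < K \<Longrightarrow> measure M {w \<in> space M. norm (\<xi> n w) \<ge> K} \<le> C / K\<^sup>2"
  shows "conv_in_distr (\<lambda>n. distr M borel (Z n)) std_gaussian"
proof (rule conv_in_distr_trigI[where ?n0.0 = n0])
  show "prob_space (distr M borel (Z n)) \<and> sets (distr M borel (Z n)) = sets borel" if "n \<ge> n0" for n
    using Z[OF that] prob_space_distr by simp
  fix t :: "real^'p" and b :: real
  have lim\<xi>: "(\<lambda>n. \<integral>w. cos (t \<bullet> \<xi> n w + b) \<partial>M) \<longlonglongrightarrow> (\<integral>x. cos (t \<bullet> x + b) \<partial>std_gaussian)"
  proof -
    have "(\<lambda>n. Re (iexp b * (\<integral>w. iexp (t \<bullet> \<xi> n w) \<partial>M))) \<longlonglongrightarrow> Re (iexp b * exp (- (norm t)\<^sup>2 / 2))"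
      by (intro tendsto_intros char)
    also have "Re (iexp b * exp (- (norm t)\<^sup>2 / 2)) = (\<integral>x. cos (t \<bullet> x + b) \<partial>std_gaussian)"
      by (simp only: integral_cos_eq[OF prob_space_std_gaussian sets_std_gaussian] iexp_std_gaussian)
    finally have "(\<lambda>n. Re (iexp b * (\<integral>w. iexp (t \<bullet> \<xi> n w) \<partial>M))) \<longlonglongrightarrow> \<dots>" .
    moreover have "\<forall>\<^sub>F n in sequentially. Re (iexp b * (\<integral>w. iexp (t \<bullet> \<xi> n w) \<partial>M)) = (\<integral>w. cos (t \<bullet> \<xi> n w + b) \<partial>M)"
      using eventually_ge_at_top[of n0]
    proof eventually_elim
      case (elim n)
      note [measurable] = \<xi>[OF elim]
      show ?case using integral_cos_eq[of "distr M borel (\<xi> n)" t b]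
        by (simp add: prob_space_distr integral_distr)
    qed
    ultimately show ?thesis by (simp add: tendsto_cong)
  qed
  have "(\<lambda>n. (\<integral>w. cos (t \<bullet> Z n w + b) \<partial>M) - (\<integral>w. cos (t \<bullet> \<xi> n w + b) \<partial>M)) \<longlonglongrightarrow> 0"
  proof (rule LIMSEQ_I)
    fix e :: real assume e: "0 < e"
    \<comment> \<open>Makes the Lipschitz error \<open>norm t * \<epsilon>\<close> at most
      \<open>e / 4\<close>; the added 1 covers \<open>t = 0\<close>.\<close>
    define \<epsilon> where "\<epsilon> = e / (4 * (norm t + 1))"
    have \<epsilon>: "0 < \<epsilon>" "norm t * \<epsilon> \<le> e / 4" using e by (auto simp: \<epsilon>_def field_simps add_pos_nonneg)
    have "(\<lambda>n. measure M {w \<in> space M. dist (Z n w - \<xi> n w) 0 > \<epsilon>}) \<longlonglongrightarrow> 0"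
      using diff \<epsilon> by (auto simp: conv_in_prob_def)
    then have "\<forall>\<^sub>F n in sequentially. measure M {w \<in> space M. dist (Z n w - \<xi> n w) 0 > \<epsilon>} < e / 8"
      using e by (intro order_tendstoD) auto
    with eventually_ge_at_top[of n0]
    have "\<forall>\<^sub>F n in sequentially. norm ((\<integral>w. cos (t \<bullet> Z n w + b) \<partial>M) - (\<integral>w. cos (t \<bullet> \<xi> n w + b) \<partial>M) - 0) < e"
    proof eventually_elim
      case (elim n)
      note [measurable] = \<xi>[OF elim(1)] Z[OF elim(1)]
      let ?E = "{w \<in> space M. dist (Z n w - \<xi> n w) 0 > \<epsilon>}"
      have E[measurable]: "?E \<in> sets M" by measurable
      have int: "integrable M (\<lambda>w. cos (t \<bullet> Z n w + b))" "integrable M (\<lambda>w. cos (t \<bullet> \<xi> n w + b))"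
        by (auto intro!: integrable_const_bound[where B=1])
      have "\<bar>(\<integral>w. cos (t \<bullet> Z n w + b) \<partial>M) - (\<integral>w. cos (t \<bullet> \<xi> n w + b) \<partial>M)\<bar>
          = \<bar>\<integral>w. cos (t \<bullet> Z n w + b) - cos (t \<bullet> \<xi> n w + b) \<partial>M\<bar>" using int by simp
      also have "\<dots> \<le> (\<integral>w. \<bar>cos (t \<bullet> Z n w + b) - cos (t \<bullet> \<xi> n w + b)\<bar> \<partial>M)" by (rule integral_abs_bound)
      also have "\<dots> \<le> (\<integral>w. e / 4 + 2 * indicator ?E w \<partial>M)"
      proof (rule integral_mono)
        show "integrable M (\<lambda>w. \<bar>cos (t \<bullet> Z n w + b) - cos (t \<bullet> \<xi> n w + b)\<bar>)" using int by auto
        show "integrable M (\<lambda>w. e / 4 + 2 * indicator ?E w)"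
          by (intro Bochner_Integration.integrable_add integrable_mult_right integrable_const)
             (auto simp: integrable_indicator_iff emeasure_eq_measure)
        fix w assume w: "w \<in> space M"
        show "\<bar>cos (t \<bullet> Z n w + b) - cos (t \<bullet> \<xi> n w + b)\<bar> \<le> e / 4 + 2 * indicator ?E w"
        proof (cases "w \<in> ?E")
          case True
          have "\<bar>cos (t \<bullet> Z n w + b) - cos (t \<bullet> \<xi> n w + b)\<bar> \<le> 1 + 1"
            by (intro order_trans[OF abs_triangle_ineq4] add_mono) auto
          then show ?thesis using True e by simp
        next
          case False
          have lip: "\<bar>cos x - cos y\<bar> \<le> \<bar>x - y\<bar>" for x y :: real
          proof -
            have "\<bar>cos x - cos y\<bar> = 2 * (\<bar>sin ((x + y) / 2)\<bar> * \<bar>sin ((y - x) / 2)\<bar>)"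
              by (simp add: cos_diff_cos abs_mult)
            also have "\<dots> \<le> 2 * (1 * \<bar>(y - x) / 2\<bar>)"
              by (intro mult_left_mono mult_mono abs_sin_x_le_abs_x) auto
            finally show ?thesis by simp
          qed
          have "\<bar>cos (t \<bullet> Z n w + b) - cos (t \<bullet> \<xi> n w + b)\<bar> \<le> \<bar>(t \<bullet> Z n w + b) - (t \<bullet> \<xi> n w + b)\<bar>" by (rule lip)
          also have "\<dots> = \<bar>t \<bullet> (Z n w - \<xi> n w)\<bar>" by (simp add: inner_diff_right)
          also have "\<dots> \<le> norm t * norm (Z n w - \<xi> n w)" by (rule Cauchy_Schwarz_ineq2)
          also have "\<dots> \<le> norm t * \<epsilon>" using False w by (intro mult_left_mono) auto
          finally show ?thesis using False \<epsilon>(2) by simp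
        qed
      qed
      also have "\<dots> = e / 4 + 2 * measure M ?E"
        by (subst Bochner_Integration.integral_add)
           (auto simp: integrable_indicator_iff emeasure_eq_measure prob_space)
      also have "\<dots> < e" using elim(2) e by linarith
      finally show ?case by simp
    qed
    then show "\<exists>no. \<forall>n\<ge>no. norm ((\<integral>w. cos (t \<bullet> Z n w + b) \<partial>M) - (\<integral>w. cos (t \<bullet> \<xi> n w + b) \<partial>M) - 0) < e"
      by (simp add: eventually_sequentially)
  qed
  from tendsto_add[OF this lim\<xi>]
  have "(\<lambda>n. \<integral>w. cos (t \<bullet> Z n w + b) \<partial>M) \<longlonglongrightarrow> (\<integral>x. cos (t \<bullet> x + b) \<partial>std_gaussian)" by simp
  moreover have "\<forall>\<^sub>F n in sequentially. (\<integral>w. cos (t \<bullet> Z n w + b) \<partial>M) = (\<integral>x. cos (t \<bullet> x + b) \<partial>distr M borel (Z n))"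
    using eventually_ge_at_top[of n0] by eventually_elim (use Z in \<open>simp add: integral_distr\<close>)
  ultimately show "(\<lambda>n. \<integral>x. cos (t \<bullet> x + b) \<partial>distr M borel (Z n)) \<longlonglongrightarrow> (\<integral>x. cos (t \<bullet> x + b) \<partial>std_gaussian)"
    by (simp add: tendsto_cong)
next
  fix \<epsilon> :: real assume \<epsilon>: "0 < \<epsilon>"
  define K where "K = sqrt (2 * \<bar>C\<bar> / \<epsilon>) + 1"
  have K: "0 < K" using \<epsilon> by (simp add: K_def add_nonneg_pos)
  have "2 * \<bar>C\<bar> / \<epsilon> \<le> K\<^sup>2"
  proof -
    have "2 * \<bar>C\<bar> / \<epsilon> = (sqrt (2 * \<bar>C\<bar> / \<epsilon>))\<^sup>2" using \<epsilon> by simp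
    also have "\<dots> \<le> K\<^sup>2" using \<epsilon> by (intro power_mono) (auto simp: K_def)
    finally show ?thesis .
  qed
  then have CK: "C / K\<^sup>2 \<le> \<epsilon> / 2" using \<epsilon> K by (simp add: field_simps abs_le_iff)
  have "(\<lambda>n. measure M {w \<in> space M. dist (Z n w - \<xi> n w) 0 > 1}) \<longlonglongrightarrow> 0"
    using diff by (auto simp: conv_in_prob_def)
  then have "\<forall>\<^sub>F n in sequentially. measure M {w \<in> space M. dist (Z n w - \<xi> n w) 0 > 1} < \<epsilon> / 2"
    using \<epsilon> by (intro order_tendstoD) auto
  with eventually_ge_at_top[of n0]
  have "\<forall>\<^sub>F n in sequentially. measure (distr M borel (Z n)) {x. norm x > K + 1} \<le> \<epsilon>"
  proof eventually_elim
    case (elim n)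
    note [measurable] = \<xi>[OF elim(1)] Z[OF elim(1)]
    have "{x::real^'p. norm x > K + 1} \<in> sets borel" by measurable
    then have "measure (distr M borel (Z n)) {x. norm x > K + 1} = measure M {w \<in> space M. norm (Z n w) > K + 1}"
      by (simp add: measure_distr vimage_def Int_def conj_commute)
    also have "\<dots> \<le> measure M ({w \<in> space M. norm (\<xi> n w) \<ge> K} \<union> {w \<in> space M. dist (Z n w - \<xi> n w) 0 > 1})"
    proof (rule finite_measure_mono)
      show "{w \<in> space M. norm (Z n w) > K + 1} \<subseteq> {w \<in> space M. norm (\<xi> n w) \<ge> K} \<union> {w \<in> space M. dist (Z n w - \<xi> n w) 0 > 1}"
      proof
        fix w assume w: "w \<in> {w \<in> space M. norm (Z n w) > K + 1}"
        have "norm (Z n w) \<le> norm (\<xi> n w) + norm (Z n w - \<xi> n w)" by (rule norm_triangle_sub)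
        then show "w \<in> {w \<in> space M. norm (\<xi> n w) \<ge> K} \<union> {w \<in> space M. dist (Z n w - \<xi> n w) 0 > 1}"
          using w by (auto simp: dist_norm)
      qed
    qed measurable
    also have "\<dots> \<le> measure M {w \<in> space M. norm (\<xi> n w) \<ge> K} + measure M {w \<in> space M. dist (Z n w - \<xi> n w) 0 > 1}"
      by (rule measure_Un_le) measurable
    also have "\<dots> \<le> \<epsilon>" using elim tight[OF elim(1) K] CK by linarith
    finally show ?case .
  qed
  then show "\<exists>K. \<forall>\<^sub>F n in sequentially. measure (distr M borel (Z n)) {x. norm x > K} \<le> \<epsilon>" by blast
qed (rule prob_space_std_gaussian sets_std_gaussian)+

text \<open>The central limit theorem normalises to unit variance; evaluating the characteristic
  function at \<open>\<sigma>\<close> undoes the division by \<open>\<sigma>\<close>.\<close>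

lemma (in prob_space) clt_char:
  fixes X :: "nat \<Rightarrow> 'a \<Rightarrow> real"
  assumes indep: "indep_vars (\<lambda>_. borel) X UNIV" and distr: "\<And>i. distr M borel (X i) = Q"
    and mean: "\<And>i. expectation (X i) = 0" and sq: "\<And>i. integrable M (\<lambda>w. (X i w)\<^sup>2)"
    and var: "\<And>i. expectation (\<lambda>w. (X i w)\<^sup>2) = \<sigma>\<^sup>2" and \<sigma>: "0 < \<sigma>"
  shows "(\<lambda>n. \<integral>w. iexp ((\<Sum>i<n. X i w) / sqrt n) \<partial>M) \<longlonglongrightarrow> exp (- \<sigma>\<^sup>2 / 2)"
proof -
  have [measurable]: "X i \<in> borel_measurable M" for i using indep by (auto simp: indep_vars_def2)
  have "weak_conv_m (\<lambda>n. distr M borel (\<lambda>w. (\<Sum>i<n. X i w) / sqrt (real n * \<sigma>\<^sup>2))) std_normal_distribution"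
    using assms by (intro central_limit_theorem_zero_mean) auto
  then have "(\<lambda>n. char (distr M borel (\<lambda>w. (\<Sum>i<n. X i w) / sqrt (real n * \<sigma>\<^sup>2))) \<sigma>) \<longlonglongrightarrow> char std_normal_distribution \<sigma>"
    by (intro levy_continuity1) (auto intro!: real_distribution_distr real_dist_normal_dist)
  moreover have "char (distr M borel (\<lambda>w. (\<Sum>i<n. X i w) / sqrt (real n * \<sigma>\<^sup>2))) \<sigma>
      = (\<integral>w. iexp ((\<Sum>i<n. X i w) / sqrt n) \<partial>M)" for n
  proof -
    have "\<sigma> * ((\<Sum>i<n. X i w) / sqrt (real n * \<sigma>\<^sup>2)) = (\<Sum>i<n. X i w) / sqrt n" for w
      using \<sigma> by (simp add: real_sqrt_mult)
    then show ?thesis unfolding char_def by (subst integral_distr) (auto simp del: of_real_mult simp flip: of_real_mult)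
  qed
  ultimately show ?thesis by (simp add: char_std_normal_distribution)
qed

section \<open>Sieve spaces and smooth likelihoods\<close>

definition sieve_basis :: "(nat \<Rightarrow> 'x::real_inner) \<Rightarrow> nat \<Rightarrow> ((real^'p) \<times> 'x) set" where
  "sieve_basis e k = (\<lambda>i. (axis i 1, 0)) ` UNIV \<union> (\<lambda>j. (0, e j)) ` {..<k}"

lemma card_sieve_basis: "card (sieve_basis e k :: ((real^'p) \<times> 'x::real_inner) set) \<le> CARD('p) + k"
proof -
  have "card (sieve_basis e k :: ((real^'p) \<times> 'x) set)
      \<le> card ((\<lambda>i. (axis i 1, 0::'x)) ` UNIV :: ((real^'p) \<times> 'x) set) + card ((\<lambda>j. (0::real^'p, e j)) ` {..<k})"
    unfolding sieve_basis_def by (rule card_Un_le)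
  also have "\<dots> \<le> CARD('p) + card {..<k}" by (intro add_mono card_image_le) auto
  finally show ?thesis by simp
qed

lemma sieve_basis_nonempty: "sieve_basis e k \<noteq> {}"
  by (simp add: sieve_basis_def)

lemma orthonormal_sieve_basis:
  assumes "orthonormal_basis e"
  shows "orthonormal_set (sieve_basis e k :: ((real^'p) \<times> 'x::real_inner) set)"
proof -
  have e: "e i \<bullet> e j = of_bool (i = j)" for i j using assms by (auto simp: orthonormal_basis_def)
  have ne: "e j \<noteq> 0" for j using e[of j j] by auto
  have inj: "e i = e j \<longleftrightarrow> i = j" for i j using e[of i j] e[of i i] by (cases "i = j") auto
  have ax: "axis i (1::real) \<bullet> axis j 1 = of_bool (i = j)" for i j :: 'p by (simp add: inner_axis_axis)
  show ?thesis
    by (auto simp: orthonormal_set_def sieve_basis_def inner_prod_def e ax axis_eq_axis inj ne)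
qed

lemma sieve_proj_eq:
  fixes e :: "nat \<Rightarrow> 'x::real_inner" and u :: "(real^'p) \<times> 'x"
  assumes "orthonormal_basis e"
  shows "sieve_proj e k u = (\<Sum>b\<in>sieve_basis e k. (u \<bullet> b) *\<^sub>R b)"
proof -
  have e: "e i \<bullet> e j = of_bool (i = j)" for i j using assms by (auto simp: orthonormal_basis_def)
  have inj: "inj_on (\<lambda>j. (0::real^'p, e j)) {..<k}" 
  proof (rule inj_onI)
    fix i j assume "(0::real^'p, e i) = (0, e j)"
    then show "i = j" using e[of i j] e[of i i] by (auto split: if_splits)
  qed
  have inj': "inj (\<lambda>i. (axis i (1::real), 0::'x) :: (real^'p) \<times> 'x)" by (auto simp: inj_on_def axis_eq_axis)
  have disj: "range (\<lambda>i. (axis i (1::real), 0::'x)) \<inter> (\<lambda>j. (0::real^'p, e j)) ` {..<k} = {}"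
    by (auto simp: axis_eq_0_iff)
  have "(\<Sum>b\<in>sieve_basis e k. (u \<bullet> b) *\<^sub>R b)
      = (\<Sum>i\<in>UNIV. (fst u $ i) *\<^sub>R (axis i 1, 0)) + (\<Sum>j<k. (snd u \<bullet> e j) *\<^sub>R (0, e j))"
    unfolding sieve_basis_def
    by (subst sum.union_disjoint[OF _ _ disj])
       (simp_all add: sum.reindex[OF inj] sum.reindex[OF inj'] inner_prod_def inner_axis)
  also have "\<dots> = (\<Sum>i\<in>UNIV. (fst u $ i) *\<^sub>R axis i 1, \<Sum>j<k. (snd u \<bullet> e j) *\<^sub>R e j)"
    by (simp add: prod_eq_iff fst_sum snd_sum)
  also have "\<dots> = sieve_proj e k u"
    using basis_expansion[of "fst u"] by (simp add: sieve_proj_def scalar_mult_eq_scaleR)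
  finally show ?thesis by simp
qed

lemma span_sieve_basis:
  fixes e :: "nat \<Rightarrow> 'x::real_inner"
  assumes e: "orthonormal_basis e"
  shows "span (sieve_basis e k :: ((real^'p) \<times> 'x) set) = UNIV \<times> sieve_space e k"
proof (intro equalityI)
  have "subspace (UNIV \<times> sieve_space e k :: ((real^'p) \<times> 'x) set)"
    unfolding sieve_space_def by (intro subspace_Times subspace_UNIV subspace_span)
  then show "span (sieve_basis e k :: ((real^'p) \<times> 'x) set) \<subseteq> UNIV \<times> sieve_space e k"
    by (intro span_minimal) (auto simp: sieve_basis_def sieve_space_def span_base span_zero)
next
  show "UNIV \<times> sieve_space e k \<subseteq> span (sieve_basis e k :: ((real^'p) \<times> 'x) set)"
  proof
    fix u :: "(real^'p) \<times> 'x" assume u: "u \<in> UNIV \<times> sieve_space e k"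
    have ee: "e i \<bullet> e j = of_bool (i = j)" for i j using e by (auto simp: orthonormal_basis_def)
    have inj: "i = j" if "e i = e j" for i j using ee[of i j] ee[of i i] that by (cases "i = j") auto
    have "orthonormal_set (e ` {..<k})"
      using ee inj by (auto simp: orthonormal_set_def of_bool_def)
    moreover have "snd u \<in> span (e ` {..<k})" using u by (auto simp: sieve_space_def)
    ultimately have "snd u = (\<Sum>b\<in>e ` {..<k}. (snd u \<bullet> b) *\<^sub>R b)" by (rule orthonormal_expansion)
    also have "\<dots> = (\<Sum>j<k. (snd u \<bullet> e j) *\<^sub>R e j)"
    proof (subst sum.reindex)
      show "inj_on e {..<k}" using inj by (auto simp: inj_on_def)
    qed simp
    finally have "sieve_proj e k u = u" by (simp add: sieve_proj_def prod_eq_iff)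
    moreover have "sieve_proj e k u \<in> span (sieve_basis e k)"
      unfolding sieve_proj_eq[OF e] by (rule orthonormal_proj(1)[OF orthonormal_sieve_basis[OF e]])
    ultimately show "u \<in> span (sieve_basis e k)" by simp
  qed
qed

lemma sieve_proj_in: "orthonormal_basis e \<Longrightarrow> sieve_proj e k (u :: (real^'p) \<times> 'x::real_inner) \<in> UNIV \<times> sieve_space e k"
  by (simp only: sieve_proj_eq orthonormal_proj(1)[OF orthonormal_sieve_basis] flip: span_sieve_basis)

lemma inner_sieve_proj:
  fixes u :: "(real^'p) \<times> 'x::real_inner"
  assumes "orthonormal_basis e" "v \<in> UNIV \<times> sieve_space e k"
  shows "v \<bullet> sieve_proj e k u = v \<bullet> u" "sieve_proj e k u \<bullet> v = u \<bullet> v"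
proof -
  have "(u - sieve_proj e k u) \<bullet> v = 0"
    unfolding sieve_proj_eq[OF assms(1)]
    by (rule orthonormal_proj(2)[OF orthonormal_sieve_basis[OF assms(1)]]) (use assms span_sieve_basis in blast)
  then show "sieve_proj e k u \<bullet> v = u \<bullet> v" by (simp add: inner_diff_left)
  then show "v \<bullet> sieve_proj e k u = v \<bullet> u" by (simp add: inner_commute)
qed

lemma sieve_proj_id:
  fixes u :: "(real^'p) \<times> 'x::real_inner"
  assumes "orthonormal_basis e" "u \<in> UNIV \<times> sieve_space e k"
  shows "sieve_proj e k u = u"
  using orthonormal_expansion[OF orthonormal_sieve_basis[OF assms(1)], of u k] assms
  by (simp add: sieve_proj_eq span_sieve_basis)

lemma linear_sieve_proj: "linear (sieve_proj e k)"
  by (intro linearI)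
     (simp_all add: sieve_proj_def prod_eq_iff inner_add_left scaleR_left_distrib sum.distrib scaleR_sum_right)

lemma subspace_sieve_space: "subspace (sieve_space e k)"
  by (simp add: sieve_space_def subspace_span)

lemma pos_def_operator_sieve:
  assumes "orthonormal_basis e" "linear T" "pos_def_on (UNIV \<times> sieve_space e k) (\<lambda>h. sieve_proj e k (T h))"
  shows "pos_def_operator (sieve_basis e k) (\<lambda>h. sieve_proj e k (T h))"
proof (rule pos_def_operator.intro)
  show "linear (\<lambda>h. sieve_proj e k (T h))"
    using linear_compose[OF assms(2) linear_sieve_proj, of e k] by (simp add: o_def)
  show "(\<lambda>h. sieve_proj e k (T h)) ` span (sieve_basis e k) \<subseteq> span (sieve_basis e k)"
    unfolding span_sieve_basis[OF assms(1)] using sieve_proj_in[OF assms(1)] by blast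
qed (use assms in \<open>simp_all add: orthonormal_sieve_basis span_sieve_basis\<close>)

lemma eff_block_sieve:
  assumes "orthonormal_basis e" "linear T" "pos_def_on (UNIV \<times> sieve_space e k) (\<lambda>h. sieve_proj e k (T h))"
  shows "eff_block (sieve_space e k) (\<lambda>h. sieve_proj e k (T h))"
  using assms by (intro eff_blockI[OF pos_def_operator_sieve] span_sieve_basis subspace_sieve_space) auto

section \<open>Gradients and likelihoods of i.i.d. samples\<close>

lemma grad_eqI:
  assumes "GDERIV f x :> d"
  shows "grad f x = d"
  unfolding grad_def
proof (rule the_equality)
  fix d' assume "GDERIV f x :> d'"
  then have "(\<lambda>h. h \<bullet> d') = (\<lambda>h. h \<bullet> d)"
    using assms has_derivative_unique unfolding gderiv_def by blast
  then show "d' = d" by (metis vector_eq_ldot)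
qed (rule assms)

text \<open>Restricted to the line through \<open>u\<close> in direction \<open>h\<close>, the
  function has an interior maximum at \<open>u\<close>. As \<open>f\<close> is maximal only among
  points of \<open>V\<close>, only directions in \<open>V\<close> can be tested.\<close>

lemma GDERIV_local_max_subspace:
  fixes f :: "'u::real_inner \<Rightarrow> real"
  assumes d: "GDERIV f u :> d" and V: "subspace V" "u \<in> V" "h \<in> V"
    and W: "open W" "u \<in> W" and max: "\<And>v. v \<in> W \<inter> V \<Longrightarrow> f v \<le> f u"
  shows "d \<bullet> h = 0"
proof -
  have "((\<lambda>s::real. u + s *\<^sub>R h) has_derivative (\<lambda>s. s *\<^sub>R h)) (at 0)"
    by (auto intro!: derivative_eq_intros)
  moreover have "(f has_derivative (\<lambda>h. h \<bullet> d)) (at (u + 0 *\<^sub>R h))" using d by (simp add: gderiv_def)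
  ultimately have "((\<lambda>s. f (u + s *\<^sub>R h)) has_derivative (\<lambda>s. (s *\<^sub>R h) \<bullet> d)) (at 0)"
    using has_derivative_compose by fastforce
  then have der: "((\<lambda>s. f (u + s *\<^sub>R h)) has_real_derivative (h \<bullet> d)) (at 0)"
    by (simp add: has_field_derivative_def mult_commute_abs)
  have "((\<lambda>s::real. u + s *\<^sub>R h) \<longlongrightarrow> u + 0 *\<^sub>R h) (at 0)" by (intro tendsto_intros)
  then have "\<forall>\<^sub>F s in at (0::real). u + s *\<^sub>R h \<in> W" using W by (auto dest: topological_tendstoD)
  then obtain \<epsilon> where \<epsilon>: "0 < \<epsilon>" "\<And>s::real. s \<noteq> 0 \<Longrightarrow> dist s 0 < \<epsilon> \<Longrightarrow> u + s *\<^sub>R h \<in> W"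
    by (auto simp: eventually_at)
  have "f (u + s *\<^sub>R h) \<le> f (u + 0 *\<^sub>R h)" if "\<bar>0 - s\<bar> < \<epsilon>" for s
  proof (cases "s = 0")
    case False
    then have "u + s *\<^sub>R h \<in> W" using \<epsilon>(2)[of s] that by simp
    then show ?thesis using max V by (simp add: subspace_add subspace_scale)
  qed simp
  then have "h \<bullet> d = 0" using DERIV_local_max[OF der \<epsilon>(1)] by blast
  then show ?thesis by (simp add: inner_commute)
qed

locale smooth_iid = prob_space M for M :: "'w measure" +
  fixes \<mu> :: "'y measure" and Y :: "nat \<Rightarrow> 'w \<Rightarrow> 'y" and P :: "'y measure"
    and lik :: "'y \<Rightarrow> 'u::real_inner \<Rightarrow> real" and U :: "'u set"
  assumes indep: "indep_vars (\<lambda>_. \<mu>) Y UNIV" and distr_Y: "\<And>i. distr M \<mu> (Y i) = P"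
    and smooth: "smooth_loglik P lik U"
begin

definition "L n w u = (\<Sum>i<n. lik (Y i w) u)"
definition "EL n u = (\<integral>w. L n w u \<partial>M)"
definition "ell u = (\<integral>y. lik y u \<partial>P)"

lemma Y_measurable: "Y i \<in> measurable M \<mu>"
  using indep by (auto simp: indep_vars_def2)

lemma sets_P: "sets P = sets \<mu>"
  using sets_distr[of M \<mu> "Y 0"] distr_Y by simp

lemma space_P: "space P = space \<mu>"
  using sets_eq_imp_space_eq[OF sets_P] .

lemma Y_space: "w \<in> space M \<Longrightarrow> Y i w \<in> space P"
  using measurable_space[OF Y_measurable] space_P by blast

lemma measurable_P: "f \<in> borel_measurable P \<Longrightarrow> f \<in> borel_measurable \<mu>"
  using measurable_cong_sets[OF sets_P refl] by blast

lemma integrable_Y: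
  fixes f :: "'y \<Rightarrow> real"
  assumes "integrable P f"
  shows "integrable M (\<lambda>w. f (Y i w))"
  using assms integrable_distr_eq[OF Y_measurable measurable_P[OF borel_measurable_integrable[OF assms]], of i]
  by (simp add: distr_Y)

lemma integral_Y:
  fixes f :: "'y \<Rightarrow> real"
  assumes "f \<in> borel_measurable P"
  shows "(\<integral>w. f (Y i w) \<partial>M) = (\<integral>y. f y \<partial>P)"
  using integral_distr[OF Y_measurable measurable_P[OF assms], of i] by (simp add: distr_Y)

lemma indep_Y:
  fixes f :: "'y \<Rightarrow> real"
  assumes "f \<in> borel_measurable P"
  shows "indep_vars (\<lambda>_. borel) (\<lambda>i w. f (Y i w)) UNIV"
  by (rule indep_vars_compose2[OF indep]) (rule measurable_P[OF assms])

lemma sum_Y_second_moment: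
  fixes f :: "'y \<Rightarrow> real"
  assumes f: "f \<in> borel_measurable P" "integrable P (\<lambda>y. (f y)\<^sup>2)" "(\<integral>y. f y \<partial>P) = 0"
  shows "integrable M (\<lambda>w. (\<Sum>i<n. f (Y i w))\<^sup>2)"
    "(\<integral>w. (\<Sum>i<n. f (Y i w))\<^sup>2 \<partial>M) = real n * (\<integral>y. (f y)\<^sup>2 \<partial>P)"
  using expectation_sum_square[OF indep_Y[OF f(1)], of "\<integral>y. (f y)\<^sup>2 \<partial>P" n]
    integrable_Y[OF f(2)] integral_Y[of "\<lambda>y. (f y)\<^sup>2"] integral_Y[OF f(1)] f by auto

lemma open_U: "open U"
  and GDERIV_lik: "y \<in> space P \<Longrightarrow> u \<in> U \<Longrightarrow> GDERIV (lik y) u :> grad (lik y) u"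
  and continuous_grad_lik: "y \<in> space P \<Longrightarrow> continuous_on U (grad (lik y))"
  and integrable_lik: "u \<in> U \<Longrightarrow> integrable P (\<lambda>y. lik y u)"
  and GDERIV_ell: "u \<in> U \<Longrightarrow> GDERIV ell u :> grad ell u"
  and grad_ell_differentiable: "u \<in> U \<Longrightarrow> grad ell differentiable (at u)"
  and integrable_score: "u \<in> U \<Longrightarrow> integrable P (\<lambda>y. grad (lik y) u \<bullet> h)"
  and grad_ell_inner: "u \<in> U \<Longrightarrow> grad ell u \<bullet> h = (\<integral>y. grad (lik y) u \<bullet> h \<partial>P)"
  using smooth unfolding smooth_loglik_def ell_def[abs_def] by blast+

lemma integrable_L: "u \<in> U \<Longrightarrow> integrable M (\<lambda>w. L n w u)"
  unfolding L_def by (intro Bochner_Integration.integrable_sum integrable_Y integrable_lik)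

lemma EL_eq:
  assumes u: "u \<in> U"
  shows "EL n u = real n * ell u"
proof -
  have "EL n u = (\<Sum>i<n. \<integral>w. lik (Y i w) u \<partial>M)"
    unfolding EL_def L_def
    by (intro Bochner_Integration.integral_sum integrable_Y integrable_lik u)
  also have "\<dots> = real n * ell u"
    using integral_Y[of "\<lambda>y. lik y u"] integrable_lik[OF u] by (simp add: ell_def)
  finally show ?thesis .
qed

lemma GDERIV_L:
  assumes "w \<in> space M" "u \<in> U"
  shows "GDERIV (L n w) u :> (\<Sum>i<n. grad (lik (Y i w)) u)"
proof -
  have "((\<lambda>u. \<Sum>i<n. lik (Y i w) u) has_derivative (\<lambda>h. \<Sum>i<n. h \<bullet> grad (lik (Y i w)) u)) (at u)"
    using GDERIV_lik[OF Y_space[OF assms(1)] assms(2)] by (intro has_derivative_sum) (simp add: gderiv_def)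
  then show ?thesis by (simp add: gderiv_def L_def[abs_def] inner_sum_right)
qed

lemma grad_L: "w \<in> space M \<Longrightarrow> u \<in> U \<Longrightarrow> grad (L n w) u = (\<Sum>i<n. grad (lik (Y i w)) u)"
  by (rule grad_eqI[OF GDERIV_L])

lemma GDERIV_EL:
  assumes u: "u \<in> U"
  shows "GDERIV (EL n) u :> real n *\<^sub>R grad ell u"
  unfolding gderiv_def
\<comment> \<open>\<open>EL n\<close> is known to equal \<open>n * ell\<close> only on
  \<open>U\<close>, where the log-likelihood is integrable; openness of \<open>U\<close> transfers
  the derivative.\<close>
proof (rule has_derivative_transform_within_open[OF _ open_U u])
  show "((\<lambda>u. real n * ell u) has_derivative (\<lambda>h. h \<bullet> real n *\<^sub>R grad ell u)) (at u)"
    using has_derivative_mult_right[OF GDERIV_ell[OF u, unfolded gderiv_def], of "real n"]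
    by simp
qed (simp add: EL_eq)

lemma grad_EL: "u \<in> U \<Longrightarrow> grad (EL n) u = real n *\<^sub>R grad ell u"
  by (rule grad_eqI[OF GDERIV_EL])

lemma grad_zeta:
  assumes "w \<in> space M" "u \<in> U"
  shows "grad (\<lambda>v. L n w v - EL n v) u = grad (L n w) u - grad (EL n) u"
  using GDERIV_diff[OF GDERIV_L[OF assms, of n] GDERIV_EL[OF assms(2), of n]]
  by (simp add: grad_eqI grad_L[OF assms] grad_EL[OF assms(2)])

lemma hess_ell: "u \<in> U \<Longrightarrow> (grad ell has_derivative hess ell u) (at u)"
  unfolding hess_def using grad_ell_differentiable frechet_derivative_works by blast

lemma linear_hess: "u \<in> U \<Longrightarrow> linear (hess ell u)"
  using hess_ell has_derivative_linear by blast

lemma hess_EL: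
  assumes u: "u \<in> U"
  shows "hess (EL n) u = (\<lambda>h. real n *\<^sub>R hess ell u h)"
proof -
  have "(grad (EL n) has_derivative (\<lambda>h. real n *\<^sub>R hess ell u h)) (at u)"
    by (rule has_derivative_transform_within_open[OF has_derivative_scaleR_right[OF hess_ell[OF u]] open_U u])
       (simp add: grad_EL)
  then show ?thesis unfolding hess_def by (rule frechet_derivative_at[symmetric])
qed

lemma hess_EL_1: "u \<in> U \<Longrightarrow> hess (EL 1) u = hess ell u"
  by (simp add: hess_EL)

lemma continuous_grad_L: "w \<in> space M \<Longrightarrow> continuous_on U (grad (L n w))"
  by (rule continuous_on_eq[of _ "\<lambda>u. \<Sum>i<n. grad (lik (Y i w)) u"])
     (auto intro!: continuous_on_sum continuous_grad_lik Y_space simp: grad_L)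

lemma continuous_grad_EL: "continuous_on U (grad (EL n))"
proof -
  have "continuous_on U (grad ell)"
    using grad_ell_differentiable differentiable_imp_continuous_within continuous_on_eq_continuous_at[OF open_U] by blast
  then have "continuous_on U (\<lambda>u. real n *\<^sub>R grad ell u)" by (intro continuous_intros)
  then show ?thesis by (rule continuous_on_eq) (simp add: grad_EL)
qed

end

section \<open>The Fisher expansion at a fixed sieve dimension\<close>

text \<open>One sample size and one sieve dimension. The derived operators are parameters tied down
  by equations, so that the symbols of the theorem can be substituted for them directly;
  \<open>\<delta>\<close> is the curvature constant at the radius \<open>r0\<close>.\<close>

locale sieve_step = smooth_iid M \<mu> Y P lik U
  for M :: "'w measure" and \<mu> :: "'y measure" and Y P
    and lik :: "'y \<Rightarrow> (real^'p) \<times> 'x::real_inner \<Rightarrow> real" and U +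
  fixes e :: "nat \<Rightarrow> 'x" and \<Upsilon> :: "((real^'p) \<times> 'x) set" and n k :: nat
    and v0 :: "(real^'p) \<times> 'x" and \<delta> \<nu> g \<omega> r0 :: real
    and T :: "(real^'p) \<times> 'x \<Rightarrow> (real^'p) \<times> 'x \<Rightarrow> (real^'p) \<times> 'x"
    and V :: "((real^'p) \<times> 'x) set" and S S_inv :: "(real^'p) \<times> 'x \<Rightarrow> (real^'p) \<times> 'x"
    and loc :: "real \<Rightarrow> ((real^'p) \<times> 'x) set"
  assumes basis: "orthonormal_basis e" and sub: "\<Upsilon> \<subseteq> U"
    and T_def: "T = (\<lambda>u h. sieve_proj e k (- hess (EL n) u h))"
    and V_def: "V = UNIV \<times> sieve_space e k"
    and S_def: "S = sqrt_on V (T v0)" and S_inv_def: "S_inv = inv_into V S"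
    and loc_def: "loc = (\<lambda>r. {u \<in> \<Upsilon> \<inter> V. norm (S (u - v0)) \<le> r})"
    and v0: "v0 \<in> \<Upsilon> \<inter> V" and v0_max: "\<And>u. u \<in> \<Upsilon> \<inter> V \<Longrightarrow> EL n u \<le> EL n v0"
    and pos_def: "pos_def_on V (T v0)"
    and const: "0 < \<nu>" "0 < g" "0 < \<omega>" "0 < r0"
    and c1: "\<And>u. u \<in> loc r0 \<Longrightarrow>
        onorm (\<lambda>h. S_inv (T u (S_inv (sieve_proj e k h))) - sieve_proj e k h) \<le> \<delta>"
    and c3: "\<And>r u u' \<gamma>. 0 < r \<Longrightarrow> r < r0 \<Longrightarrow> u \<in> loc r \<Longrightarrow> u' \<in> loc r \<Longrightarrow> u \<noteq> u' \<Longrightarrow> \<gamma> \<in> V \<Longrightarrow> norm \<gamma> = 1 \<Longrightarrow>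
        log_mgf_bound M (\<lambda>w. (\<gamma> \<bullet> S_inv (sieve_proj e k (grad (\<lambda>v. L n w v - EL n v) u)
             - sieve_proj e k (grad (\<lambda>v. L n w v - EL n v) u'))) / (\<omega> * norm (S (u - u')))) \<nu> g"
    and interior: "\<exists>W. open W \<and> loc r0 \<subseteq> W \<and> W \<inter> V \<subseteq> \<Upsilon>"
    and convex_loc: "convex (loc r0)"
begin

abbreviation B :: "((real^'p) \<times> 'x) set" where "B \<equiv> sieve_basis e k"

lemma V_span: "span B = V"
  unfolding V_def by (rule span_sieve_basis[OF basis])

lemma orthonormal_B: "orthonormal_set B"
  by (rule orthonormal_sieve_basis[OF basis])

lemma proj_eq: "sieve_proj e k u = (\<Sum>b\<in>B. (u \<bullet> b) *\<^sub>R b)"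
  by (rule sieve_proj_eq[OF basis])

lemma proj_in: "sieve_proj e k u \<in> V"
  unfolding V_def by (rule sieve_proj_in[OF basis])

lemma inner_proj: "v \<in> V \<Longrightarrow> v \<bullet> sieve_proj e k u = v \<bullet> u"
  unfolding V_def by (rule inner_sieve_proj[OF basis])

lemma subspace_V: "subspace V"
  using subspace_span[of B] V_span by simp

lemma linear_T: "u \<in> U \<Longrightarrow> linear (T u)"
  unfolding T_def
  using linear_compose[OF linear_compose_neg[OF linear_compose_scale_right[OF linear_hess]] linear_sieve_proj]
  by (simp add: hess_EL o_def)

lemma T_in: "T u h \<in> V"
  unfolding T_def by (rule proj_in)

lemma v0_U: "v0 \<in> U"
  using v0 sub by blast

lemma pos_def_operator: "pos_def_operator B (T v0)"
proof (rule pos_def_operator.intro)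
  show "T v0 ` span B \<subseteq> span B" unfolding V_span using T_in by blast
qed (simp_all add: V_span orthonormal_B linear_T[OF v0_U] pos_def)

lemma eff_block: "eff_block (sieve_space e k) (T v0)"
  using pos_def_operator V_span by (intro eff_blockI subspace_sieve_space) (simp_all add: V_def)

sublocale op: pos_def_operator B "T v0"
  rewrites "span B = V" and "sqrt_on V (T v0) = S" and "inv_into V S = S_inv"
  by (rule pos_def_operator) (simp_all add: V_span S_def S_inv_def)

sublocale blk: eff_block "sieve_space e k" "T v0"
  rewrites "UNIV \<times> sieve_space e k = V"
  by (rule eff_block) (simp add: V_def)

lemma v0_loc: "v0 \<in> loc r0"
  using v0 const linear_0[OF op.sqrt_linear] by (simp add: loc_def)

lemma locD: "u \<in> loc r \<Longrightarrow> u \<in> U" "u \<in> loc r \<Longrightarrow> u \<in> V" "u \<in> loc r \<Longrightarrow> u - v0 \<in> V"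
    "u \<in> loc r \<Longrightarrow> norm (S (u - v0)) \<le> r"
  using sub v0 subspace_diff[OF subspace_V] by (auto simp: loc_def)

text \<open>The assumption \<open>interior\<close> surrounds the local set by an open set whose
  trace on \<open>V\<close> stays in the parameter set, so a maximiser found in the local set is
  interior relative to \<open>V\<close>.\<close>

lemma first_order:
  assumes "u \<in> loc r0" "GDERIV f u :> d" "\<And>v. v \<in> \<Upsilon> \<inter> V \<Longrightarrow> f v \<le> f u" "h \<in> V"
  shows "d \<bullet> h = 0"
proof -
  obtain W where W: "open W" "loc r0 \<subseteq> W" "W \<inter> V \<subseteq> \<Upsilon>" using interior by blast
  show ?thesis
    by (rule GDERIV_local_max_subspace[OF assms(2) subspace_V _ assms(4) W(1)])
       (use assms W locD in auto)
qed

lemma grad_EL_target: "h \<in> V \<Longrightarrow> grad (EL n) v0 \<bullet> h = 0"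
  using first_order[OF v0_loc GDERIV_EL[OF v0_U] v0_max] by (simp add: grad_EL[OF v0_U])

lemma S_inv_T: "a \<in> V \<Longrightarrow> S a \<bullet> S_inv (T u b) = a \<bullet> T u b"
  using op.sqrt_inv_sym[OF op.sqrt_range T_in] op.sqrt_inv by simp

text \<open>As \<open>S\<close> is self-adjoint, the difference is the pairing of \<open>S a\<close>
  with the normalised curvature defect applied to \<open>S b\<close>, and condition (1) bounds the
  operator norm of that defect.\<close>

lemma curvature_bound:
  assumes u: "u \<in> loc r0" and a: "a \<in> V" and b: "b \<in> V"
  shows "\<bar>a \<bullet> T u b - S a \<bullet> S b\<bar> \<le> \<delta> * norm (S a) * norm (S b)"
proof -
  define G where "G h = S_inv (T u (S_inv (sieve_proj e k h))) - sieve_proj e k h" for h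
  have fin: "finite B" by (rule orthonormal_setD[OF orthonormal_B])
  have bV: "b \<in> V" if "b \<in> B" for b using that V_span span_base by blast
  \<comment> \<open>\<open>onorm\<close> bounds the values of bounded linear maps; this finite sum
    exhibits \<open>G\<close> as one.\<close>
  have "G h = (\<Sum>b\<in>B. (h \<bullet> b) *\<^sub>R (S_inv (T u (S_inv b)) - b))" for h
  proof -
    have "S_inv (sieve_proj e k h) = (\<Sum>b\<in>B. (h \<bullet> b) *\<^sub>R S_inv b)"
      unfolding proj_eq by (rule op.sqrt_inv_sum[OF fin bV])
    then have "T u (S_inv (sieve_proj e k h)) = (\<Sum>b\<in>B. (h \<bullet> b) *\<^sub>R T u (S_inv b))"
      using linear_T[OF locD(1)[OF u]] by (simp add: linear_sum linear_scale)
    then have "S_inv (T u (S_inv (sieve_proj e k h))) = (\<Sum>b\<in>B. (h \<bullet> b) *\<^sub>R S_inv (T u (S_inv b)))"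
      using op.sqrt_inv_sum[OF fin T_in] by simp
    then show ?thesis by (simp add: G_def proj_eq scaleR_diff_right sum_subtractf)
  qed
  moreover have "bounded_linear (\<lambda>h. \<Sum>b\<in>B. (h \<bullet> b) *\<^sub>R (S_inv (T u (S_inv b)) - b))"
    by (intro bounded_linear_sum bounded_linear_scaleR_const bounded_linear_inner_left)
  ultimately have G: "bounded_linear G" by presburger
  have "norm (G (S b)) \<le> onorm G * norm (S b)" by (rule onorm[OF G])
  also have "\<dots> \<le> \<delta> * norm (S b)" using c1[OF u] by (intro mult_right_mono) (simp_all add: G_def[abs_def])
  finally have Gb: "norm (G (S b)) \<le> \<delta> * norm (S b)" .
  have "sieve_proj e k (S b) = S b"
    using sieve_proj_id[OF basis] op.sqrt_range unfolding V_def by blast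
  then have "G (S b) = S_inv (T u b) - S b" using op.sqrt_inv[OF b] by (simp add: G_def)
  then have "a \<bullet> T u b - S a \<bullet> S b = S a \<bullet> G (S b)" using S_inv_T[OF a] by (simp add: inner_diff_right)
  also have "\<bar>\<dots>\<bar> \<le> norm (S a) * norm (G (S b))" by (rule Cauchy_Schwarz_ineq2)
  also have "\<dots> \<le> norm (S a) * (\<delta> * norm (S b))" using Gb by (intro mult_left_mono) auto
  finally show ?thesis by (simp add: mult_ac)
qed

text \<open>The curvature bound is tested on a vector of unit \<open>S\<close>-norm, which exists
  because the theta-space is nontrivial.\<close>

lemma delta_nonneg: "0 \<le> \<delta>"
proof -
  let ?a = "S_inv (axis undefined 1, 0)"
  have "(axis undefined 1, 0) \<in> V" using subspace_0[OF subspace_sieve_space] by (simp add: V_def)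
  then have a: "?a \<in> V" "S ?a = (axis undefined 1, 0)" using op.sqrt_inv_in op.sqrt_of_inv by auto
  have "0 \<le> \<delta> * norm (S ?a) * norm (S ?a)"
    using order_trans[OF abs_ge_zero curvature_bound[OF v0_loc a(1) a(1)]] .
  moreover have "norm (S ?a) = 1" using a(2) by (simp add: norm_Pair)
  ultimately show ?thesis by simp
qed

text \<open>The expected score vanishes on \<open>V\<close> at the target. The mean value theorem
  along the segment to \<open>u\<close>, which stays in the convex local set, expresses its value at
  \<open>u\<close> by one intermediate curvature.\<close>

lemma bias_bound:
  assumes u: "u \<in> loc r0" and h: "h \<in> V"
  shows "\<bar>h \<bullet> grad (EL n) u + S h \<bullet> S (u - v0)\<bar> \<le> \<delta> * r0 * norm (S h)"
proof -
  let ?p = "\<lambda>s::real. v0 + s *\<^sub>R (u - v0)"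
  have seg: "?p s \<in> loc r0" if "0 \<le> s" "s \<le> 1" for s
    using convexD_alt[OF convex_loc v0_loc u that] by (simp add: algebra_simps)
  have "((\<lambda>s. h \<bullet> grad (EL n) (?p s)) has_real_derivative h \<bullet> hess (EL n) (?p s) (u - v0)) (at s)"
    if s: "0 \<le> s" "s \<le> 1" for s
  proof -
    have pU: "?p s \<in> U" using locD(1)[OF seg[OF s]] .
    have "(grad (EL n) has_derivative hess (EL n) (?p s)) (at (?p s))"
      unfolding hess_EL[OF pU]
      by (rule has_derivative_transform_within_open[OF has_derivative_scaleR_right[OF hess_ell[OF pU]] open_U pU])
         (simp add: grad_EL)
    moreover have "(?p has_derivative (\<lambda>t. t *\<^sub>R (u - v0))) (at s)"
      by (auto intro!: derivative_eq_intros)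
    ultimately have "((\<lambda>s. grad (EL n) (?p s)) has_derivative (\<lambda>t. hess (EL n) (?p s) (t *\<^sub>R (u - v0)))) (at s)"
      using has_derivative_compose by fastforce
    then have "((\<lambda>s. h \<bullet> grad (EL n) (?p s)) has_derivative (\<lambda>t. h \<bullet> hess (EL n) (?p s) (t *\<^sub>R (u - v0)))) (at s)"
      by (rule has_derivative_inner_right)
    moreover have "hess (EL n) (?p s) (t *\<^sub>R (u - v0)) = t *\<^sub>R hess (EL n) (?p s) (u - v0)" for t
      using linear_scale[OF linear_hess[OF pU]] by (simp add: hess_EL[OF pU] mult.commute)
    ultimately show ?thesis by (simp add: has_field_derivative_def mult_commute_abs)
  qed
  then obtain s where s: "0 < s" "s < 1"
    and mvt: "h \<bullet> grad (EL n) (?p 1) - h \<bullet> grad (EL n) (?p 0) = (1 - 0) * (h \<bullet> hess (EL n) (?p s) (u - v0))"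
    using MVT2[of 0 1 "\<lambda>s. h \<bullet> grad (EL n) (?p s)" "\<lambda>s. h \<bullet> hess (EL n) (?p s) (u - v0)"] by auto
  have "h \<bullet> T (?p s) (u - v0) = - (h \<bullet> hess (EL n) (?p s) (u - v0))"
    unfolding T_def using inner_proj[OF h] by simp
  then have "h \<bullet> grad (EL n) u = - (h \<bullet> T (?p s) (u - v0))"
    using mvt grad_EL_target[OF h] by (simp add: inner_commute)
  then have "\<bar>h \<bullet> grad (EL n) u + S h \<bullet> S (u - v0)\<bar> = \<bar>h \<bullet> T (?p s) (u - v0) - S h \<bullet> S (u - v0)\<bar>"
    by (simp add: abs_minus_commute)
  also have "\<dots> \<le> \<delta> * norm (S h) * norm (S (u - v0))"
    by (rule curvature_bound) (use s in \<open>auto intro: seg h locD(3)[OF u]\<close>)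
  also have "\<dots> \<le> \<delta> * norm (S h) * r0" using delta_nonneg locD(4)[OF u] by (intro mult_left_mono) auto
  finally show ?thesis by (simp add: mult_ac)
qed

abbreviation "zeta' w u \<equiv> grad (L n w) u - grad (EL n) u"

text \<open>The factor 48 is the chaining constant 12 times 4, because successive net points in a
  ball of radius \<open>r0\<close> are at most \<open>4 * r0 / 2 ^ j\<close> apart.\<close>

definition "stoch x = 48 * \<omega> * r0 * \<nu> * zq (\<nu> * g) (x + 4 * (real CARD('p) + real k))"

lemma tendsto_zeta':
  assumes w: "w \<in> space M" and v: "v \<in> V" "v0 + S_inv v \<in> U"
    and vs: "\<And>j. vs j \<in> V" "vs \<longlonglongrightarrow> v"
  shows "(\<lambda>j. a \<bullet> zeta' w (v0 + S_inv (vs j))) \<longlonglongrightarrow> a \<bullet> zeta' w (v0 + S_inv v)"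
proof -
  have "(\<lambda>j. \<Sum>b\<in>B. (vs j \<bullet> b) *\<^sub>R S_inv b) \<longlonglongrightarrow> (\<Sum>b\<in>B. (v \<bullet> b) *\<^sub>R S_inv b)"
    by (intro tendsto_intros vs)
  then have "(\<lambda>j. v0 + S_inv (vs j)) \<longlonglongrightarrow> v0 + S_inv v"
    using op.sqrt_inv_expansion[OF vs(1)] op.sqrt_inv_expansion[OF v(1)] by (intro tendsto_intros) simp
  moreover have "continuous_on U (\<lambda>u. a \<bullet> zeta' w u)"
    by (intro continuous_intros continuous_grad_L continuous_grad_EL w)
  then have "isCont (\<lambda>u. a \<bullet> zeta' w u) (v0 + S_inv v)"
    using continuous_on_eq_continuous_at[OF open_U] v(2) by blast
  ultimately show ?thesis by (rule isCont_tendsto_compose[rotated])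
qed

text \<open>In the coordinate \<open>v = S (u - v0)\<close> the local set lies in a Euclidean ball
  and the increment scale of condition (3) is \<open>\<omega>\<close> times Euclidean distance,
  which is the setting of chaining.\<close>

lemma stochastic_bound:
  assumes \<gamma>: "\<gamma> \<in> V" "norm \<gamma> = 1" and x: "1 \<le> x"
  obtains A where "A \<in> sets M" "measure M A \<le> 2 * exp (- x)"
    "\<And>w u. w \<in> space M - A \<Longrightarrow> u \<in> loc r0 \<Longrightarrow> \<bar>S_inv \<gamma> \<bullet> (zeta' w u - zeta' w v0)\<bar> \<le> stoch x"
proof -
  \<comment> \<open>The norm bound is strict because condition (3) is available only at radii below
    \<open>r0\<close>.\<close>
  define Z where "Z = {v \<in> V. v0 + S_inv v \<in> loc r0 \<and> norm v < r0}"
  define D where "D = real CARD('p) + real k"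
  define f where "f v w = S_inv \<gamma> \<bullet> zeta' w (v0 + S_inv v)" for v w
  have SS: "S (v0 + S_inv v - v0) = v" if "v \<in> V" for v using op.sqrt_of_inv[OF that] by simp
  have ZV: "Z \<subseteq> span B" by (auto simp: Z_def V_span)
  have S_inv_0: "S_inv 0 = 0"
    using op.sqrt_inv[OF subspace_0[OF subspace_V]] linear_0[OF op.sqrt_linear] by simp
  have Z0: "0 \<in> Z" using v0_loc const subspace_0[OF subspace_V] by (simp add: Z_def S_inv_0)
  obtain \<pi> where \<pi>: "\<And>j u. u \<in> Z \<Longrightarrow> \<pi> j u \<in> Z" "\<And>u. \<pi> 0 u = 0"
    "\<And>j u. u \<in> Z \<Longrightarrow> norm (\<pi> j u - \<pi> (Suc j) u) \<le> 4 * r0 / 2 ^ j"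
    "\<And>j u. u \<in> Z \<Longrightarrow> norm (\<pi> j u - u) \<le> 2 * r0 / 2 ^ j"
    "\<And>j. finite (\<pi> j ` Z)" "\<And>j. real (card (\<pi> j ` Z)) \<le> exp (card B * (real j + 4))"
  proof (rule nested_nets[OF orthonormal_B sieve_basis_nonempty ZV _ const(4) Z0])
    show "norm u \<le> r0" if "u \<in> Z" for u using that by (simp add: Z_def)
  qed blast
  have inc: "0 < \<omega> * norm (u - v) \<and> log_mgf_bound M (\<lambda>w. (f u w - f v w) / (\<omega> * norm (u - v))) \<nu> g"
    if u: "u \<in> Z" and v: "v \<in> Z" and ne: "u \<noteq> v" for u v
  proof -
    have uv: "u \<in> V" "v \<in> V" using u v by (auto simp: Z_def)
    \<comment> \<open>Both points lie in the local set of radius \<open>?r\<close>, which is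
      positive because they differ and below \<open>r0\<close> by strictness.\<close>
    let ?u = "v0 + S_inv u" and ?v = "v0 + S_inv v" and ?r = "max (norm u) (norm v)"
    have loc: "?u \<in> loc ?r" "?v \<in> loc ?r" and U: "?u \<in> U" "?v \<in> U"
      using u v SS sub by (auto simp: Z_def loc_def)
    have ne': "?u \<noteq> ?v" using ne SS[OF uv(1)] SS[OF uv(2)] by auto
    have r: "0 < ?r" "?r < r0" using u v ne by (auto simp: Z_def less_max_iff_disj)
    have S_diff: "S (?u - ?v) = u - v"
      using SS[OF uv(1)] SS[OF uv(2)] by (simp add: linear_diff[OF op.sqrt_linear])
    have "\<gamma> \<bullet> S_inv (sieve_proj e k (grad (\<lambda>v. L n w v - EL n v) ?u)
             - sieve_proj e k (grad (\<lambda>v. L n w v - EL n v) ?v)) = f u w - f v w" if w: "w \<in> space M" for w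
    proof -
      have "\<gamma> \<bullet> S_inv (sieve_proj e k a - sieve_proj e k b) = S_inv \<gamma> \<bullet> a - S_inv \<gamma> \<bullet> b" for a b
        using op.sqrt_inv_sym[OF \<gamma>(1) subspace_diff[OF subspace_V proj_in proj_in]]
          inner_proj[OF op.sqrt_inv_in[OF \<gamma>(1)]] by (simp add: inner_diff_right)
      then show ?thesis by (simp add: f_def grad_zeta[OF w] U)
    qed
    then have "log_mgf_bound M (\<lambda>w. (\<gamma> \<bullet> S_inv (sieve_proj e k (grad (\<lambda>v. L n w v - EL n v) ?u)
             - sieve_proj e k (grad (\<lambda>v. L n w v - EL n v) ?v))) / (\<omega> * norm (S (?u - ?v)))) \<nu> g
        \<longleftrightarrow> log_mgf_bound M (\<lambda>w. (f u w - f v w) / (\<omega> * norm (u - v))) \<nu> g"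
      unfolding log_mgf_bound_def S_diff
      by (simp cong: Bochner_Integration.integrable_cong Bochner_Integration.integral_cong)
    then show ?thesis using c3[OF r loc ne' \<gamma>] const ne by simp
  qed
  have conv: "(\<lambda>j. f (\<pi> j u) w) \<longlonglongrightarrow> f u w" if w: "w \<in> space M" and u: "u \<in> Z" for w u
    unfolding f_def
  proof (rule tendsto_zeta'[OF w])
    show "u \<in> V" "v0 + S_inv u \<in> U" using u unfolding Z_def by (blast intro: locD(1))+
    show "\<pi> j u \<in> V" for j using \<pi>(1)[OF u] by (auto simp: Z_def)
    have "(\<lambda>j. \<pi> j u - u) \<longlonglongrightarrow> 0"
    proof (rule Lim_null_comparison)
      show "\<forall>\<^sub>F j in sequentially. norm (\<pi> j u - u) \<le> 2 * r0 / 2 ^ j" using \<pi>(4)[OF u] by simp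
      have "(\<lambda>j. 2 * r0 * (1 / 2) ^ j) \<longlonglongrightarrow> 2 * r0 * 0" by (intro tendsto_intros LIMSEQ_realpow_zero) auto
      then show "(\<lambda>j. 2 * r0 / 2 ^ j) \<longlonglongrightarrow> 0" by (simp add: power_divide)
    qed
    then show "(\<lambda>j. \<pi> j u) \<longlonglongrightarrow> u" by (rule Lim_transform2[OF tendsto_const, rotated, simplified] | simp add: LIM_zero_iff)
  qed
  have card: "real (card (\<pi> j ` Z)) \<le> exp (D * (real j + 4))" for j
  proof -
    have "real (card B) \<le> D" using card_sieve_basis[of e k, where 'p='p] by (simp add: D_def flip: of_nat_add)
    then have "exp (card B * (real j + 4)) \<le> exp (D * (real j + 4))" by (simp add: mult_right_mono)
    then show ?thesis using \<pi>(6)[of j] by linarith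
  qed
  have step: "\<omega> * norm (\<pi> j u - \<pi> (Suc j) u) \<le> (4 * \<omega> * r0) / 2 ^ j" if "u \<in> Z" for j u
    using mult_left_mono[OF \<pi>(3)[OF that, of j], of \<omega>] const by (simp add: mult_ac)
  obtain A where A: "A \<in> sets M" "measure M A \<le> 2 * exp (- x)"
    "\<And>w u. w \<in> space M - A \<Longrightarrow> u \<in> Z \<Longrightarrow> \<bar>f u w - f 0 w\<bar> \<le> 12 * (4 * \<omega> * r0) * \<nu> * zq (\<nu> * g) (x + 4 * D)"
    by (rule chaining_bound[of \<nu> g "4 * \<omega> * r0" D x Z "\<lambda>u v. \<omega> * norm (u - v)" f \<pi> 0])
       (use const x inc \<pi> step card conv in \<open>auto simp: D_def\<close>)
  have stoch: "12 * (4 * \<omega> * r0) * \<nu> * zq (\<nu> * g) (x + 4 * D) = stoch x" by (simp add: stoch_def D_def)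
  show ?thesis
  proof (rule that[OF A(1,2)])
    fix w u assume w: "w \<in> space M - A" and u: "u \<in> loc r0"
    define v where "v = S (u - v0)"
    have v: "v \<in> V" "S_inv v = u - v0" "norm v \<le> r0"
      using op.sqrt_range op.sqrt_inv[OF locD(3)[OF u]] locD(4)[OF u] by (auto simp: v_def)
    \<comment> \<open>Points on the boundary of the ball are reached by shrinking towards the
      centre, which convexity permits, and letting the factor tend to 1.\<close>
    define s where "s j = 1 - 1 / (real j + 2)" for j :: nat
    have s: "0 \<le> s j" "s j < 1" for j by (auto simp: s_def field_simps)
    have sZ: "s j *\<^sub>R v \<in> Z" for j
    proof -
      have sv: "s j *\<^sub>R v = S (s j *\<^sub>R (u - v0))" by (simp add: v_def linear_scale[OF op.sqrt_linear])
      have "S_inv (s j *\<^sub>R v) = s j *\<^sub>R (u - v0)"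
        unfolding sv by (rule op.sqrt_inv[OF subspace_scale[OF subspace_V locD(3)[OF u]]])
      moreover have "v0 + s j *\<^sub>R (u - v0) \<in> loc r0"
        using convexD_alt[OF convex_loc v0_loc u, of "s j"] s[of j] by (simp add: algebra_simps)
      moreover have "norm (s j *\<^sub>R v) < r0"
      proof (cases "norm v = 0")
        case False
        then have "s j * norm v < 1 * norm v" using s[of j] by (intro mult_strict_right_mono) auto
        then show ?thesis using v(3) s[of j] by simp
      qed (use const in simp)
      ultimately show ?thesis using subspace_scale[OF subspace_V v(1)] by (simp add: Z_def)
    qed
    have "(\<lambda>j. 1 / (real j + 2)) \<longlonglongrightarrow> 0"
      using LIMSEQ_ignore_initial_segment[OF lim_1_over_n, of 2] by (simp add: add.commute)
    then have "(\<lambda>j. s j *\<^sub>R v) \<longlonglongrightarrow> (1 - 0) *\<^sub>R v" unfolding s_def by (intro tendsto_intros)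
    then have "(\<lambda>j. f (s j *\<^sub>R v) w) \<longlonglongrightarrow> f v w"
      unfolding f_def using w sZ v locD(1)[OF u] by (intro tendsto_zeta') (auto simp: Z_def)
    then have "(\<lambda>j. \<bar>f (s j *\<^sub>R v) w - f 0 w\<bar>) \<longlonglongrightarrow> \<bar>f v w - f 0 w\<bar>" by (intro tendsto_intros)
    then have "\<bar>f v w - f 0 w\<bar> \<le> stoch x"
      by (rule LIMSEQ_le_const2) (use A(3)[OF w sZ] stoch in auto)
    then show "\<bar>S_inv \<gamma> \<bullet> (zeta' w u - zeta' w v0)\<bar> \<le> stoch x"
      using v by (simp add: f_def S_inv_0 inner_diff_right)
  qed
qed

lemma norm_S_lfd: "(norm (S (blk.lfd t)))\<^sup>2 = t \<bullet> (blk.E *v t)"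
  using op.norm_sqrt[OF blk.lfd_in] blk.inner_lfd by simp

text \<open>
  Only the p directions spanning the least favourable subspace enter, so the process needs to be
  controlled for finitely many fixed directions instead of uniformly over the sphere.
\<close>

lemma fisher_expansion:
  assumes x: "1 \<le> x"
  obtains A where "A \<in> sets M" "measure M A \<le> 2 * real CARD('p) * exp (- x)"
    "\<And>w u q. w \<in> space M - A \<Longrightarrow> u \<in> loc r0 \<Longrightarrow> (\<And>v. v \<in> \<Upsilon> \<inter> V \<Longrightarrow> L n w v \<le> L n w u) \<Longrightarrow>
      blk.E *v q = blk.E *v (fst u - fst v0) - eff_score (sieve_space e k) (T v0) (grad (L n w) v0) \<Longrightarrow>
      sqrt (q \<bullet> (blk.E *v q)) \<le> \<delta> * r0 + real CARD('p) * stoch x"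
proof -
  let ?E = "blk.E"
  let ?R = "msqrt ?E"
  \<comment> \<open>Columns of the inverse root of the efficient information, so that the vectors
    \<open>\<gamma> i\<close> have norm 1.\<close>
  define t where "t i = matrix_inv ?R *v axis i 1" for i
  define \<gamma> where "\<gamma> i = S (blk.lfd (t i))" for i
  have R_inv: "invertible ?R" by (rule msqrt_invertible[OF blk.pos_def_E])
  have "t i \<bullet> (?E *v t i) = 1" for i
    using norm_msqrt[OF blk.pos_def_E, of "t i"]
    by (simp add: t_def matrix_inv_vector(1)[OF R_inv])
  then have n\<gamma>: "norm (\<gamma> i) = 1" for i
    using norm_S_lfd[of "t i"] by (simp add: \<gamma>_def power2_eq_1_iff) (metis norm_ge_zero not_one_le_zero zero_le_one neg_0_le_iff_le)
  have \<gamma>V: "\<gamma> i \<in> V" for i unfolding \<gamma>_def by (rule op.sqrt_range)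
  have "\<forall>i. \<exists>A. A \<in> sets M \<and> measure M A \<le> 2 * exp (- x) \<and>
    (\<forall>w u. w \<in> space M - A \<longrightarrow> u \<in> loc r0 \<longrightarrow> \<bar>S_inv (\<gamma> i) \<bullet> (zeta' w u - zeta' w v0)\<bar> \<le> stoch x)"
  proof
    fix i
    show "\<exists>A. A \<in> sets M \<and> measure M A \<le> 2 * exp (- x) \<and>
      (\<forall>w u. w \<in> space M - A \<longrightarrow> u \<in> loc r0 \<longrightarrow> \<bar>S_inv (\<gamma> i) \<bullet> (zeta' w u - zeta' w v0)\<bar> \<le> stoch x)"
      by (rule stochastic_bound[OF \<gamma>V n\<gamma> x]) blast
  qed
  then obtain A where A: "\<And>i. A i \<in> sets M" "\<And>i. measure M (A i) \<le> 2 * exp (- x)"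
    "\<And>i w u. w \<in> space M - A i \<Longrightarrow> u \<in> loc r0 \<Longrightarrow> \<bar>S_inv (\<gamma> i) \<bullet> (zeta' w u - zeta' w v0)\<bar> \<le> stoch x"
    by metis
  have "measure M (\<Union>i. A i) \<le> (\<Sum>i\<in>UNIV. measure M (A i))"
    using A(1) by (intro finite_measure_subadditive_finite) auto
  also have "\<dots> \<le> 2 * real CARD('p) * exp (- x)"
    using sum_bounded_above[of UNIV "\<lambda>i. measure M (A i)" "2 * exp (- x)"] A(2) by simp
  finally have PA: "measure M (\<Union>i. A i) \<le> 2 * real CARD('p) * exp (- x)" .
  show ?thesis
  proof (rule that[OF _ PA])
    show "(\<Union>i. A i) \<in> sets M" using A(1) by blast
    fix w u q assume w: "w \<in> space M - (\<Union>i. A i)" and u: "u \<in> loc r0"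
      and max: "\<And>v. v \<in> \<Upsilon> \<inter> V \<Longrightarrow> L n w v \<le> L n w u"
      and q: "?E *v q = ?E *v (fst u - fst v0) - eff_score (sieve_space e k) (T v0) (grad (L n w) v0)"
    have wM: "w \<in> space M" and wA: "\<And>i. w \<in> space M - A i" using w by auto
    let ?h = "blk.lfd q"
    let ?N = "norm (S ?h)"
    have N: "?N = sqrt (q \<bullet> (?E *v q))" using norm_S_lfd[of q] by (metis norm_ge_zero real_sqrt_unique)
    \<comment> \<open>The score equation of the maximiser, tested in the least favourable direction
      of the error \<open>q\<close> itself.\<close>
    have fo: "?h \<bullet> grad (L n w) u = 0"
      using first_order[OF u GDERIV_L[OF wM locD(1)[OF u]] max blk.lfd_in]
      by (simp add: grad_L[OF wM locD(1)[OF u]] inner_commute)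
    have target: "?h \<bullet> grad (EL n) v0 = 0" using grad_EL_target[OF blk.lfd_in] by (simp add: inner_commute)
    have "q \<bullet> (?E *v q) = (fst u - fst v0) \<bullet> (?E *v q) - ?h \<bullet> grad (L n w) v0"
      using pos_def_matrixD(1)[OF blk.pos_def_E, of "fst u - fst v0" q] blk.eff_score_inner[of q]
      by (simp add: q inner_diff_right inner_commute)
    also have "(fst u - fst v0) \<bullet> (?E *v q) = S ?h \<bullet> S (u - v0)"
      using blk.inner_T_lfd[OF locD(3)[OF u]] op.sqrt_inner[OF blk.lfd_in] by (simp add: inner_commute)
    \<comment> \<open>The vanishing terms \<open>fo\<close> and \<open>target\<close> are inserted
      so that the first bracket is the bias and the rest a centred increment.\<close>
    finally have split: "q \<bullet> (?E *v q)
        = (?h \<bullet> grad (EL n) u + S ?h \<bullet> S (u - v0)) + ?h \<bullet> (zeta' w u - zeta' w v0)"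
      by (simp add: inner_diff_right fo target)
    have "\<bar>?h \<bullet> (zeta' w u - zeta' w v0)\<bar> \<le> real CARD('p) * stoch x * ?N"
    proof -
      \<comment> \<open>The coordinates of \<open>q\<close> in the frame \<open>t\<close>; each is
        at most \<open>?N\<close> in absolute value, which costs the factor \<open>CARD('p)\<close>
        on summation.\<close>
      define s where "s = ?R *v q"
      have ns: "norm s = ?N" unfolding N using norm_msqrt[OF blk.pos_def_E, of q]
        by (metis norm_ge_zero real_sqrt_unique s_def)
      have "q = matrix_inv ?R *v s" by (simp add: s_def matrix_inv_vector(2)[OF R_inv])
      also have "s = (\<Sum>i\<in>UNIV. s $ i *\<^sub>R axis i 1)" using basis_expansion[of s] by (simp add: scalar_mult_eq_scaleR)
      finally have "q = (\<Sum>i\<in>UNIV. s $ i *\<^sub>R t i)"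
        by (simp add: t_def linear_sum[OF matrix_vector_mul_linear] matrix_vector_mult_scaleR)
      then have "?h = (\<Sum>i\<in>UNIV. s $ i *\<^sub>R blk.lfd (t i))"
        by (simp add: linear_sum[OF blk.linear_lfd] linear_scale[OF blk.linear_lfd])
      also have "\<dots> = (\<Sum>i\<in>UNIV. s $ i *\<^sub>R S_inv (\<gamma> i))"
        by (simp add: \<gamma>_def op.sqrt_inv[OF blk.lfd_in])
      finally have "?h \<bullet> (zeta' w u - zeta' w v0) = (\<Sum>i\<in>UNIV. s $ i * (S_inv (\<gamma> i) \<bullet> (zeta' w u - zeta' w v0)))"
        by (simp add: inner_sum_left)
      also have "\<bar>\<dots>\<bar> \<le> (\<Sum>i\<in>(UNIV::'p set). ?N * stoch x)"
      proof (intro order_trans[OF sum_abs] sum_mono)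
        fix i
        have "\<bar>s $ i\<bar> * \<bar>S_inv (\<gamma> i) \<bullet> (zeta' w u - zeta' w v0)\<bar> \<le> ?N * stoch x"
          using component_le_norm_cart[of s i] A(3)[OF wA u] ns by (intro mult_mono) auto
        then show "\<bar>s $ i * (S_inv (\<gamma> i) \<bullet> (zeta' w u - zeta' w v0))\<bar> \<le> ?N * stoch x"
          by (simp add: abs_mult)
      qed
      finally show ?thesis by (simp add: mult_ac)
    qed
    then have "q \<bullet> (?E *v q) \<le> \<delta> * r0 * ?N + real CARD('p) * stoch x * ?N"
      using bias_bound[OF u blk.lfd_in, of q] unfolding split by linarith
    \<comment> \<open>Every term is linear in \<open>?N\<close>, so one factor cancels; for
      \<open>?N = 0\<close> the right side has to be nonnegative.\<close>
    then have "?N * ?N \<le> (\<delta> * r0 + real CARD('p) * stoch x) * ?N"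
      using norm_S_lfd[of q] by (simp add: power2_eq_square algebra_simps)
    moreover have "0 \<le> \<delta> * r0 + real CARD('p) * stoch x"
    proof -
      have "0 \<le> stoch x" unfolding stoch_def
        using const x by (intro mult_nonneg_nonneg zq_nonneg) auto
      then show ?thesis using delta_nonneg const by simp
    qed
    ultimately have "?N \<le> \<delta> * r0 + real CARD('p) * stoch x"
      by (cases "?N = 0") (auto simp: mult_le_cancel_right)
    then show "sqrt (q \<bullet> (?E *v q)) \<le> \<delta> * r0 + real CARD('p) * stoch x" by (simp add: N)
  qed
qed

end

section \<open>Limits of information matrices and efficient scores\<close>

text \<open>The sieve information at the target is compared with that at the truth, and the latter
  with the full one; the score covariance is compared with the first. All relative errors are then
  referred to \<open>F\<close>.\<close>

lemma info_limit:
  fixes E Es N :: "nat \<Rightarrow> real^'p^'p" and F :: "real^'p^'p"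
  assumes pd: "\<And>k. k \<ge> k0 \<Longrightarrow> pos_def_matrix (E k)" "\<And>k. k \<ge> k0 \<Longrightarrow> pos_def_matrix (Es k)" "pos_def_matrix F"
    and lim1: "(\<lambda>k. spectral_norm (mat 1 - matrix_inv (msqrt (Es k)) ** F ** matrix_inv (msqrt (Es k)))) \<longlonglongrightarrow> 0"
    and lim2: "(\<lambda>k. spectral_norm (mat 1 - matrix_inv (msqrt (E k)) ** Es k ** matrix_inv (msqrt (E k)))) \<longlonglongrightarrow> 0"
    and lim3: "(\<lambda>k. spectral_norm (matrix_inv (msqrt (E k)) ** N k ** matrix_inv (msqrt (E k)) - mat 1)) \<longlonglongrightarrow> 0"
    and \<eta>: "0 < \<eta>"
  shows "\<forall>\<^sub>F k in sequentially. \<forall>t. \<bar>t \<bullet> (E k *v t) - t \<bullet> (F *v t)\<bar> \<le> \<eta> * (t \<bullet> (F *v t)) \<and>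
    \<bar>t \<bullet> (N k *v t) - t \<bullet> (F *v t)\<bar> \<le> \<eta> * (t \<bullet> (F *v t))"
proof -
  \<comment> \<open>With \<open>\<epsilon> \<le> 1/2\<close> the form of \<open>Es k\<close> is at
    most 2 times and that of \<open>E k\<close> at most 4 times the form of \<open>F\<close>; the
    errors add up to \<open>2 + 4 + 4\<close> times \<open>\<epsilon>\<close>.\<close>
  define \<epsilon> where "\<epsilon> = min (1/2) (\<eta> / 10)"
  have \<epsilon>: "0 < \<epsilon>" "\<epsilon> \<le> 1/2" "10 * \<epsilon> \<le> \<eta>" using \<eta> by (auto simp: \<epsilon>_def)
  have flip: "spectral_norm (A - C) = spectral_norm (C - A)" for A C :: "real^'p^'p"
  proof -
    have "(\<lambda>v. (A - C) *v v) = (\<lambda>v. - ((C - A) *v v))" by (simp add: matrix_vector_mult_diff_rdistrib)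
    then show ?thesis by (simp add: spectral_norm_def onorm_neg)
  qed
  have "\<forall>\<^sub>F k in sequentially. spectral_norm (mat 1 - matrix_inv (msqrt (Es k)) ** F ** matrix_inv (msqrt (Es k))) < \<epsilon>"
    using lim1 \<epsilon> by (intro order_tendstoD) auto
  moreover have "\<forall>\<^sub>F k in sequentially. spectral_norm (mat 1 - matrix_inv (msqrt (E k)) ** Es k ** matrix_inv (msqrt (E k))) < \<epsilon>"
    using lim2 \<epsilon> by (intro order_tendstoD) auto
  moreover have "\<forall>\<^sub>F k in sequentially. spectral_norm (matrix_inv (msqrt (E k)) ** N k ** matrix_inv (msqrt (E k)) - mat 1) < \<epsilon>"
    using lim3 \<epsilon> by (intro order_tendstoD) auto
  ultimately show ?thesis using eventually_ge_at_top[of k0]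
  proof eventually_elim
    case (elim k)
    show ?case
    proof
      fix t
      let ?e = "t \<bullet> (E k *v t)" and ?s = "t \<bullet> (Es k *v t)" and ?f = "t \<bullet> (F *v t)" and ?n = "t \<bullet> (N k *v t)"
      have 1: "\<bar>?s - ?f\<bar> \<le> \<epsilon> * ?s" using elim pd by (intro spectral_norm_quadratic) auto
      have 2: "\<bar>?e - ?s\<bar> \<le> \<epsilon> * ?e" using elim pd by (intro spectral_norm_quadratic) auto
      have 3: "\<bar>?e - ?n\<bar> \<le> \<epsilon> * ?e" using elim pd by (intro spectral_norm_quadratic) (auto simp: flip[of "mat 1"])
      have nn: "0 \<le> ?e" "0 \<le> ?s" "0 \<le> ?f" using elim pd pos_def_matrixD(3) by blast+
      have "\<epsilon> * ?s \<le> 1/2 * ?s" "\<epsilon> * ?e \<le> 1/2 * ?e" using \<epsilon> nn by (intro mult_right_mono; simp)+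
      then have le: "?s \<le> 2 * ?f" "?e \<le> 4 * ?f" using 1 2 by linarith+
      have fnn: "0 \<le> \<epsilon> * ?f" using \<epsilon> nn by simp
      have "\<epsilon> * ?s \<le> \<epsilon> * (2 * ?f)" "\<epsilon> * ?e \<le> \<epsilon> * (4 * ?f)" using \<epsilon> le by (intro mult_left_mono; simp)+
      moreover have "10 * \<epsilon> * ?f \<le> \<eta> * ?f" using \<epsilon> nn by (intro mult_right_mono)
      ultimately show "\<bar>?e - ?f\<bar> \<le> \<eta> * ?f \<and> \<bar>?n - ?f\<bar> \<le> \<eta> * ?f"
        using 1 2 3 fnn by linarith
    qed
  qed
qed

lemma msqrt_dual:
  assumes "pos_def_matrix F"
  shows "r \<bullet> y = (msqrt F *v r) \<bullet> (matrix_inv (msqrt F) *v y)"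
  using matrix_inv_msqrt_sym[OF assms, of "msqrt F *v r" y]
  by (simp add: matrix_inv_vector(2)[OF msqrt_invertible[OF assms]])

text \<open>Polarisation of the symmetric form of \<open>E - F\<close>; the parallelogram law keeps
  the constant at \<open>\<eta>\<close> for vectors that are normalised in the metric of
  \<open>F\<close>.\<close>

lemma relative_bilinear_bound:
  fixes E F :: "real^'p^'p"
  assumes pd: "pos_def_matrix E" "pos_def_matrix F"
    and rel: "\<And>t. \<bar>t \<bullet> (E *v t) - t \<bullet> (F *v t)\<bar> \<le> \<eta> * (t \<bullet> (F *v t))"
  shows "\<bar>s \<bullet> ((E - F) *v t)\<bar> \<le> \<eta> * norm (msqrt F *v s) * norm (msqrt F *v t)"
proof -
  let ?R = "msqrt F"
  define Q where "Q t = t \<bullet> ((E - F) *v t)" for t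
  have Q: "\<bar>Q t\<bar> \<le> \<eta> * (norm (?R *v t))\<^sup>2" for t
    using rel[of t] norm_msqrt[OF pd(2), of t] by (simp add: Q_def matrix_vector_mult_diff_rdistrib inner_diff_right)
  have sym: "s \<bullet> ((E - F) *v t) = t \<bullet> ((E - F) *v s)" for s t
    using pos_def_matrixD(1)[OF pd(1), of s t] pos_def_matrixD(1)[OF pd(2), of s t]
    by (simp add: matrix_vector_mult_diff_rdistrib inner_diff_right inner_commute)
  have unit: "\<bar>s \<bullet> ((E - F) *v t)\<bar> \<le> \<eta>" if "norm (?R *v s) = 1" "norm (?R *v t) = 1" for s t
  proof -
    have "4 * (s \<bullet> ((E - F) *v t)) = Q (s + t) - Q (s - t)"
      using sym[of s t] by (simp add: Q_def matrix_vector_right_distrib matrix_vector_mult_diff_distrib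
          inner_add_left inner_diff_left inner_add_right inner_diff_right)
    also have "\<bar>\<dots>\<bar> \<le> \<eta> * (norm (?R *v (s + t)))\<^sup>2 + \<eta> * (norm (?R *v (s - t)))\<^sup>2"
      using Q[of "s + t"] Q[of "s - t"] by linarith
    also have "\<dots> = \<eta> * ((norm (?R *v s + ?R *v t))\<^sup>2 + (norm (?R *v s - ?R *v t))\<^sup>2)"
      by (simp add: matrix_vector_right_distrib matrix_vector_mult_diff_distrib distrib_left)
    also have "(norm (?R *v s + ?R *v t))\<^sup>2 + (norm (?R *v s - ?R *v t))\<^sup>2 = 4"
      using that by (simp add: power2_norm_eq_inner inner_add_left inner_diff_left inner_add_right
          inner_diff_right norm_eq_1)
    finally show ?thesis by simp
  qed
  show ?thesis
  proof (cases "s = 0 \<or> t = 0")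
    case False
    have "?R *v x \<noteq> 0" if "x \<noteq> 0" for x
      using matrix_inv_vector(2)[OF msqrt_invertible[OF pd(2)], of x] that by auto
    then have nz: "?R *v s \<noteq> 0" "?R *v t \<noteq> 0" using False by auto
    let ?a = "norm (?R *v s)" and ?b = "norm (?R *v t)"
    have "\<bar>(s /\<^sub>R ?a) \<bullet> ((E - F) *v (t /\<^sub>R ?b))\<bar> \<le> \<eta>"
      using nz by (intro unit) (simp_all add: matrix_vector_mult_scaleR)
    then have "\<bar>s \<bullet> ((E - F) *v t)\<bar> / (?a * ?b) \<le> \<eta>"
      by (simp add: matrix_vector_mult_scaleR abs_mult divide_inverse mult_ac)
    then show ?thesis using nz by (simp add: divide_le_eq mult_ac)
  qed auto
qed

text \<open>Here \<open>z\<close> is the scaled estimation error, \<open>b\<close> the sieve bias,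
  \<open>G\<close> and \<open>S\<close> the sieve and the full efficient score. The vector
  \<open>z\<close> splits into \<open>b\<close>, \<open>q\<close>, the inverse of \<open>F\<close>
  applied to \<open>S\<close>, and a remainder \<open>r\<close>; \<open>\<eta> \<le> 1/2\<close>
  bounds the metric of \<open>F\<close> by that of \<open>E\<close>.\<close>

lemma normalized_error_bound:
  fixes E F :: "real^'p^'p"
  assumes pd: "pos_def_matrix E" "pos_def_matrix F"
    and rel: "\<And>t. \<bar>t \<bullet> (E *v t) - t \<bullet> (F *v t)\<bar> \<le> \<eta> * (t \<bullet> (F *v t))" and \<eta>: "0 \<le> \<eta>" "\<eta> \<le> 1/2"
    and q: "E *v q = E *v (z - b) - G"
  shows "norm (msqrt F *v z - matrix_inv (msqrt F) *v S) \<le> 2 * sqrt (b \<bullet> (E *v b)) + 2 * sqrt (q \<bullet> (E *v q))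
    + 2 * norm (matrix_inv (msqrt F) *v (G - S)) + 2 * \<eta> * norm (matrix_inv (msqrt F) *v S)"
proof -
  let ?R = "msqrt F" and ?J = "matrix_inv (msqrt F)"
  have RI: "invertible ?R" by (rule msqrt_invertible[OF pd(2)])
  have low: "(norm (?R *v t))\<^sup>2 \<le> 2 * (t \<bullet> (E *v t))" for t
  proof -
    have "\<eta> * (t \<bullet> (F *v t)) \<le> 1/2 * (t \<bullet> (F *v t))"
      using \<eta> pos_def_matrixD(3)[OF pd(2)] by (intro mult_right_mono)
    then show ?thesis using rel[of t] norm_msqrt[OF pd(2), of t] by linarith
  qed
  have Rle: "norm (?R *v t) \<le> 2 * sqrt (t \<bullet> (E *v t))" for t
  proof -
    have "0 \<le> t \<bullet> (E *v t)" by (rule pos_def_matrixD(3)[OF pd(1)])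
    then have "norm (?R *v t) \<le> sqrt (4 * (t \<bullet> (E *v t)))" using low[of t] by (intro real_le_rsqrt) linarith
    then show ?thesis by (simp add: real_sqrt_mult)
  qed
  define r where "r = z - b - q - ?J *v (?J *v S)"
  have JJ: "F *v (?J *v (?J *v y)) = y" for y
    using msqrt_msqrt[OF pd(2), of "?J *v (?J *v y)"] by (simp add: matrix_inv_vector(1)[OF RI])
  \<comment> \<open>Adding and subtracting \<open>S\<close> separates the change of score from the
    change of information.\<close>
  have "E *v r = (G - S) - (E - F) *v (?J *v (?J *v S))"
    using q by (simp add: r_def matrix_vector_mult_diff_distrib matrix_vector_mult_diff_rdistrib JJ)
  then have "r \<bullet> (E *v r) = (?R *v r) \<bullet> (?J *v (G - S)) - r \<bullet> ((E - F) *v (?J *v (?J *v S)))"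
    using msqrt_dual[OF pd(2), of r "G - S"] by (simp add: inner_diff_right)
  also have "\<dots> \<le> norm (?R *v r) * norm (?J *v (G - S)) + \<eta> * norm (?R *v r) * norm (?J *v S)"
    using norm_cauchy_schwarz[of "?R *v r" "?J *v (G - S)"]
      relative_bilinear_bound[OF pd rel, of r "?J *v (?J *v S)"]
    by (simp add: matrix_inv_vector(1)[OF RI])
  finally have "norm (?R *v r) * norm (?R *v r) \<le> norm (?R *v r) * (2 * norm (?J *v (G - S)) + 2 * \<eta> * norm (?J *v S))"
    using low[of r] by (simp add: power2_eq_square algebra_simps)
  then have rle: "norm (?R *v r) \<le> 2 * norm (?J *v (G - S)) + 2 * \<eta> * norm (?J *v S)"
    using \<eta> by (cases "norm (?R *v r) = 0") (auto simp: mult_le_cancel_left)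
  have "?R *v z - ?J *v S = ?R *v b + ?R *v q + ?R *v r"
    by (simp add: r_def matrix_vector_mult_diff_distrib matrix_inv_vector(1)[OF RI])
  then have "norm (?R *v z - ?J *v S) = norm (?R *v b + ?R *v q + ?R *v r)" by simp
  then have "norm (?R *v z - ?J *v S) \<le> norm (?R *v b) + norm (?R *v q) + norm (?R *v r)"
    using norm_triangle_ineq[of "?R *v b + ?R *v q" "?R *v r"] norm_triangle_ineq[of "?R *v b" "?R *v q"] by linarith
  then show ?thesis using Rle[of b] Rle[of q] rle by linarith
qed

section \<open>Efficient scores of the full model and their sieve approximations\<close>

lemma integrable_mult_square:
  fixes f g :: "'y \<Rightarrow> real"
  assumes [measurable]: "f \<in> borel_measurable P" "g \<in> borel_measurable P"
    and "integrable P (\<lambda>y. (f y)\<^sup>2)" "integrable P (\<lambda>y. (g y)\<^sup>2)"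
  shows "integrable P (\<lambda>y. f y * g y)"
proof (rule Bochner_Integration.integrable_bound)
  show "integrable P (\<lambda>y. (f y)\<^sup>2 + (g y)\<^sup>2)" using assms by simp
  have "\<bar>a * b\<bar> \<le> a\<^sup>2 + b\<^sup>2" for a b :: real
  proof -
    have "0 \<le> (\<bar>a\<bar> - \<bar>b\<bar>)\<^sup>2" by simp
    then have "2 * \<bar>a * b\<bar> \<le> a\<^sup>2 + b\<^sup>2" by (simp add: power2_diff abs_mult)
    moreover have "0 \<le> \<bar>a * b\<bar>" by simp
    ultimately show ?thesis by linarith
  qed
  then show "AE y in P. norm (f y * g y) \<le> norm ((f y)\<^sup>2 + (g y)\<^sup>2)" by simp
qed measurable

text \<open>The covariance operator is a definite description; the vector assembled coordinatewise
  from mixed second moments satisfies it, and the zero mean removes the centring.\<close>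

lemma covariance_matrix_quadratic:
  fixes X :: "'y \<Rightarrow> real^'p"
  assumes int: "\<And>t. integrable P (\<lambda>y. X y \<bullet> t)" "\<And>t. integrable P (\<lambda>y. (X y \<bullet> t)\<^sup>2)"
    and mean: "\<And>t. (\<integral>y. X y \<bullet> t \<partial>P) = 0"
  shows "t \<bullet> (matrix (cov_op P X) *v t) = (\<integral>y. (X y \<bullet> t)\<^sup>2 \<partial>P)"
proof -
  have meas: "(\<lambda>y. X y \<bullet> t) \<in> borel_measurable P" for t using int(1)[of t] by simp
  have prod: "integrable P (\<lambda>y. (X y \<bullet> s) * (X y \<bullet> t))" for s t
    by (intro integrable_mult_square meas int)
  have cov: "covar P (\<lambda>y. X y \<bullet> s) (\<lambda>y. X y \<bullet> t) = (\<integral>y. (X y \<bullet> s) * (X y \<bullet> t) \<partial>P)" for s t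
    by (simp add: covar_def mean)
  define C where "C u = (\<chi> c. \<integral>y. (X y \<bullet> u) * (X y \<bullet> axis c 1) \<partial>P)" for u
  have C: "C u \<bullet> z = (\<integral>y. (X y \<bullet> u) * (X y \<bullet> z) \<partial>P)" for u z
  proof -
    have "C u \<bullet> z = (\<Sum>c\<in>UNIV. \<integral>y. z $ c * ((X y \<bullet> u) * (X y \<bullet> axis c 1)) \<partial>P)"
      by (simp add: C_def inner_vec_def mult.commute)
    also have "\<dots> = (\<integral>y. (\<Sum>c\<in>UNIV. z $ c * ((X y \<bullet> u) * (X y \<bullet> axis c 1))) \<partial>P)"
      by (intro Bochner_Integration.integral_sum[symmetric] integrable_mult_right prod)
    also have "\<dots> = (\<integral>y. (X y \<bullet> u) * (X y \<bullet> z) \<partial>P)"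
      by (simp add: inner_vec_def[of _ z] inner_axis sum_distrib_left mult_ac)
    finally show ?thesis .
  qed
  have op: "cov_op P X u = C u" for u
    unfolding cov_op_def cov
  proof (rule the_equality)
    show "\<forall>z. C u \<bullet> z = (\<integral>y. (X y \<bullet> u) * (X y \<bullet> z) \<partial>P)" using C by blast
    fix v assume "\<forall>z. v \<bullet> z = (\<integral>y. (X y \<bullet> u) * (X y \<bullet> z) \<partial>P)"
    then show "v = C u" by (simp add: C[symmetric] vector_eq_rdot)
  qed
  have "linear C"
  proof (rule linearI)
    show "C (a + b) = C a + C b" for a b
      using prod by (simp add: C_def vec_eq_iff inner_add_right distrib_right)
    show "C (c *\<^sub>R a) = c *\<^sub>R C a" for c a by (simp add: C_def vec_eq_iff mult.assoc)
  qed
  moreover have "cov_op P X = C" using op by blast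
  ultimately have "matrix (cov_op P X) *v t = C t" by (simp add: matrix_works)
  then show ?thesis using C[of t t] by (simp add: inner_commute power2_eq_square)
qed

text \<open>\<open>T\<close> stands for the information of one observation at the truth. Through
  \<open>info\<close> its geometry becomes the mean-square geometry of scores, so that orthogonality
  of directions is orthogonality of scores.\<close>

locale full_model = smooth_iid M \<mu> Y P lik U
  for M :: "'w measure" and \<mu> :: "'y measure" and Y P
    and lik :: "'y \<Rightarrow> (real^'p) \<times> 'x::real_inner \<Rightarrow> real" and U +
  fixes us :: "(real^'p) \<times> 'x" and T :: "(real^'p) \<times> 'x \<Rightarrow> (real^'p) \<times> 'x"
  assumes us: "us \<in> U" and block: "eff_block UNIV T"
    and score_mean: "\<And>h. grad ell us \<bullet> h = 0"
    and score_sq: "\<And>h. integrable P (\<lambda>y. (grad (lik y) us \<bullet> h)\<^sup>2)"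
    and info: "\<And>h. h \<bullet> T h = (\<integral>y. (grad (lik y) us \<bullet> h)\<^sup>2 \<partial>P)"
begin

sublocale full: eff_block UNIV T by (rule block)

abbreviation "F \<equiv> full.E"

definition "xi n w = (1 / sqrt (real n)) *\<^sub>R (matrix_inv (msqrt F) *v eff_score UNIV T (grad (L n w) us))"

lemma score_measurable: "(\<lambda>y. grad (lik y) us \<bullet> h) \<in> borel_measurable P"
  using integrable_score[OF us] by simp

lemma score_mean': "(\<integral>y. grad (lik y) us \<bullet> h \<partial>P) = 0"
  using grad_ell_inner[OF us] score_mean by simp

lemma xi_inner:
  assumes w: "w \<in> space M"
  shows "t \<bullet> xi n w
    = (\<Sum>i<n. grad (lik (Y i w)) us \<bullet> full.lfd (matrix_inv (msqrt F) *v t)) / sqrt (real n)"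
  using matrix_inv_msqrt_sym[OF full.pos_def_E, of t] full.eff_score_inner
  by (simp add: xi_def grad_L[OF w us] inner_sum_left inner_commute[of "full.lfd _"] divide_inverse mult.commute)

text \<open>The form of \<open>T\<close> at \<open>lfd s\<close> is
  \<open>s \<bullet> (F *v s)\<close>; for \<open>s\<close> the inverse root of \<open>F\<close>
  applied to \<open>t\<close> this is \<open>norm t\<close> squared, the variance of a standard
  Gaussian in direction \<open>t\<close>.\<close>

lemma lfd_second_moment:
  "(\<integral>y. (grad (lik y) us \<bullet> full.lfd (matrix_inv (msqrt F) *v t))\<^sup>2 \<partial>P) = (norm t)\<^sup>2"
  unfolding info[symmetric] full.inner_lfd norm_msqrt[OF full.pos_def_E, symmetric]
  by (simp add: matrix_inv_vector(1)[OF msqrt_invertible[OF full.pos_def_E]])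

lemma xi_measurable: "xi n \<in> borel_measurable M"
proof (rule borel_measurable_euclidean_space[THEN iffD2], intro ballI)
  fix b :: "real^'p"
  have "(\<lambda>w. (\<Sum>i<n. grad (lik (Y i w)) us \<bullet> full.lfd (matrix_inv (msqrt F) *v b)) / sqrt (real n)) \<in> borel_measurable M"
    using indep_Y[OF score_measurable] by (intro borel_measurable_divide borel_measurable_sum) (auto simp: indep_vars_def2)
  then show "(\<lambda>w. xi n w \<bullet> b) \<in> borel_measurable M"
    by (rule measurable_cong[THEN iffD2, rotated]) (simp add: inner_commute[of "xi n _"] xi_inner)
qed

lemma xi_second_moment:
  shows "integrable M (\<lambda>w. (xi n w $ c)\<^sup>2)" "1 \<le> n \<Longrightarrow> (\<integral>w. (xi n w $ c)\<^sup>2 \<partial>M) = 1"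
proof -
  let ?h = "full.lfd (matrix_inv (msqrt F) *v axis c 1)"
  have eq: "(xi n w $ c)\<^sup>2 = (\<Sum>i<n. grad (lik (Y i w)) us \<bullet> ?h)\<^sup>2 / real n" if "w \<in> space M" for w
    using xi_inner[OF that, of "axis c 1" n] by (simp add: inner_axis' power_divide)
  note m = sum_Y_second_moment[OF score_measurable[of ?h] score_sq[of ?h] score_mean'[of ?h], of n]
  show "integrable M (\<lambda>w. (xi n w $ c)\<^sup>2)"
    using m(1) by (subst Bochner_Integration.integrable_cong[OF refl eq]) auto
  show "(\<integral>w. (xi n w $ c)\<^sup>2 \<partial>M) = 1" if "1 \<le> n"
    using m(2) that lfd_second_moment[of "axis c 1"]
    by (subst Bochner_Integration.integral_cong[OF refl eq]) auto
qed

lemma xi_tail: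
  assumes "1 \<le> n" "0 < K"
  shows "measure M {w \<in> space M. norm (xi n w) \<ge> K} \<le> real CARD('p) / K\<^sup>2"
  using markov_norm[OF xi_measurable xi_second_moment(1) assms(2), of n] xi_second_moment(2)[OF assms(1)] by simp

lemma xi_char: "(\<lambda>n. \<integral>w. iexp (t \<bullet> xi n w) \<partial>M) \<longlonglongrightarrow> exp (- (norm t)\<^sup>2 / 2)"
proof (cases "t = 0")
  case False
  let ?f = "\<lambda>y. grad (lik y) us \<bullet> full.lfd (matrix_inv (msqrt F) *v t)"
  have f: "?f \<in> borel_measurable P" by (rule score_measurable)
  have "(\<lambda>n. \<integral>w. iexp ((\<Sum>i<n. ?f (Y i w)) / sqrt n) \<partial>M) \<longlonglongrightarrow> exp (- (norm t)\<^sup>2 / 2)"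
  proof (rule clt_char)
    show "indep_vars (\<lambda>_. borel) (\<lambda>i w. ?f (Y i w)) UNIV" by (rule indep_Y[OF f])
    show "distr M borel (\<lambda>w. ?f (Y i w)) = distr P borel ?f" for i
      using distr_distr[OF measurable_P[OF f] Y_measurable, of i] by (simp add: distr_Y o_def)
    show "expectation (\<lambda>w. ?f (Y i w)) = 0" for i using integral_Y[OF f, of i] score_mean' by simp
    show "integrable M (\<lambda>w. (?f (Y i w))\<^sup>2)" for i by (rule integrable_Y[OF score_sq])
    show "expectation (\<lambda>w. (?f (Y i w))\<^sup>2) = (norm t)\<^sup>2" for i
      using integral_Y[of "\<lambda>y. (?f y)\<^sup>2" i] f lfd_second_moment by simp
    show "0 < norm t" using False by simp
  qed
  moreover have "(\<integral>w. iexp (t \<bullet> xi n w) \<partial>M) = (\<integral>w. iexp ((\<Sum>i<n. ?f (Y i w)) / sqrt n) \<partial>M)" for n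
    by (intro Bochner_Integration.integral_cong refl) (simp add: xi_inner)
  ultimately show ?thesis by simp
qed (simp add: prob_space)

text \<open>
  Both least favourable directions have theta-component t, and the full one is T-orthogonal to
  all vectors with vanishing theta-component; so their distance in the metric of T is the excess
  of the quadratic form of T at the sieve direction over its minimum.
\<close>

lemma lfd_excess:
  assumes "fst a = t"
  shows "(a - full.lfd t) \<bullet> T (a - full.lfd t) = a \<bullet> T a - t \<bullet> (F *v t)"
proof -
  let ?b = "full.lfd t"
  have 1: "x \<bullet> T ?b = fst x \<bullet> (F *v t)" for x using full.inner_T_lfd[of x t] by simp
  have 2: "?b \<bullet> T a = t \<bullet> (F *v t)" using full.sym[of ?b a] 1[of a] assms by (simp add: inner_commute)
  show ?thesis using 1[of a] 1[of ?b] 2 assms full.fst_lfd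
    by (simp add: linear_diff[OF full.linear] inner_diff_left inner_diff_right)
qed

text \<open>The passage from the score at \<open>v\<close> along \<open>a\<close> to the full
  efficient score goes through the true score along \<open>a\<close>: the first leg is mean-square
  smoothness, the second an excess by \<open>lfd_excess\<close>. That excess contains the variance
  of the true score; Young's inequality with weight \<open>\<eta>\<close> replaces it by the
  variance at \<open>v\<close>.\<close>

lemma score_difference_bound:
  assumes v: "v \<in> U" and a: "fst a = t" and sq: "integrable P (\<lambda>y. (grad (lik y) v \<bullet> a)\<^sup>2)" and \<eta>: "0 < \<eta>"
  shows "integrable P (\<lambda>y. (grad (lik y) v \<bullet> a - grad (lik y) us \<bullet> full.lfd t)\<^sup>2)"
    "(\<integral>y. (grad (lik y) v \<bullet> a - grad (lik y) us \<bullet> full.lfd t)\<^sup>2 \<partial>P)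
      \<le> 2 * ((1 + \<eta>) * (\<integral>y. (grad (lik y) v \<bullet> a)\<^sup>2 \<partial>P) - t \<bullet> (F *v t))
        + (4 + 2 / \<eta>) * (\<integral>y. ((grad (lik y) v - grad (lik y) us) \<bullet> a)\<^sup>2 \<partial>P)"
proof -
  let ?X = "\<lambda>y. grad (lik y) v \<bullet> a" and ?Z = "\<lambda>y. grad (lik y) us \<bullet> a"
    and ?b = "\<lambda>y. grad (lik y) us \<bullet> full.lfd t" and ?D = "\<lambda>y. (grad (lik y) v - grad (lik y) us) \<bullet> a"
  have [measurable]: "?X \<in> borel_measurable P" "?Z \<in> borel_measurable P" "?b \<in> borel_measurable P"
    using integrable_score[OF v] score_measurable by auto
  have D: "?D y = ?X y - ?Z y" for y by (simp add: inner_diff_left)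
  have sqdiff: "integrable P (\<lambda>y. (f y - g y)\<^sup>2)"
    if [measurable]: "f \<in> borel_measurable P" "g \<in> borel_measurable P"
      and "integrable P (\<lambda>y. (f y)\<^sup>2)" "integrable P (\<lambda>y. (g y)\<^sup>2)" for f g :: "'y \<Rightarrow> real"
    using that integrable_mult_square[of f P g] by (simp add: power2_diff mult.assoc)
  have iD: "integrable P (\<lambda>y. (?D y)\<^sup>2)" unfolding D by (intro sqdiff sq score_sq) measurable
  show int: "integrable P (\<lambda>y. (?X y - ?b y)\<^sup>2)" by (intro sqdiff sq score_sq) measurable
  have iZ: "integrable P (\<lambda>y. (?Z y)\<^sup>2)" and iZb: "integrable P (\<lambda>y. (?Z y - ?b y)\<^sup>2)"
    by (intro sqdiff score_sq; measurable)+
  have young: "2 * \<bar>r * s\<bar> \<le> \<eta> * r\<^sup>2 + s\<^sup>2 / \<eta>" for r s :: real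
  proof -
    have "0 \<le> (\<eta> * \<bar>r\<bar> - \<bar>s\<bar>)\<^sup>2 / \<eta>" using \<eta> by simp
    also have "\<dots> = \<eta> * r\<^sup>2 + s\<^sup>2 / \<eta> - 2 * \<bar>r * s\<bar>"
      using \<eta> by (simp add: power2_diff power_mult_distrib abs_mult field_simps power2_eq_square)
    finally show ?thesis by simp
  qed
  have "(\<integral>y. (?Z y)\<^sup>2 \<partial>P) \<le> (\<integral>y. (1 + \<eta>) * (?X y)\<^sup>2 + (1 + 1 / \<eta>) * (?D y)\<^sup>2 \<partial>P)"
  proof (rule integral_mono[OF iZ])
    fix y
    have "(?Z y)\<^sup>2 = (?X y)\<^sup>2 - 2 * (?X y * ?D y) + (?D y)\<^sup>2" by (simp add: D power2_eq_square algebra_simps)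
    also have "\<dots> \<le> (?X y)\<^sup>2 + (\<eta> * (?X y)\<^sup>2 + (?D y)\<^sup>2 / \<eta>) + (?D y)\<^sup>2"
      using young[of "?X y" "?D y"] by linarith
    finally show "(?Z y)\<^sup>2 \<le> (1 + \<eta>) * (?X y)\<^sup>2 + (1 + 1 / \<eta>) * (?D y)\<^sup>2" by (simp add: algebra_simps)
  qed (use sq iD in auto)
  also have "\<dots> = (1 + \<eta>) * (\<integral>y. (?X y)\<^sup>2 \<partial>P) + (1 + 1 / \<eta>) * (\<integral>y. (?D y)\<^sup>2 \<partial>P)"
    using sq iD by simp
  finally have Zle: "(\<integral>y. (?Z y)\<^sup>2 \<partial>P) \<le> \<dots>" .
  have "(\<integral>y. (?Z y - ?b y)\<^sup>2 \<partial>P) = (a - full.lfd t) \<bullet> T (a - full.lfd t)"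
    unfolding info by (simp add: inner_diff_right)
  also have "\<dots> = (\<integral>y. (?Z y)\<^sup>2 \<partial>P) - t \<bullet> (F *v t)" by (simp only: lfd_excess[OF a] info[of a])
  finally have Zb: "(\<integral>y. (?Z y - ?b y)\<^sup>2 \<partial>P) = \<dots>" .
  have "(\<integral>y. (?X y - ?b y)\<^sup>2 \<partial>P) \<le> (\<integral>y. 2 * (?D y)\<^sup>2 + 2 * (?Z y - ?b y)\<^sup>2 \<partial>P)"
  proof (rule integral_mono[OF int])
    fix y
    have "(r + s)\<^sup>2 \<le> 2 * r\<^sup>2 + 2 * s\<^sup>2" for r s :: real
    proof -
      have "0 \<le> (r - s)\<^sup>2" by simp
      then show ?thesis by (simp add: power2_sum power2_diff)
    qed
    from this[of "?D y" "?Z y - ?b y"] show "(?X y - ?b y)\<^sup>2 \<le> 2 * (?D y)\<^sup>2 + 2 * (?Z y - ?b y)\<^sup>2"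
      by (simp add: D)
  qed (use iD iZb in auto)
  also have "\<dots> = 2 * (\<integral>y. (?D y)\<^sup>2 \<partial>P) + 2 * (\<integral>y. (?Z y - ?b y)\<^sup>2 \<partial>P)" using iD iZb by simp
  \<comment> \<open>\<open>4 + 2 / \<eta>\<close> is 2 from the first leg plus
    \<open>2 * (1 + 1 / \<eta>)\<close> from Young's inequality.\<close>
  finally show "(\<integral>y. (?X y - ?b y)\<^sup>2 \<partial>P) \<le> 2 * ((1 + \<eta>) * (\<integral>y. (?X y)\<^sup>2 \<partial>P) - t \<bullet> (F *v t))
        + (4 + 2 / \<eta>) * (\<integral>y. (?D y)\<^sup>2 \<partial>P)"
    using Zle unfolding Zb by (simp add: algebra_simps) 
qed

end

text \<open>Information operators are those of one observation, with explicit factors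
  \<open>sqrt (real n)\<close> in the expansion. The sequences \<open>\<kappa>\<close>,
  \<open>\<alpha>\<close> and \<open>\<rho>\<close> bound the expansion error, the sieve bias and
  the probability of the exceptional event.\<close>

locale sieve_sequence = full_model M \<mu> Y P lik U us T
  for M :: "'w measure" and \<mu> :: "'y measure" and Y P
    and lik :: "'y \<Rightarrow> (real^'p) \<times> 'x::real_inner \<Rightarrow> real" and U us T +
  fixes v :: "nat \<Rightarrow> (real^'p) \<times> 'x" and W :: "nat \<Rightarrow> 'x set"
    and Tn :: "nat \<Rightarrow> (real^'p) \<times> 'x \<Rightarrow> (real^'p) \<times> 'x"
    and \<theta> :: "nat \<Rightarrow> 'w \<Rightarrow> real^'p" and \<kappa> \<alpha> \<rho> :: "nat \<Rightarrow> real" and n0 :: nat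
  assumes n0: "1 \<le> n0"
    and block_n: "\<And>n. n \<ge> n0 \<Longrightarrow> eff_block (W n) (Tn n)"
    and v: "\<And>n. n \<ge> n0 \<Longrightarrow> v n \<in> U"
    and mean_n: "\<And>n h. n \<ge> n0 \<Longrightarrow> h \<in> UNIV \<times> W n \<Longrightarrow> grad ell (v n) \<bullet> h = 0"
    and sq_n: "\<And>n h. n \<ge> n0 \<Longrightarrow> h \<in> UNIV \<times> W n \<Longrightarrow> integrable P (\<lambda>y. (grad (lik y) (v n) \<bullet> h)\<^sup>2)"
    and info_n: "\<And>\<eta>. 0 < \<eta> \<Longrightarrow> \<forall>\<^sub>F n in sequentially. \<forall>t.
        \<bar>t \<bullet> (eff_info (W n) (Tn n) *v t) - t \<bullet> (eff_info UNIV T *v t)\<bar> \<le> \<eta> * (t \<bullet> (eff_info UNIV T *v t))"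
    and cov_n: "\<And>\<eta>. 0 < \<eta> \<Longrightarrow> \<forall>\<^sub>F n in sequentially. \<forall>t.
        (\<integral>y. (grad (lik y) (v n) \<bullet> eff_block.lfd (W n) (Tn n) t)\<^sup>2 \<partial>P) \<le> (1 + \<eta>) * (t \<bullet> (eff_info UNIV T *v t))"
    and smooth_n: "\<And>t. (\<lambda>n. \<integral>y. ((grad (lik y) (v n) - grad (lik y) us) \<bullet> eff_block.lfd (W n) (Tn n) t)\<^sup>2 \<partial>P) \<longlonglongrightarrow> 0"
    and \<theta>: "\<And>n. n \<ge> n0 \<Longrightarrow> \<theta> n \<in> borel_measurable M"
    and expansion: "\<And>n. n \<ge> n0 \<Longrightarrow> \<exists>A\<in>sets M. measure M A \<le> \<rho> n \<and> (\<forall>w\<in>space M - A. \<exists>q.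
        eff_info (W n) (Tn n) *v q = eff_info (W n) (Tn n) *v (sqrt (real n) *\<^sub>R (\<theta> n w - fst (v n)))
          - (1 / sqrt (real n)) *\<^sub>R eff_score (W n) (Tn n) (grad (L n w) (v n)) \<and>
        sqrt (q \<bullet> (eff_info (W n) (Tn n) *v q)) \<le> \<kappa> n)"
    and bias: "\<And>n. n \<ge> n0 \<Longrightarrow>
        sqrt ((sqrt (real n) *\<^sub>R (fst (v n) - fst us)) \<bullet> (eff_info (W n) (Tn n) *v (sqrt (real n) *\<^sub>R (fst (v n) - fst us)))) \<le> \<alpha> n"
    and rates: "\<kappa> \<longlonglongrightarrow> 0" "\<alpha> \<longlonglongrightarrow> 0" "\<rho> \<longlonglongrightarrow> 0"
begin

abbreviation "lfd_n n t \<equiv> eff_block.lfd (W n) (Tn n) t"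

text \<open>The gap between the sieve and the full efficient score of one observation, tested
  against \<open>t\<close>.\<close>

definition "\<psi> n t y = grad (lik y) (v n) \<bullet> lfd_n n t - grad (lik y) us \<bullet> full.lfd t"

lemma \<psi>_square_integrable: "n \<ge> n0 \<Longrightarrow> integrable P (\<lambda>y. (\<psi> n t y)\<^sup>2)"
  unfolding \<psi>_def
  by (rule score_difference_bound(1)[of _ _ _ 1])
     (auto intro: v sq_n eff_block.fst_lfd[OF block_n] eff_block.lfd_in[OF block_n])

text \<open>The full information is the minimal variance, and \<open>cov_n\<close> gives the sieve
  variance the same limiting upper bound. So the excess is made small by the choice of
  \<open>\<eta>\<close>, and only then is the smoothness term, with its factor
  \<open>1 / \<eta>\<close>, sent to 0.\<close>

lemma \<psi>_tendsto: "(\<lambda>n. \<integral>y. (\<psi> n t y)\<^sup>2 \<partial>P) \<longlonglongrightarrow> 0"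
proof (rule LIMSEQ_I)
  fix r :: real assume r: "0 < r"
  define f where "f = t \<bullet> (F *v t)"
  have f0: "0 \<le> f" unfolding f_def by (rule pos_def_matrixD(3)[OF full.pos_def_E])
  \<comment> \<open>The excess costs \<open>2 * ((1 + \<eta>)\<^sup>2 - 1) * f\<close>, at most
    \<open>6 * \<eta> * f\<close>, which this keeps below \<open>r / 2\<close>; the added 1 covers
    \<open>f = 0\<close>.\<close>
  define \<eta> where "\<eta> = min 1 (r / (12 * (f + 1)))"
  have \<eta>: "0 < \<eta>" "\<eta> \<le> 1" using r f0 by (auto simp: \<eta>_def)
  have "6 * \<eta> * f \<le> 6 * (r / (12 * (f + 1))) * f" using f0 by (intro mult_right_mono) (auto simp: \<eta>_def)
  also have "\<dots> \<le> r / 2" using r f0 by (simp add: field_simps)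
  finally have \<eta>f: "6 * \<eta> * f \<le> r / 2" .
  let ?d = "\<lambda>n. \<integral>y. ((grad (lik y) (v n) - grad (lik y) us) \<bullet> lfd_n n t)\<^sup>2 \<partial>P"
  have "(\<lambda>n. (4 + 2 / \<eta>) * ?d n) \<longlonglongrightarrow> (4 + 2 / \<eta>) * 0" by (intro tendsto_intros smooth_n)
  then have "\<forall>\<^sub>F n in sequentially. (4 + 2 / \<eta>) * ?d n < r / 2" using r by (intro order_tendstoD) auto
  with cov_n[OF \<eta>(1)] eventually_ge_at_top[of n0]
  have "\<forall>\<^sub>F n in sequentially. norm ((\<integral>y. (\<psi> n t y)\<^sup>2 \<partial>P) - 0) < r"
  proof eventually_elim
    case (elim n)
    interpret b: eff_block "W n" "Tn n" by (rule block_n[OF elim(2)])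
    have "(\<integral>y. (\<psi> n t y)\<^sup>2 \<partial>P) \<le> 2 * ((1 + \<eta>) * (\<integral>y. (grad (lik y) (v n) \<bullet> b.lfd t)\<^sup>2 \<partial>P) - f) + (4 + 2 / \<eta>) * ?d n"
      unfolding \<psi>_def f_def
      by (rule score_difference_bound(2)[OF v[OF elim(2)] b.fst_lfd sq_n[OF elim(2) b.lfd_in] \<eta>(1)])
    also have "(1 + \<eta>) * (\<integral>y. (grad (lik y) (v n) \<bullet> b.lfd t)\<^sup>2 \<partial>P) \<le> (1 + \<eta>) * ((1 + \<eta>) * f)"
      using elim(1) \<eta> by (intro mult_left_mono) (auto simp: f_def)
    also have "\<dots> \<le> f + 3 * \<eta> * f"
    proof -
      have "\<eta> * (\<eta> * f) \<le> 1 * (\<eta> * f)" using \<eta> f0 by (intro mult_right_mono) auto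
      then show ?thesis by (simp add: algebra_simps)
    qed
    finally have "(\<integral>y. (\<psi> n t y)\<^sup>2 \<partial>P) < r" using elim(3) \<eta>f by (simp add: algebra_simps)
    then show ?case by simp
  qed
  then show "\<exists>no. \<forall>n\<ge>no. norm ((\<integral>y. (\<psi> n t y)\<^sup>2 \<partial>P) - 0) < r" by (simp add: eventually_sequentially)
qed

definition "rem n w = matrix_inv (msqrt F) *v ((1 / sqrt (real n)) *\<^sub>R eff_score (W n) (Tn n) (grad (L n w) (v n))
    - (1 / sqrt (real n)) *\<^sub>R eff_score UNIV T (grad (L n w) us))"

lemma rem_inner:
  assumes n: "n \<ge> n0" and w: "w \<in> space M"
  shows "t \<bullet> rem n w = (\<Sum>i<n. \<psi> n (matrix_inv (msqrt F) *v t) (Y i w)) / sqrt (real n)"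
proof -
  interpret b: eff_block "W n" "Tn n" by (rule block_n[OF n])
  show ?thesis
    using matrix_inv_msqrt_sym[OF full.pos_def_E, of t] full.eff_score_inner b.eff_score_inner
    by (simp add: rem_def grad_L[OF w us] grad_L[OF w v[OF n]] \<psi>_def inner_diff_right inner_sum_right
        inner_commute[of _ "full.lfd _"] inner_commute[of _ "b.lfd _"] sum_subtractf diff_divide_distrib)
qed

lemma \<psi>_measurable: "n \<ge> n0 \<Longrightarrow> \<psi> n t \<in> borel_measurable P"
  unfolding \<psi>_def[abs_def]
  using integrable_score[OF v] score_measurable by (intro borel_measurable_diff) auto

lemma \<psi>_mean: "n \<ge> n0 \<Longrightarrow> (\<integral>y. \<psi> n t y \<partial>P) = 0"
  unfolding \<psi>_def
  using integrable_score[OF v] integrable_score[OF us] score_mean' mean_n[OF _ eff_block.lfd_in[OF block_n]]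
    grad_ell_inner[OF v] by simp

lemma rem_measurable:
  assumes n: "n \<ge> n0"
  shows "rem n \<in> borel_measurable M"
proof (rule borel_measurable_euclidean_space[THEN iffD2], intro ballI)
  fix b :: "real^'p"
  have "(\<lambda>w. (\<Sum>i<n. \<psi> n (matrix_inv (msqrt F) *v b) (Y i w)) / sqrt (real n)) \<in> borel_measurable M"
    using indep_Y[OF \<psi>_measurable[OF n]] by (intro borel_measurable_divide borel_measurable_sum) (auto simp: indep_vars_def2)
  then show "(\<lambda>w. rem n w \<bullet> b) \<in> borel_measurable M"
    by (rule measurable_cong[THEN iffD2, rotated]) (simp add: inner_commute[of "rem n _"] rem_inner[OF n])
qed

text \<open>For each \<open>n\<close> the components of the remainder are normalised sums of centred
  i.i.d. terms whose law changes with \<open>n\<close>. Their second moments are those of single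
  terms, so Markov's inequality suffices.\<close>

lemma rem_tail: 
  assumes K: "0 < K"
  shows "(\<lambda>n. measure M {w \<in> space M. norm (rem n w) \<ge> K}) \<longlonglongrightarrow> 0"
proof (rule tendsto_sandwich[OF _ _ tendsto_const])
  let ?V = "\<lambda>n c. \<integral>y. (\<psi> n (matrix_inv (msqrt F) *v axis c 1) y)\<^sup>2 \<partial>P"
  show "\<forall>\<^sub>F n in sequentially. 0 \<le> measure M {w \<in> space M. norm (rem n w) \<ge> K}" by simp
  show "\<forall>\<^sub>F n in sequentially. measure M {w \<in> space M. norm (rem n w) \<ge> K} \<le> (\<Sum>c\<in>UNIV. ?V n c) / K\<^sup>2"
    using eventually_ge_at_top[of n0]
  proof eventually_elim
    case (elim n)
    have n: "0 < n" using elim n0 by simp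
    have eq: "(rem n w $ c)\<^sup>2 = (\<Sum>i<n. \<psi> n (matrix_inv (msqrt F) *v axis c 1) (Y i w))\<^sup>2 / real n"
      if "w \<in> space M" for w c
      using rem_inner[OF elim that, of "axis c 1"] by (simp add: inner_axis' power_divide)
    note m = sum_Y_second_moment[OF \<psi>_measurable[OF elim] \<psi>_square_integrable[OF elim] \<psi>_mean[OF elim]]
    have int: "integrable M (\<lambda>w. (rem n w $ c)\<^sup>2)" for c
      using m(1) by (subst Bochner_Integration.integrable_cong[OF refl eq]) auto
    have val: "(\<integral>w. (rem n w $ c)\<^sup>2 \<partial>M) = ?V n c" for c
      using m(2) n by (subst Bochner_Integration.integral_cong[OF refl eq]) auto
    show ?case using markov_norm[OF rem_measurable[OF elim] int K] by (simp add: val)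
  qed
  have "(\<lambda>n. (\<Sum>c\<in>UNIV. ?V n c) / K\<^sup>2) \<longlonglongrightarrow> (\<Sum>c\<in>(UNIV::'p set). 0) / K\<^sup>2"
    using K by (intro tendsto_intros \<psi>_tendsto) auto
  then show "(\<lambda>n. (\<Sum>c\<in>UNIV. ?V n c) / K\<^sup>2) \<longlonglongrightarrow> 0" by simp
qed

lemma estimator_expansion:
  "conv_in_prob M (\<lambda>n w. msqrt F *v (sqrt (real n) *\<^sub>R (\<theta> n w - fst us)) - xi n w) 0"
  unfolding conv_in_prob_def
proof (intro allI impI LIMSEQ_I)
  fix \<epsilon> r :: real assume \<epsilon>: "0 < \<epsilon>" and r: "0 < r"
  define p where "p = real CARD('p)"
  have p: "0 < p" by (simp add: p_def)
  \<comment> \<open>Outside probability \<open>r / 4\<close> the normalised full score is below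
    \<open>K\<close>. It is fixed before \<open>\<eta>\<close>, because the information error is
    multiplied by the size of that score.\<close>
  define K where "K = sqrt (4 * p / r)"
  have K: "0 < K" "p / K\<^sup>2 \<le> r / 4" using r p by (auto simp: K_def)
  define \<eta> where "\<eta> = min (1/2) (\<epsilon> / (8 * K))"
  have \<eta>: "0 < \<eta>" "\<eta> \<le> 1/2" "2 * \<eta> * K \<le> \<epsilon> / 4"
    using \<epsilon> K by (auto simp: \<eta>_def min_def field_simps)
  let ?X = "\<lambda>n w. msqrt F *v (sqrt (real n) *\<^sub>R (\<theta> n w - fst us)) - xi n w"
  have "(\<lambda>n. 2 * \<alpha> n + 2 * \<kappa> n) \<longlonglongrightarrow> 2 * 0 + 2 * 0" by (intro tendsto_intros rates)
  then have "\<forall>\<^sub>F n in sequentially. 2 * \<alpha> n + 2 * \<kappa> n < \<epsilon> / 4" using \<epsilon> by (intro order_tendstoD) auto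
  moreover have "\<forall>\<^sub>F n in sequentially. \<rho> n < r / 4" using rates(3) r by (intro order_tendstoD) auto
  moreover have "\<forall>\<^sub>F n in sequentially. measure M {w \<in> space M. norm (rem n w) \<ge> \<epsilon> / 8} < r / 4"
    using rem_tail[of "\<epsilon> / 8"] \<epsilon> r by (intro order_tendstoD) auto
  ultimately have "\<forall>\<^sub>F n in sequentially. norm (measure M {w \<in> space M. dist (?X n w) 0 > \<epsilon>} - 0) < r"
    using info_n[OF \<eta>(1)] eventually_ge_at_top[of n0]
  proof eventually_elim
    case (elim n)
    let ?E = "eff_info (W n) (Tn n)"
    interpret b: eff_block "W n" "Tn n" by (rule block_n[OF elim(5)])
    note [measurable] = rem_measurable[OF elim(5)] xi_measurable
    have n: "1 \<le> n" using elim n0 by simp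
    obtain A where A: "A \<in> sets M" "measure M A \<le> \<rho> n" and q: "\<And>w. w \<in> space M - A \<Longrightarrow> \<exists>q.
        ?E *v q = ?E *v (sqrt (real n) *\<^sub>R (\<theta> n w - fst (v n)))
          - (1 / sqrt (real n)) *\<^sub>R eff_score (W n) (Tn n) (grad (L n w) (v n)) \<and> sqrt (q \<bullet> (?E *v q)) \<le> \<kappa> n"
      using expansion[OF elim(5)] by blast
    let ?B1 = "{w \<in> space M. norm (xi n w) \<ge> K}" and ?B2 = "{w \<in> space M. norm (rem n w) \<ge> \<epsilon> / 8}"
    have meas: "?B1 \<in> sets M" "?B2 \<in> sets M" by measurable
    have sub: "{w \<in> space M. dist (?X n w) 0 > \<epsilon>} \<subseteq> A \<union> (?B1 \<union> ?B2)"
    proof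
      fix w assume w: "w \<in> {w \<in> space M. dist (?X n w) 0 > \<epsilon>}"
      show "w \<in> A \<union> (?B1 \<union> ?B2)"
      proof (rule ccontr)
        assume nw: "w \<notin> A \<union> (?B1 \<union> ?B2)"
        then obtain q where q: "?E *v q = ?E *v (sqrt (real n) *\<^sub>R (\<theta> n w - fst (v n)))
          - (1 / sqrt (real n)) *\<^sub>R eff_score (W n) (Tn n) (grad (L n w) (v n))" "sqrt (q \<bullet> (?E *v q)) \<le> \<kappa> n"
          using q w by blast
        let ?z = "sqrt (real n) *\<^sub>R (\<theta> n w - fst us)" and ?b = "sqrt (real n) *\<^sub>R (fst (v n) - fst us)"
          and ?S = "(1 / sqrt (real n)) *\<^sub>R eff_score UNIV T (grad (L n w) us)"
        have zb: "?z - ?b = sqrt (real n) *\<^sub>R (\<theta> n w - fst (v n))" by (simp add: scaleR_diff_right)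
        have xi: "matrix_inv (msqrt F) *v ?S = xi n w" by (simp add: xi_def matrix_vector_mult_scaleR)
        have "norm (?X n w) \<le> 2 * sqrt (?b \<bullet> (?E *v ?b)) + 2 * sqrt (q \<bullet> (?E *v q))
            + 2 * norm (rem n w) + 2 * \<eta> * norm (xi n w)"
          using normalized_error_bound[OF b.pos_def_E full.pos_def_E, of \<eta> q ?z ?b _ ?S] elim(4) \<eta> q(1)
          unfolding zb[symmetric] xi rem_def by simp
        also have "\<dots> \<le> 2 * \<alpha> n + 2 * \<kappa> n + 2 * (\<epsilon> / 8) + 2 * \<eta> * K"
          using bias[OF elim(5)] q(2) nw w \<eta>(1) by (intro add_mono mult_left_mono) auto
        also have "\<dots> < \<epsilon>" using elim(1) \<eta>(3) \<epsilon> by linarith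
        finally show False using w by simp
      qed
    qed
    have "measure M {w \<in> space M. dist (?X n w) 0 > \<epsilon>} \<le> measure M (A \<union> (?B1 \<union> ?B2))"
      using A meas by (intro finite_measure_mono[OF sub]) auto
    also have "\<dots> \<le> measure M A + (measure M ?B1 + measure M ?B2)"
      using A meas by (intro order_trans[OF measure_Un_le] add_left_mono measure_Un_le) auto
    also have "\<dots> < r" using A(2) elim(2,3) xi_tail[OF n K(1)] K(2)[unfolded p_def] r by linarith
    finally show ?case by simp
  qed
  then show "\<exists>no. \<forall>n\<ge>no. norm (measure M {w \<in> space M. dist (?X n w) 0 > \<epsilon>} - 0) < r"
    by (simp add: eventually_sequentially)
qed

lemma estimator_normal:
  "conv_in_distr (\<lambda>n. distr M borel (\<lambda>w. msqrt F *v (sqrt (real n) *\<^sub>R (\<theta> n w - fst us)))) std_gaussian"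
proof (rule conv_in_distr_std_gaussianI[OF _ _ estimator_expansion xi_char xi_tail])
  show "(\<lambda>w. msqrt F *v (sqrt (real n) *\<^sub>R (\<theta> n w - fst us))) \<in> borel_measurable M" if "n \<ge> n0" for n
  proof -
    have "continuous_on UNIV (\<lambda>x. msqrt F *v (sqrt (real n) *\<^sub>R (x - fst us)))"
      by (intro bounded_linear.continuous_on[OF matrix_vector_mul_bounded_linear] continuous_intros)
    from measurable_compose[OF \<theta>[OF that] borel_measurable_continuous_onI[OF this]] show ?thesis .
  qed
qed (use n0 xi_measurable in auto)

end

section \<open>Reduction of the theorem to one observation\<close>

lemma conv_in_prob_cong:
  assumes "\<And>n w. 1 \<le> n \<Longrightarrow> w \<in> space M \<Longrightarrow> X n w = X' n w" "conv_in_prob M X' c"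
  shows "conv_in_prob M X c"
  unfolding conv_in_prob_def
proof (intro allI impI)
  fix \<epsilon> :: real assume "0 < \<epsilon>"
  then have "(\<lambda>n. measure M {w \<in> space M. dist (X' n w) c > \<epsilon>}) \<longlonglongrightarrow> 0"
    using assms(2) by (simp add: conv_in_prob_def)
  moreover have "\<forall>\<^sub>F n in sequentially.
      measure M {w \<in> space M. dist (X' n w) c > \<epsilon>} = measure M {w \<in> space M. dist (X n w) c > \<epsilon>}"
    using eventually_ge_at_top[of 1] by eventually_elim (rule arg_cong[where f = "measure M"], use assms(1) in auto)
  ultimately show "(\<lambda>n. measure M {w \<in> space M. dist (X n w) c > \<epsilon>}) \<longlonglongrightarrow> 0"
    by (rule Lim_transform_eventually)
qed

lemma conv_in_distr_cong:
  assumes "\<And>n. 1 \<le> n \<Longrightarrow> Q n = Q' n" "conv_in_distr Q' R"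
  shows "conv_in_distr Q R"
  unfolding conv_in_distr_def
proof (intro allI impI)
  fix h :: "'a \<Rightarrow> real" assume "continuous_on UNIV h \<and> bounded (range h)"
  then have "(\<lambda>n. \<integral>x. h x \<partial>Q' n) \<longlonglongrightarrow> (\<integral>x. h x \<partial>R)" using assms(2) by (simp add: conv_in_distr_def)
  moreover have "\<forall>\<^sub>F n in sequentially. (\<integral>x. h x \<partial>Q' n) = (\<integral>x. h x \<partial>Q n)"
    using eventually_ge_at_top[of 1] by eventually_elim (simp add: assms(1))
  ultimately show "(\<lambda>n. \<integral>x. h x \<partial>Q n) \<longlonglongrightarrow> (\<integral>x. h x \<partial>R)"
    by (rule Lim_transform_eventually)
qed

theorem corollary2p8:
  fixes M :: "'w measure" and \<mu> :: "'y measure" and Y :: "nat \<Rightarrow> 'w \<Rightarrow> 'y"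
    and lik :: "'y \<Rightarrow> (real^'p) \<times> 'x::{real_inner,polish_space} \<Rightarrow> real"
    and e :: "nat \<Rightarrow> 'x"
    and \<Upsilon> U :: "((real^'p) \<times> 'x) set"
    and \<upsilon>s :: "(real^'p) \<times> 'x" and \<upsilon>m :: "nat \<Rightarrow> (real^'p) \<times> 'x"
    and m0 :: nat
    and \<delta> :: "nat \<Rightarrow> nat \<Rightarrow> real \<Rightarrow> real" and \<nu>0 g \<omega> r0 :: "nat \<Rightarrow> nat \<Rightarrow> real"
    and \<alpha> :: "nat \<Rightarrow> nat \<Rightarrow> real"
    and m :: "nat \<Rightarrow> nat" and x :: "nat \<Rightarrow> real"
    and \<upsilon>t \<upsilon>tc :: "nat \<Rightarrow> 'w \<Rightarrow> (real^'p) \<times> 'x"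
    and P :: "'y measure"
    and L :: "nat \<Rightarrow> 'w \<Rightarrow> (real^'p) \<times> 'x \<Rightarrow> real"
    and EL :: "nat \<Rightarrow> (real^'p) \<times> 'x \<Rightarrow> real"
    and X :: "nat \<Rightarrow> 'x set" and V \<Upsilon>m :: "nat \<Rightarrow> ((real^'p) \<times> 'x) set"
    and D2 :: "nat \<Rightarrow> (real^'p) \<times> 'x \<Rightarrow> (real^'p) \<times> 'x \<Rightarrow> (real^'p) \<times> 'x"
    and D2m :: "nat \<Rightarrow> nat \<Rightarrow> (real^'p) \<times> 'x \<Rightarrow> (real^'p) \<times> 'x \<Rightarrow> (real^'p) \<times> 'x"
    and Dm Dm_inv V2m Vm :: "nat \<Rightarrow> nat \<Rightarrow> (real^'p) \<times> 'x \<Rightarrow> (real^'p) \<times> 'x"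
    and gradz :: "nat \<Rightarrow> nat \<Rightarrow> 'w \<Rightarrow> (real^'p) \<times> 'x \<Rightarrow> (real^'p) \<times> 'x"
    and loc :: "nat \<Rightarrow> nat \<Rightarrow> real \<Rightarrow> ((real^'p) \<times> 'x) set"
    and Db :: "nat \<Rightarrow> nat \<Rightarrow> (real^'p) \<times> 'x \<Rightarrow> real^'p^'p"
    and D2b :: "nat \<Rightarrow> real^'p^'p" and F :: "real^'p^'p"
    and V2b :: "nat \<Rightarrow> nat \<Rightarrow> real^'p^'p"
    and \<xi> :: "nat \<Rightarrow> 'w \<Rightarrow> real^'p"
  defines "P \<equiv> model \<mu> lik \<upsilon>s"
    and "L \<equiv> \<lambda>n w u. \<Sum>i<n. lik (Y i w) u"
    and "EL \<equiv> \<lambda>n u. \<integral>w. L n w u \<partial>M"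
    and "X \<equiv> sieve_space e"
    and "V \<equiv> \<lambda>k. UNIV \<times> X k"
    and "\<Upsilon>m \<equiv> \<lambda>k. \<Upsilon> \<inter> V k"
    and "D2 \<equiv> \<lambda>n u h. - hess (EL n) u h"
    and "D2m \<equiv> \<lambda>n k u h. sieve_proj e k (D2 n u h)"
    and "Dm \<equiv> \<lambda>n k. sqrt_on (V k) (D2m n k (\<upsilon>m k))"
    and "Dm_inv \<equiv> \<lambda>n k. inv_into (V k) (Dm n k)"
    and "V2m \<equiv> \<lambda>n k. cov_op M (\<lambda>w. sieve_proj e k (grad (L n w) (\<upsilon>m k)))"
    and "Vm \<equiv> \<lambda>n k. sqrt_on (V k) (V2m n k)"
    and "gradz \<equiv> \<lambda>n k w u. sieve_proj e k (grad (\<lambda>v. L n w v - EL n v) u)"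
    and "loc \<equiv> \<lambda>n k r. {u \<in> \<Upsilon>m k. norm (Dm n k (u - \<upsilon>m k)) \<le> r}"
    and "Db \<equiv> \<lambda>n k u. msqrt (eff_info (X k) (D2m n k u))"
    and "D2b \<equiv> \<lambda>n. eff_info UNIV (D2 n \<upsilon>s)"
    and "F \<equiv> eff_info UNIV (cov_op P (\<lambda>y. grad (lik y) \<upsilon>s))"
    and "V2b \<equiv> \<lambda>n k. matrix (cov_op P (\<lambda>y.
               eff_score (X k) (D2m n k (\<upsilon>m k)) (sieve_proj e k (grad (lik y) (\<upsilon>m k)))))"
    and "\<xi> \<equiv> \<lambda>n w. matrix_inv (msqrt (D2b n)) *v eff_score UNIV (D2 n \<upsilon>s) (grad (L n w) \<upsilon>s)"
  assumes
    \<comment> \<open>Hilbert space, i.i.d. data and correctly specified smooth model\<close>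
        basis: "orthonormal_basis e"
    and prob: "prob_space M"
    and indep: "prob_space.indep_vars M (\<lambda>_. \<mu>) Y UNIV"
    and distr: "\<And>i. distr M \<mu> (Y i) = P"
    and model: "\<And>u. u \<in> \<Upsilon> \<Longrightarrow> prob_space (model \<mu> lik u)"
    and true_par: "\<upsilon>s \<in> \<Upsilon>"
    and smooth: "smooth_loglik P lik U" "\<Upsilon> \<subseteq> U"
    and moments: "\<And>h. integrable P (\<lambda>y. (grad (lik y) \<upsilon>s \<bullet> h)\<^sup>2)"
        "\<And>k h. k \<ge> m0 \<Longrightarrow> h \<in> V k \<Longrightarrow> integrable P (\<lambda>y. (grad (lik y) (\<upsilon>m k) \<bullet> h)\<^sup>2)"
    and information_identity:
        "\<And>h h'. h \<bullet> D2 1 \<upsilon>s h' =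
           covar P (\<lambda>y. grad (lik y) \<upsilon>s \<bullet> h) (\<lambda>y. grad (lik y) \<upsilon>s \<bullet> h')"
    and full_info: "pos_def_on UNIV (D2 1 \<upsilon>s)" "\<And>t. (t, 0) \<in> range (D2 1 \<upsilon>s)"
    \<comment> \<open>mean-square smoothness of the sieve score between the sieve target and the true parameter\<close>
    and smooth_score: "(\<lambda>k. \<integral>y. (norm (eff_score (X k) (D2m 1 k (\<upsilon>m k))
           (sieve_proj e k (grad (lik y) (\<upsilon>m k) - grad (lik y) \<upsilon>s))))\<^sup>2 \<partial>P) \<longlonglongrightarrow> 0"
    \<comment> \<open>targets\<close>
    and target: "\<And>n. n \<ge> 1 \<Longrightarrow> is_arg_max (EL n) (\<lambda>u. integrable M (\<lambda>w. L n w u)) \<upsilon>s"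
    and sieve_target: "\<And>n k. n \<ge> 1 \<Longrightarrow> k \<ge> m0 \<Longrightarrow> is_arg_max (EL n) (\<lambda>u. u \<in> \<Upsilon>m k) (\<upsilon>m k)"
    \<comment> \<open>conditions (1) to (6)\<close>
    and constants: "\<And>n k. n \<ge> 1 \<Longrightarrow> k \<ge> m0 \<Longrightarrow>
           0 < \<nu>0 n k \<and> 0 < g n k \<and> 0 < \<omega> n k \<and> \<omega> n k \<le> 1/2 \<and> 0 < r0 n k"
    and pos_def: "\<And>n k. n \<ge> 1 \<Longrightarrow> k \<ge> m0 \<Longrightarrow>
           pos_def_on (V k) (D2m n k (\<upsilon>m k)) \<and> pos_def_on (V k) (V2m n k)"
    and c1: "\<And>n k r u. n \<ge> 1 \<Longrightarrow> k \<ge> m0 \<Longrightarrow> r \<le> r0 n k \<Longrightarrow> u \<in> loc n k r \<Longrightarrow>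
           onorm (\<lambda>h. Dm_inv n k (D2m n k u (Dm_inv n k (sieve_proj e k h))) - sieve_proj e k h)
             \<le> \<delta> n k r"
    and c2: "\<And>n k \<gamma>. n \<ge> 1 \<Longrightarrow> k \<ge> m0 \<Longrightarrow> \<gamma> \<in> V k \<Longrightarrow> \<gamma> \<noteq> 0 \<Longrightarrow>
           log_mgf_bound M (\<lambda>w. (gradz n k w (\<upsilon>m k) \<bullet> \<gamma>) / norm (Vm n k \<gamma>)) (\<nu>0 n k) (g n k)"
    and c3: "\<And>n k \<gamma> r u u'. n \<ge> 1 \<Longrightarrow> k \<ge> m0 \<Longrightarrow> 0 < r \<Longrightarrow> r < r0 n k \<Longrightarrow>
           u \<in> loc n k r \<Longrightarrow> u' \<in> loc n k r \<Longrightarrow> u \<noteq> u' \<Longrightarrow> \<gamma> \<in> V k \<Longrightarrow> norm \<gamma> = 1 \<Longrightarrow>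
           log_mgf_bound M (\<lambda>w. (\<gamma> \<bullet> Dm_inv n k (gradz n k w u - gradz n k w u')) /
               (\<omega> n k * norm (Dm n k (u - u')))) (\<nu>0 n k) (g n k)"
    and c4: "\<And>n. n \<ge> 1 \<Longrightarrow> antimono (\<alpha> n)" "\<And>n k. n \<ge> 1 \<Longrightarrow> 0 \<le> \<alpha> n k"
        "\<And>n k. n \<ge> 1 \<Longrightarrow> k \<ge> m0 \<Longrightarrow>
           norm (Db n k (\<upsilon>m k) *v (fst (\<upsilon>m k) - fst \<upsilon>s)) \<le> \<alpha> n k"
    and c5: "\<And>n. n \<ge> 1 \<Longrightarrow> (\<lambda>k. spectral_norm (mat 1 -
             matrix_inv (Db n k \<upsilon>s) ** D2b n ** matrix_inv (Db n k \<upsilon>s))) \<longlonglongrightarrow> 0"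
        "\<And>n. n \<ge> 1 \<Longrightarrow> (\<lambda>k. spectral_norm (mat 1 -
             matrix_inv (Db n k (\<upsilon>m k)) ** eff_info (X k) (D2m n k \<upsilon>s)
               ** matrix_inv (Db n k (\<upsilon>m k)))) \<longlonglongrightarrow> 0"
    and c6: "\<And>n. n \<ge> 1 \<Longrightarrow> (\<lambda>k. spectral_norm (
             matrix_inv (Db n k (\<upsilon>m k)) ** (real n *\<^sub>R V2b n k) ** matrix_inv (Db n k (\<upsilon>m k))
               - mat 1)) \<longlonglongrightarrow> 0"
    \<comment> \<open>sequences and estimators\<close>
    and m_lim: "filterlim m at_top sequentially"
    and x_lim: "filterlim x at_top sequentially"
    and small: "(\<lambda>n. spread (\<delta> n (m n)) (\<nu>0 n (m n)) (g n (m n)) (\<omega> n (m n))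
                     (real (CARD('p) + m n)) (r0 n (m n)) (x n) + \<alpha> n (m n)) \<longlonglongrightarrow> 0"
    and loc_interior: "\<And>n. n \<ge> 1 \<Longrightarrow> m n \<ge> m0 \<Longrightarrow>
           \<exists>W. open W \<and> loc n (m n) (r0 n (m n)) \<subseteq> W \<and> W \<inter> V (m n) \<subseteq> \<Upsilon>"
    and loc_convex: "\<And>n. n \<ge> 1 \<Longrightarrow> m n \<ge> m0 \<Longrightarrow> convex (loc n (m n) (r0 n (m n)))"
    and est: "\<And>n. n \<ge> 1 \<Longrightarrow> \<upsilon>t n \<in> borel_measurable M"
        "\<And>n. n \<ge> 1 \<Longrightarrow> AE w in M. is_arg_max (L n w) (\<lambda>u. u \<in> \<Upsilon>m (m n)) (\<upsilon>t n w)"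
    and est_constr: "\<And>n. n \<ge> 1 \<Longrightarrow> \<upsilon>tc n \<in> borel_measurable M"
        "\<And>n. n \<ge> 1 \<Longrightarrow> AE w in M. is_arg_max (L n w)
           (\<lambda>u. u \<in> \<Upsilon>m (m n) \<and> fst u = fst (\<upsilon>m (m n))) (\<upsilon>tc n w)"
    and concentration: "\<And>n. n \<ge> 1 \<Longrightarrow>
           measure M {w \<in> space M. \<upsilon>t n w \<in> loc n (m n) (r0 n (m n)) \<and>
                                   \<upsilon>tc n w \<in> loc n (m n) (r0 n (m n))} \<ge> 1 - exp (- x n)"
  shows "conv_in_prob M (\<lambda>n w. msqrt (real n *\<^sub>R F) *v (fst (\<upsilon>t n w) - fst \<upsilon>s) - \<xi> n w) 0 \<and>
         conv_in_distr (\<lambda>n. distr M borel (\<lambda>w. msqrt (real n *\<^sub>R F) *v (fst (\<upsilon>t n w) - fst \<upsilon>s)))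
           std_gaussian"
proof -
  interpret prob_space M by (rule prob)
  interpret I: smooth_iid M \<mu> Y P lik U
    by unfold_locales (use indep distr smooth in auto)
  have L_eq: "I.L = L" by (simp add: fun_eq_iff I.L_def L_def)
  have EL_eq: "I.EL = EL" by (simp add: fun_eq_iff I.EL_def EL_def L_eq)
  have D2_1: "D2 1 u = (\<lambda>h. - hess I.ell u h)" if "u \<in> U" for u
    using I.hess_EL_1[OF that] by (simp add: D2_def EL_eq)
  \<comment> \<open>The starting point of the reduction: expected Hessians are proportional to the
    sample size, so the operators below are rescaled to \<open>n = 1\<close>.\<close>
  have D2_n: "D2 n u = (\<lambda>h. real n *\<^sub>R D2 1 u h)" if "u \<in> U" for n u
    unfolding D2_1[OF that] using I.hess_EL[OF that, of n] by (simp add: D2_def EL_eq)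
  have linear_D2: "linear (D2 1 u)" if "u \<in> U" for u
    unfolding D2_1[OF that] by (rule linear_compose_neg[OF I.linear_hess[OF that]])
  have D2m_n: "D2m n k u = (\<lambda>h. real n *\<^sub>R D2m 1 k u h)" if "u \<in> U" for n k u
    by (simp add: D2m_def D2_n[OF that, of n] linear_scale[OF linear_sieve_proj])
  have us_U: "\<upsilon>s \<in> U" using true_par smooth(2) by blast
  have vm: "\<upsilon>m k \<in> \<Upsilon> \<inter> V k" "\<upsilon>m k \<in> U" if "k \<ge> m0" for k
    using sieve_target[of 1 k] that smooth(2) by (auto simp: is_arg_max_def \<Upsilon>m_def)

  have block_full: "eff_block UNIV (D2 1 \<upsilon>s)"
    by (rule eff_block.intro) (use full_info linear_D2[OF us_U] in \<open>simp_all add: UNIV_Times_UNIV\<close>)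
  \<comment> \<open>The truth maximises the expected likelihood among all points where it is
    integrable, which include the open set \<open>U\<close>; so the expected score vanishes in every
    direction, not only in those of a sieve.\<close>
  have mean_s: "grad I.ell \<upsilon>s \<bullet> h = 0" for h
  proof -
    have max: "EL 1 u \<le> EL 1 \<upsilon>s" if "u \<in> U" for u
    proof -
      have "is_arg_max (EL 1) (\<lambda>u. integrable M (\<lambda>w. L 1 w u)) \<upsilon>s" by (rule target) simp
      then show ?thesis using I.integrable_L[OF that, of 1] unfolding is_arg_max_linorder L_eq by blast
    qed
    show ?thesis
      using GDERIV_local_max_subspace[OF I.GDERIV_EL[OF us_U, of 1] subspace_UNIV _ _ I.open_U us_U, of h] max
      by (simp add: EL_eq)
  qed
  have covar_s: "covar P (\<lambda>y. grad (lik y) \<upsilon>s \<bullet> h) (\<lambda>y. grad (lik y) \<upsilon>s \<bullet> h')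
      = (\<integral>y. (grad (lik y) \<upsilon>s \<bullet> h) * (grad (lik y) \<upsilon>s \<bullet> h') \<partial>P)" for h h'
    using mean_s by (simp add: covar_def I.grad_ell_inner[OF us_U, symmetric])
  interpret FM: full_model M \<mu> Y P lik U \<upsilon>s "D2 1 \<upsilon>s"
  proof (intro full_model.intro full_model_axioms.intro I.smooth_iid_axioms us_U block_full mean_s moments(1))
    show "h \<bullet> D2 1 \<upsilon>s h = (\<integral>y. (grad (lik y) \<upsilon>s \<bullet> h)\<^sup>2 \<partial>P)" for h
      unfolding information_identity covar_s by (simp only: power2_eq_square)
  qed
  have sym_D2: "h \<bullet> D2 1 \<upsilon>s h' = D2 1 \<upsilon>s h \<bullet> h'" for h h'
    using full_info(1) unfolding pos_def_on_def by blast
  \<comment> \<open>By the information identity the negative expected Hessian satisfies the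
    description of the score covariance, so \<open>F\<close> may be computed from it.\<close>
  have "cov_op P (\<lambda>y. grad (lik y) \<upsilon>s) u = D2 1 \<upsilon>s u" for u
    unfolding cov_op_def information_identity[symmetric] sym_D2
  proof (rule the_equality)
    fix v assume "\<forall>z. v \<bullet> z = D2 1 \<upsilon>s u \<bullet> z"
    then show "v = D2 1 \<upsilon>s u" using vector_eq_rdot[of v "D2 1 \<upsilon>s u"] by blast
  qed simp
  then have "cov_op P (\<lambda>y. grad (lik y) \<upsilon>s) = D2 1 \<upsilon>s" by blast
  then have F_eq: "F = eff_info UNIV (D2 1 \<upsilon>s)" by (simp only: F_def)
  have D2b_eq: "D2b n = real n *\<^sub>R F" if "n \<ge> 1" for n
    using FM.full.eff_info_scaleR[of "real n"] that by (simp add: D2b_def F_eq D2_n[OF us_U, of n])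
  have pd_F: "pos_def_matrix F" unfolding F_eq by (rule FM.full.pos_def_E)

  define E where "E k = eff_info (X k) (D2m 1 k (\<upsilon>m k))" for k
  have block: "eff_block (X k) (D2m 1 k (\<upsilon>m k))" if k: "k \<ge> m0" for k
    using eff_block_sieve[OF basis linear_D2[OF vm(2)[OF k]], of k] pos_def[of 1 k] k
    by (simp add: D2m_def V_def X_def)
  have pd_E: "pos_def_matrix (E k)" if "k \<ge> m0" for k
    unfolding E_def by (rule eff_block.pos_def_E[OF block[OF that]])
  have E_n: "eff_info (X k) (D2m n k (\<upsilon>m k)) = real n *\<^sub>R E k" if "n \<ge> 1" "k \<ge> m0" for n k
    using eff_block.eff_info_scaleR[OF block[OF that(2)], of "real n"] that
    by (simp add: E_def D2m_n[OF vm(2)[OF that(2)], of n])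
  \<comment> \<open>The sieve information at the truth is a compression of the full one and inherits
    its positivity; it is the intermediate matrix in condition (5).\<close>
  have "pos_def_on (V k) (D2m 1 k \<upsilon>s)" for k
    unfolding pos_def_on_def
  proof (intro conjI ballI impI)
    fix a b assume ab: "a \<in> V k" "b \<in> V k"
    show "a \<bullet> D2m 1 k \<upsilon>s b = D2m 1 k \<upsilon>s a \<bullet> b"
      using ab sym_D2[of a b] by (simp add: D2m_def V_def X_def inner_sieve_proj[OF basis])
  next
    fix a assume a: "a \<in> V k" "a \<noteq> 0"
    have "0 < a \<bullet> D2 1 \<upsilon>s a" using full_info(1) a(2) unfolding pos_def_on_def by blast
    then show "0 < a \<bullet> D2m 1 k \<upsilon>s a"
      using a inner_sieve_proj(1)[OF basis, of a k] by (simp add: D2m_def V_def X_def)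
  qed
  then have pd_Es: "pos_def_matrix (eff_info (X k) (D2m 1 k \<upsilon>s))" for k
    using eff_block.pos_def_E[OF eff_block_sieve[OF basis linear_D2[OF us_U], of k]]
    by (simp add: D2m_def V_def X_def)

  \<comment> \<open>The limit is taken in the sieve dimension at sample size 1 and composed with
    \<open>m\<close> afterwards.\<close>
  have info: "\<forall>\<^sub>F k in sequentially. \<forall>t. \<bar>t \<bullet> (E k *v t) - t \<bullet> (F *v t)\<bar> \<le> \<eta> * (t \<bullet> (F *v t)) \<and>
      \<bar>t \<bullet> (V2b 1 k *v t) - t \<bullet> (F *v t)\<bar> \<le> \<eta> * (t \<bullet> (F *v t))" if \<eta>: "0 < \<eta>" for \<eta>
  proof (rule info_limit[where ?k0.0 = m0, OF pd_E pd_Es pd_F _ _ _ \<eta>])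
    show "(\<lambda>k. spectral_norm (mat 1 - matrix_inv (msqrt (eff_info (X k) (D2m 1 k \<upsilon>s))) ** F
        ** matrix_inv (msqrt (eff_info (X k) (D2m 1 k \<upsilon>s))))) \<longlonglongrightarrow> 0"
      using c5(1)[of 1] D2b_eq[of 1] by (simp add: Db_def)
    show "(\<lambda>k. spectral_norm (mat 1 - matrix_inv (msqrt (E k)) ** eff_info (X k) (D2m 1 k \<upsilon>s)
        ** matrix_inv (msqrt (E k)))) \<longlonglongrightarrow> 0"
      using c5(2)[of 1] by (simp add: Db_def E_def)
    show "(\<lambda>k. spectral_norm (matrix_inv (msqrt (E k)) ** V2b 1 k ** matrix_inv (msqrt (E k)) - mat 1)) \<longlonglongrightarrow> 0"
      using c6[of 1] by (simp add: Db_def E_def)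
  qed

  have ev_m: "\<forall>\<^sub>F n in sequentially. Q (m n)" if "\<forall>\<^sub>F k in sequentially. Q k" for Q
    using that m_lim by (rule eventually_compose_filterlim)
  have "\<forall>\<^sub>F n in sequentially. 1 \<le> n \<and> m0 \<le> m n \<and> 1 \<le> x n"
    using eventually_ge_at_top[of 1] ev_m[OF eventually_ge_at_top[of m0]]
      x_lim[unfolded filterlim_at_top, rule_format, of 1]
    by eventually_elim simp
  then obtain n1 where n1: "\<And>n. n \<ge> n1 \<Longrightarrow> 1 \<le> n \<and> m0 \<le> m n \<and> 1 \<le> x n"
    by (auto simp: eventually_sequentially)
  define n0 where "n0 = max 1 n1"
  have n0: "1 \<le> n" "m0 \<le> m n" "1 \<le> x n" if "n \<ge> n0" for n
    using n1[of n] that by (auto simp: n0_def)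

  have step: "sieve_step M \<mu> Y P lik U e \<Upsilon> n (m n) (\<upsilon>m (m n)) (\<delta> n (m n) (r0 n (m n))) (\<nu>0 n (m n)) (g n (m n))
      (\<omega> n (m n)) (r0 n (m n)) (D2m n (m n)) (V (m n)) (Dm n (m n)) (Dm_inv n (m n)) (loc n (m n))"
    if n: "n \<ge> n0" for n
  proof (intro sieve_step.intro sieve_step_axioms.intro)
    note n = n0[OF n]
    show "smooth_iid M \<mu> Y P lik U" by (rule I.smooth_iid_axioms)
    show "D2m n (m n) = (\<lambda>u h. sieve_proj e (m n) (- hess (I.EL n) u h))"
      by (simp add: D2m_def D2_def EL_eq)
    show "\<upsilon>m (m n) \<in> \<Upsilon> \<inter> V (m n)" using vm n by blast
    show "I.EL n u \<le> I.EL n (\<upsilon>m (m n))" if "u \<in> \<Upsilon> \<inter> V (m n)" for u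
      using sieve_target[OF n(1,2)] that unfolding is_arg_max_linorder EL_eq \<Upsilon>m_def by blast
    show "loc n (m n) = (\<lambda>r. {u \<in> \<Upsilon> \<inter> V (m n). norm (Dm n (m n) (u - \<upsilon>m (m n))) \<le> r})"
      by (simp add: loc_def \<Upsilon>m_def)
    show "onorm (\<lambda>h. Dm_inv n (m n) (D2m n (m n) u (Dm_inv n (m n) (sieve_proj e (m n) h))) - sieve_proj e (m n) h)
        \<le> \<delta> n (m n) (r0 n (m n))" if "u \<in> loc n (m n) (r0 n (m n))" for u
      using c1[OF n(1,2) order_refl that] .
    show "log_mgf_bound M (\<lambda>w. (\<gamma> \<bullet> Dm_inv n (m n)
          (sieve_proj e (m n) (grad (\<lambda>v. I.L n w v - I.EL n v) u) - sieve_proj e (m n) (grad (\<lambda>v. I.L n w v - I.EL n v) u')))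
        / (\<omega> n (m n) * norm (Dm n (m n) (u - u')))) (\<nu>0 n (m n)) (g n (m n))"
      if "0 < r" "r < r0 n (m n)" "u \<in> loc n (m n) r" "u' \<in> loc n (m n) r" "u \<noteq> u'" "\<gamma> \<in> V (m n)" "norm \<gamma> = 1"
      for r u u' \<gamma>
      using c3[OF n(1,2) that] by (simp add: gradz_def L_eq EL_eq)
    show "pos_def_on (V (m n)) (D2m n (m n) (\<upsilon>m (m n)))" using pos_def n by blast
    show "0 < \<nu>0 n (m n)" "0 < g n (m n)" "0 < \<omega> n (m n)" "0 < r0 n (m n)" using constants[OF n(1,2)] by auto
    show "\<exists>W. open W \<and> loc n (m n) (r0 n (m n)) \<subseteq> W \<and> W \<inter> V (m n) \<subseteq> \<Upsilon>" using loc_interior n by blast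
    show "convex (loc n (m n) (r0 n (m n)))" using loc_convex n by blast
    show "V (m n) = UNIV \<times> sieve_space e (m n)" by (simp add: V_def X_def)
    show "Dm n (m n) = sqrt_on (V (m n)) (D2m n (m n) (\<upsilon>m (m n)))" by (simp add: Dm_def)
    show "Dm_inv n (m n) = inv_into (V (m n)) (Dm n (m n))" by (simp add: Dm_inv_def)
  qed (rule basis smooth(2))+

  \<comment> \<open>The sieve target is maximal only within its sieve, so the expected score there
    vanishes on \<open>V (m n)\<close>.\<close>
  have mean_m: "grad I.ell (\<upsilon>m (m n)) \<bullet> h = 0" if n: "n \<ge> n0" and h: "h \<in> V (m n)" for n h
  proof -
    interpret S: sieve_step M \<mu> Y P lik U e \<Upsilon> n "m n" "\<upsilon>m (m n)" "\<delta> n (m n) (r0 n (m n))" "\<nu>0 n (m n)" "g n (m n)"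
      "\<omega> n (m n)" "r0 n (m n)" "D2m n (m n)" "V (m n)" "Dm n (m n)" "Dm_inv n (m n)" "loc n (m n)"
      by (rule step[OF n])
    have "real n * (grad I.ell (\<upsilon>m (m n)) \<bullet> h) = 0"
      using S.grad_EL_target[OF h] vm(2)[OF n0(2)[OF n]] by (simp add: I.grad_EL)
    then show ?thesis using n0(1)[OF n] by simp
  qed

  let ?T = "\<lambda>n. D2m 1 (m n) (\<upsilon>m (m n))"
  let ?lfd = "\<lambda>n. eff_block.lfd (X (m n)) (?T n)"
  have blk: "eff_block (X (m n)) (?T n)" if "n \<ge> n0" for n
    by (rule block[OF n0(2)[OF that]])
  have lfd_V: "?lfd n t \<in> V (m n)" if "n \<ge> n0" for n t
    using eff_block.lfd_in[OF blk[OF that]] by (simp add: V_def)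
  \<comment> \<open>Sieve directions lie in \<open>V (m n)\<close>, so projecting the score first
    does not change the pairing.\<close>
  have eff_proj: "t \<bullet> eff_score (X (m n)) (?T n) (sieve_proj e (m n) a) = a \<bullet> ?lfd n t" if "n \<ge> n0" for n t a
    using eff_block.eff_score_inner[OF blk[OF that]] inner_sieve_proj(1)[OF basis, of "?lfd n t" "m n"] lfd_V[OF that]
    by (simp add: V_def X_def inner_commute)

  have cov_m: "t \<bullet> (V2b 1 (m n) *v t) = (\<integral>y. (grad (lik y) (\<upsilon>m (m n)) \<bullet> ?lfd n t)\<^sup>2 \<partial>P)"
    if n: "n \<ge> n0" for n t
  proof -
    let ?X = "\<lambda>y. eff_score (X (m n)) (?T n) (sieve_proj e (m n) (grad (lik y) (\<upsilon>m (m n))))"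
    have U: "\<upsilon>m (m n) \<in> U" by (rule vm(2)[OF n0(2)[OF n]])
    have X: "?X y \<bullet> t = grad (lik y) (\<upsilon>m (m n)) \<bullet> ?lfd n t" for y t
      using eff_proj[OF n] by (simp add: inner_commute)
    show ?thesis
      unfolding V2b_def X[symmetric]
    proof (rule covariance_matrix_quadratic)
      fix t
      show "integrable P (\<lambda>y. ?X y \<bullet> t)" unfolding X by (rule I.integrable_score[OF U])
      show "integrable P (\<lambda>y. (?X y \<bullet> t)\<^sup>2)" unfolding X by (rule moments(2)[OF n0(2)[OF n] lfd_V[OF n]])
      show "(\<integral>y. ?X y \<bullet> t \<partial>P) = 0"
        unfolding X using mean_m[OF n lfd_V[OF n]] by (simp add: I.grad_ell_inner[OF U])
    qed
  qed

  define sp where "sp n = spread (\<delta> n (m n)) (\<nu>0 n (m n)) (g n (m n)) (\<omega> n (m n)) (real (CARD('p) + m n)) (r0 n (m n)) (x n)" for n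
  define \<rho> where "\<rho> n = (2 * real CARD('p) + 1) * exp (- x n)" for n

  have expansion: "0 \<le> sp n \<and> (\<exists>A\<in>sets M. measure M A \<le> \<rho> n \<and> (\<forall>w\<in>space M - A. \<exists>q.
        E (m n) *v q = E (m n) *v (sqrt (real n) *\<^sub>R (fst (\<upsilon>t n w) - fst (\<upsilon>m (m n))))
          - (1 / sqrt (real n)) *\<^sub>R eff_score (X (m n)) (?T n) (grad (I.L n w) (\<upsilon>m (m n))) \<and>
        sqrt (q \<bullet> (E (m n) *v q)) \<le> 8 * real CARD('p) * sp n))" if n: "n \<ge> n0" for n
  proof -
    interpret S: sieve_step M \<mu> Y P lik U e \<Upsilon> n "m n" "\<upsilon>m (m n)" "\<delta> n (m n) (r0 n (m n))" "\<nu>0 n (m n)" "g n (m n)"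
      "\<omega> n (m n)" "r0 n (m n)" "D2m n (m n)" "V (m n)" "Dm n (m n)" "Dm_inv n (m n)" "loc n (m n)"
      by (rule step[OF n])
    note nn = n0[OF n]
    have n_pos: "0 < real n" using nn(1) by simp
    let ?k = "m n"
    let ?z = "zq (\<nu>0 n ?k * g n ?k) (x n + 4 * (real CARD('p) + real ?k))"
    have z: "0 \<le> ?z" using S.const nn(3) by (intro zq_nonneg) (auto intro: add_pos_nonneg)
    \<comment> \<open>The 8 is the quotient of the 48 in \<open>stoch\<close> and the factor 6 in
      the spread.\<close>
    have stoch: "S.stoch (x n) = 8 * (6 * \<nu>0 n ?k * ?z * \<omega> n ?k * r0 n ?k)"
      by (simp add: S.stoch_def)
    have sp: "sp n = \<delta> n ?k (r0 n ?k) * r0 n ?k + 6 * \<nu>0 n ?k * ?z * \<omega> n ?k * r0 n ?k"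
      by (simp add: sp_def spread_def z_quantile_eq distrib_right)
    have parts: "0 \<le> \<delta> n ?k (r0 n ?k) * r0 n ?k" "0 \<le> 6 * \<nu>0 n ?k * ?z * \<omega> n ?k * r0 n ?k"
      using S.delta_nonneg S.const z by simp_all
    have le: "\<delta> n ?k (r0 n ?k) * r0 n ?k + real CARD('p) * S.stoch (x n) \<le> 8 * real CARD('p) * sp n"
    proof -
      have "1 * (\<delta> n ?k (r0 n ?k) * r0 n ?k) \<le> (8 * real CARD('p)) * (\<delta> n ?k (r0 n ?k) * r0 n ?k)"
      proof (rule mult_right_mono[OF _ parts(1)])
        have "1 \<le> real CARD('p)" by (simp add: Suc_leI)
        then show "1 \<le> 8 * real CARD('p)" by linarith
      qed
      then show ?thesis by (simp add: stoch sp distrib_left)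
    qed
    obtain A0 where A0: "A0 \<in> sets M" "measure M A0 \<le> 2 * real CARD('p) * exp (- x n)"
      and fisher: "\<And>w u q. w \<in> space M - A0 \<Longrightarrow> u \<in> loc n ?k (r0 n ?k) \<Longrightarrow>
        (\<And>v. v \<in> \<Upsilon> \<inter> V ?k \<Longrightarrow> I.L n w v \<le> I.L n w u) \<Longrightarrow>
        eff_info (sieve_space e ?k) (D2m n ?k (\<upsilon>m ?k)) *v q
          = eff_info (sieve_space e ?k) (D2m n ?k (\<upsilon>m ?k)) *v (fst u - fst (\<upsilon>m ?k))
            - eff_score (sieve_space e ?k) (D2m n ?k (\<upsilon>m ?k)) (grad (I.L n w) (\<upsilon>m ?k)) \<Longrightarrow>
        sqrt (q \<bullet> (eff_info (sieve_space e ?k) (D2m n ?k (\<upsilon>m ?k)) *v q))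
          \<le> \<delta> n ?k (r0 n ?k) * r0 n ?k + real CARD('p) * S.stoch (x n)"
      using S.fisher_expansion[OF nn(3)] by blast
    have E: "eff_info (sieve_space e ?k) (D2m n ?k (\<upsilon>m ?k)) = real n *\<^sub>R E ?k"
      using E_n[OF nn(1,2)] by (simp add: X_def)
    have score: "eff_score (sieve_space e ?k) (D2m n ?k (\<upsilon>m ?k)) a = eff_score (X ?k) (?T n) a" for a
      using eff_block.eff_score_scaleR[OF blk[OF n] n_pos]
      by (simp add: D2m_n[OF vm(2)[OF nn(2)], of n] X_def)
    define C where "C = {w \<in> space M. \<upsilon>t n w \<in> loc n ?k (r0 n ?k) \<and> \<upsilon>tc n w \<in> loc n ?k (r0 n ?k)}"
    have mC: "1 - exp (- x n) \<le> measure M C" using concentration[OF nn(1)] by (simp add: C_def)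
    \<comment> \<open>Measurability of the concentration event is inferred from its probability: a
      set outside the sigma-algebra has measure 0, while this one has positive measure.\<close>
    have "exp (- x n) < 1" using nn(3) by simp
    then have C: "C \<in> sets M" using mC measure_notin_sets[of C M] by (cases "C \<in> sets M") auto
    obtain N where N: "N \<in> null_sets M"
      "{w \<in> space M. \<not> is_arg_max (L n w) (\<lambda>u. u \<in> \<Upsilon>m ?k) (\<upsilon>t n w)} \<subseteq> N"
      using est(2)[OF nn(1)] by (auto simp: eventually_ae_filter)
    \<comment> \<open>Three exceptions: failure of chaining, failure of localisation, and the null
      set where the estimator is not a maximiser.\<close>
    let ?A = "A0 \<union> ((space M - C) \<union> N)"
    have meas: "?A \<in> sets M" using A0 C N by auto
    have "measure M ?A \<le> measure M A0 + (measure M (space M - C) + measure M N)"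
      using A0 C N by (intro order_trans[OF measure_Un_le] add_left_mono measure_Un_le) auto
    also have "\<dots> \<le> \<rho> n"
      using A0(2) mC prob_compl[OF C] measure_eq_0_null_sets[OF N(1)] by (simp add: \<rho>_def algebra_simps)
    finally have PA: "measure M ?A \<le> \<rho> n" .
    have "\<exists>q. E ?k *v q = E ?k *v (sqrt (real n) *\<^sub>R (fst (\<upsilon>t n w) - fst (\<upsilon>m ?k)))
          - (1 / sqrt (real n)) *\<^sub>R eff_score (X ?k) (?T n) (grad (I.L n w) (\<upsilon>m ?k)) \<and>
        sqrt (q \<bullet> (E ?k *v q)) \<le> 8 * real CARD('p) * sp n" if w: "w \<in> space M - ?A" for w
    proof -
      let ?d = "fst (\<upsilon>t n w) - fst (\<upsilon>m ?k)" and ?s = "eff_score (X ?k) (?T n) (grad (I.L n w) (\<upsilon>m ?k))"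
      \<comment> \<open>Solves the error equation of \<open>fisher\<close> after division by
        \<open>n\<close>; the claimed witness is \<open>sqrt (real n)\<close> times this
        vector.\<close>
      define q where "q = ?d - (1 / real n) *\<^sub>R (matrix_inv (E ?k) *v ?s)"
      have Eq: "E ?k *v q = E ?k *v ?d - (1 / real n) *\<^sub>R ?s"
        using matrix_inv_vector(1)[OF pos_def_matrix_invertible[OF pd_E[OF nn(2)]]]
        by (simp add: q_def matrix_vector_mult_diff_distrib matrix_vector_mult_scaleR)
      have loc: "\<upsilon>t n w \<in> loc n ?k (r0 n ?k)" using w by (auto simp: C_def)
      have "is_arg_max (L n w) (\<lambda>u. u \<in> \<Upsilon>m ?k) (\<upsilon>t n w)" using w N(2) by blast
      then have max: "I.L n w v \<le> I.L n w (\<upsilon>t n w)" if "v \<in> \<Upsilon> \<inter> V ?k" for v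
        using that unfolding is_arg_max_linorder L_eq \<Upsilon>m_def by blast
      have "sqrt (q \<bullet> ((real n *\<^sub>R E ?k) *v q)) \<le> \<delta> n ?k (r0 n ?k) * r0 n ?k + real CARD('p) * S.stoch (x n)"
        using fisher[OF _ loc max, of q] w n_pos
        by (simp add: E score scaleR_matrix_vector Eq scaleR_diff_right)
      then have fin: "sqrt ((sqrt (real n) *\<^sub>R q) \<bullet> (E ?k *v (sqrt (real n) *\<^sub>R q))) \<le> 8 * real CARD('p) * sp n"
        using le by (simp add: matrix_vector_mult_scaleR scaleR_matrix_vector mult.assoc[symmetric])
      have "sqrt (real n) / real n = 1 / sqrt (real n)"
        using n_pos by (simp add: real_div_sqrt field_simps)
      then have "E ?k *v (sqrt (real n) *\<^sub>R q) = E ?k *v (sqrt (real n) *\<^sub>R ?d) - (1 / sqrt (real n)) *\<^sub>R ?s"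
        by (simp add: matrix_vector_mult_scaleR Eq scaleR_diff_right[of _ "E ?k *v ?d"])
      with fin show ?thesis by blast
    qed
    then show ?thesis using meas PA parts sp by auto
  qed

  have bias: "sqrt ((sqrt (real n) *\<^sub>R (fst (\<upsilon>m (m n)) - fst \<upsilon>s)) \<bullet> (E (m n) *v (sqrt (real n) *\<^sub>R (fst (\<upsilon>m (m n)) - fst \<upsilon>s))))
      \<le> \<alpha> n (m n)" if n: "n \<ge> n0" for n
  proof -
    let ?d = "fst (\<upsilon>m (m n)) - fst \<upsilon>s"
    note nn = n0[OF n]
    have "pos_def_matrix (real n *\<^sub>R E (m n))" using pos_def_matrix_scaleR[OF pd_E[OF nn(2)]] nn(1) by simp
    from norm_msqrt[OF this, of ?d]
    have "(norm (Db n (m n) (\<upsilon>m (m n)) *v ?d))\<^sup>2 = (sqrt (real n) *\<^sub>R ?d) \<bullet> (E (m n) *v (sqrt (real n) *\<^sub>R ?d))"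
      using E_n[OF nn(1,2)]
      by (simp add: Db_def scaleR_matrix_vector matrix_vector_mult_scaleR mult.assoc[symmetric])
    then show ?thesis using c4(3)[OF nn(1,2)] by (metis norm_ge_zero real_sqrt_unique)
  qed

  \<comment> \<open>Both summands are eventually nonnegative, so convergence of their sum to 0
    forces that of each.\<close>
  have sp0: "sp \<longlonglongrightarrow> 0" and \<alpha>0: "(\<lambda>n. \<alpha> n (m n)) \<longlonglongrightarrow> 0"
  proof -
    have small': "(\<lambda>n. sp n + \<alpha> n (m n)) \<longlonglongrightarrow> 0" using small by (simp add: sp_def)
    have nonneg: "\<forall>\<^sub>F n in sequentially. 0 \<le> sp n \<and> 0 \<le> \<alpha> n (m n)"
      using eventually_ge_at_top[of n0] by eventually_elim (use expansion c4(2) n0 in blast)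
    show "sp \<longlonglongrightarrow> 0"
      by (rule tendsto_sandwich[OF _ _ tendsto_const small']; rule eventually_mono[OF nonneg]) auto
    show "(\<lambda>n. \<alpha> n (m n)) \<longlonglongrightarrow> 0"
      by (rule tendsto_sandwich[OF _ _ tendsto_const small']; rule eventually_mono[OF nonneg]) auto
  qed
  have "(\<lambda>n. 8 * real CARD('p) * sp n) \<longlonglongrightarrow> 8 * real CARD('p) * 0" by (intro tendsto_intros sp0)
  then have \<kappa>0: "(\<lambda>n. 8 * real CARD('p) * sp n) \<longlonglongrightarrow> 0" by simp
  have \<rho>0: "\<rho> \<longlonglongrightarrow> 0"
  proof -
    have "(\<lambda>n. exp (- x n)) \<longlonglongrightarrow> 0"
      by (rule filterlim_compose[OF exp_at_bot filterlim_compose[OF filterlim_uminus_at_bot_at_top x_lim]])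
    then have "(\<lambda>n. (2 * real CARD('p) + 1) * exp (- x n)) \<longlonglongrightarrow> (2 * real CARD('p) + 1) * 0" by (intro tendsto_intros)
    then show ?thesis by (simp add: \<rho>_def[abs_def])
  qed

  \<comment> \<open>By Cauchy-Schwarz the squared norm in the smoothness hypothesis controls every
    fixed direction \<open>t\<close>.\<close>
  have smooth_lim: "(\<lambda>n. \<integral>y. ((grad (lik y) (\<upsilon>m (m n)) - grad (lik y) \<upsilon>s) \<bullet> ?lfd n t)\<^sup>2 \<partial>P) \<longlonglongrightarrow> 0" for t
  proof (rule tendsto_sandwich[OF _ _ tendsto_const])
    let ?s = "\<lambda>n y. eff_score (X (m n)) (?T n) (sieve_proj e (m n) (grad (lik y) (\<upsilon>m (m n)) - grad (lik y) \<upsilon>s))"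
    show "\<forall>\<^sub>F n in sequentially. 0 \<le> (\<integral>y. ((grad (lik y) (\<upsilon>m (m n)) - grad (lik y) \<upsilon>s) \<bullet> ?lfd n t)\<^sup>2 \<partial>P)" by simp
    have "(\<lambda>n. \<integral>y. (norm (?s n y))\<^sup>2 \<partial>P) \<longlonglongrightarrow> 0"
      using filterlim_compose[OF smooth_score m_lim] by simp
    then have "(\<lambda>n. (norm t)\<^sup>2 * (\<integral>y. (norm (?s n y))\<^sup>2 \<partial>P)) \<longlonglongrightarrow> (norm t)\<^sup>2 * 0" by (intro tendsto_intros)
    then show "(\<lambda>n. (norm t)\<^sup>2 * (\<integral>y. (norm (?s n y))\<^sup>2 \<partial>P)) \<longlonglongrightarrow> 0" by simp
    show "\<forall>\<^sub>F n in sequentially. (\<integral>y. ((grad (lik y) (\<upsilon>m (m n)) - grad (lik y) \<upsilon>s) \<bullet> ?lfd n t)\<^sup>2 \<partial>P)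
        \<le> (norm t)\<^sup>2 * (\<integral>y. (norm (?s n y))\<^sup>2 \<partial>P)"
      using eventually_ge_at_top[of n0]
    proof eventually_elim
      case (elim n)
      have U: "\<upsilon>m (m n) \<in> U" by (rule vm(2)[OF n0(2)[OF elim]])
      have s: "t \<bullet> ?s n y = (grad (lik y) (\<upsilon>m (m n)) - grad (lik y) \<upsilon>s) \<bullet> ?lfd n t" for t y
        by (rule eff_proj[OF elim])
      \<comment> \<open>Integral comparison needs the squared norm to be integrable, as a
        non-integrable function would have integral 0; this follows coordinatewise from the second
        moments of the two scores.\<close>
      have int: "integrable P (\<lambda>y. (t \<bullet> ?s n y)\<^sup>2)" for t
      proof -
        have "integrable P (\<lambda>y. (grad (lik y) (\<upsilon>m (m n)) \<bullet> ?lfd n t) * (grad (lik y) \<upsilon>s \<bullet> ?lfd n t))"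
          using I.integrable_score[OF U] I.integrable_score[OF us_U] moments n0(2)[OF elim] lfd_V[OF elim]
          by (intro integrable_mult_square) auto
        then show ?thesis
          using moments(1) moments(2)[OF n0(2)[OF elim] lfd_V[OF elim]]
          unfolding s by (simp add: inner_diff_left power2_diff mult.assoc)
      qed
      have norm2: "(norm (?s n y))\<^sup>2 = (\<Sum>c\<in>UNIV. (axis c 1 \<bullet> ?s n y)\<^sup>2)" for y
        unfolding power2_norm_eq_inner inner_vec_def[of "?s n y"] by (simp add: inner_axis' power2_eq_square)
      have "integrable P (\<lambda>y. (norm (?s n y))\<^sup>2)" unfolding norm2 using int by (intro Bochner_Integration.integrable_sum)
      then have "(\<integral>y. (t \<bullet> ?s n y)\<^sup>2 \<partial>P) \<le> (\<integral>y. (norm t)\<^sup>2 * (norm (?s n y))\<^sup>2 \<partial>P)"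
        using int Cauchy_Schwarz_ineq2
        by (intro integral_mono integrable_mult_right)
           (auto simp flip: power_mult_distrib intro!: power2_le_iff_abs_le[THEN iffD2])
      then show ?case unfolding s by simp
    qed
  qed

  interpret Seq: sieve_sequence M \<mu> Y P lik U \<upsilon>s "D2 1 \<upsilon>s" "\<lambda>n. \<upsilon>m (m n)" "\<lambda>n. X (m n)" ?T
    "\<lambda>n w. fst (\<upsilon>t n w)" "\<lambda>n. 8 * real CARD('p) * sp n" "\<lambda>n. \<alpha> n (m n)" \<rho> n0
  proof (intro sieve_sequence.intro sieve_sequence_axioms.intro FM.full_model_axioms)
    show "1 \<le> n0" by (simp add: n0_def)
    show "eff_block (X (m n)) (?T n)" if "n \<ge> n0" for n by (rule blk[OF that])
    show "\<upsilon>m (m n) \<in> U" if "n \<ge> n0" for n by (rule vm(2)[OF n0(2)[OF that]])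
    show "grad I.ell (\<upsilon>m (m n)) \<bullet> h = 0" if "n \<ge> n0" "h \<in> UNIV \<times> X (m n)" for n h
      using mean_m[OF that(1)] that(2) by (simp add: V_def)
    show "integrable P (\<lambda>y. (grad (lik y) (\<upsilon>m (m n)) \<bullet> h)\<^sup>2)" if "n \<ge> n0" "h \<in> UNIV \<times> X (m n)" for n h
      using moments(2)[OF n0(2)[OF that(1)], of h] that(2) by (simp add: V_def)
    show "\<forall>\<^sub>F n in sequentially. \<forall>t. \<bar>t \<bullet> (eff_info (X (m n)) (?T n) *v t) - t \<bullet> (eff_info UNIV (D2 1 \<upsilon>s) *v t)\<bar>
        \<le> \<eta> * (t \<bullet> (eff_info UNIV (D2 1 \<upsilon>s) *v t))" if "0 < \<eta>" for \<eta>
      using ev_m[OF info[OF that]] unfolding E_def F_eq by eventually_elim blast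
    show "\<forall>\<^sub>F n in sequentially. \<forall>t. (\<integral>y. (grad (lik y) (\<upsilon>m (m n)) \<bullet> ?lfd n t)\<^sup>2 \<partial>P)
        \<le> (1 + \<eta>) * (t \<bullet> (eff_info UNIV (D2 1 \<upsilon>s) *v t))" if "0 < \<eta>" for \<eta>
      using ev_m[OF info[OF that]] eventually_ge_at_top[of n0]
    proof eventually_elim
      case (elim n)
      show ?case
      proof
        fix t
        have "\<bar>t \<bullet> (V2b 1 (m n) *v t) - t \<bullet> (F *v t)\<bar> \<le> \<eta> * (t \<bullet> (F *v t))" using elim(1) by blast
        then show "(\<integral>y. (grad (lik y) (\<upsilon>m (m n)) \<bullet> ?lfd n t)\<^sup>2 \<partial>P) \<le> (1 + \<eta>) * (t \<bullet> (eff_info UNIV (D2 1 \<upsilon>s) *v t))"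
          unfolding cov_m[OF elim(2)] F_eq[symmetric] by (simp add: distrib_right abs_le_iff)
      qed
    qed
    show "(\<lambda>w. fst (\<upsilon>t n w)) \<in> borel_measurable M" if "n \<ge> n0" for n
    proof -
      have "fst \<in> borel_measurable (borel :: ((real^'p) \<times> 'x) measure)"
        by (intro borel_measurable_continuous_onI continuous_intros)
      from measurable_compose[OF est(1)[OF n0(1)[OF that]] this] show ?thesis .
    qed
    show "\<exists>A\<in>sets M. measure M A \<le> \<rho> n \<and> (\<forall>w\<in>space M - A. \<exists>q.
        eff_info (X (m n)) (?T n) *v q = eff_info (X (m n)) (?T n) *v (sqrt (real n) *\<^sub>R (fst (\<upsilon>t n w) - fst (\<upsilon>m (m n))))
          - (1 / sqrt (real n)) *\<^sub>R eff_score (X (m n)) (?T n) (grad (I.L n w) (\<upsilon>m (m n))) \<and>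
        sqrt (q \<bullet> (eff_info (X (m n)) (?T n) *v q)) \<le> 8 * real CARD('p) * sp n)" if "n \<ge> n0" for n
      using expansion[OF that] by (simp add: E_def)
    show "sqrt ((sqrt (real n) *\<^sub>R (fst (\<upsilon>m (m n)) - fst \<upsilon>s)) \<bullet> (eff_info (X (m n)) (?T n) *v
        (sqrt (real n) *\<^sub>R (fst (\<upsilon>m (m n)) - fst \<upsilon>s)))) \<le> \<alpha> n (m n)" if "n \<ge> n0" for n
      using bias[OF that] by (simp add: E_def)
  qed (rule smooth_lim \<kappa>0 \<alpha>0 \<rho>0)+

  \<comment> \<open>Back to sample size \<open>n\<close>: roots scale by
    \<open>sqrt (real n)\<close>, inverse roots by its reciprocal, and the efficient score is
    unchanged.\<close>
  have root: "msqrt (real n *\<^sub>R F) *v d = msqrt F *v (sqrt (real n) *\<^sub>R d)" if "1 \<le> n" for n d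
    using msqrt_scaleR[OF pd_F, of "real n"] that by (simp add: scaleR_matrix_vector matrix_vector_mult_scaleR)
  have xi: "\<xi> n w = FM.xi n w" if "1 \<le> n" for n w
  proof -
    have "matrix_inv (msqrt (D2b n)) = (1 / sqrt (real n)) *\<^sub>R matrix_inv (msqrt F)"
      using msqrt_scaleR[OF pd_F, of "real n"] matrix_inv_scaleR[OF msqrt_invertible[OF pd_F], of "sqrt (real n)"] that
      by (simp add: D2b_eq)
    moreover have "eff_score UNIV (D2 n \<upsilon>s) a = eff_score UNIV (D2 1 \<upsilon>s) a" for a
      using FM.full.eff_score_scaleR[of "real n"] that by (simp add: D2_n[OF us_U, of n])
    ultimately show ?thesis unfolding \<xi>_def FM.xi_def L_eq F_eq by (simp add: scaleR_matrix_vector)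
  qed
  show ?thesis
  proof
    show "conv_in_prob M (\<lambda>n w. msqrt (real n *\<^sub>R F) *v (fst (\<upsilon>t n w) - fst \<upsilon>s) - \<xi> n w) 0"
      by (rule conv_in_prob_cong[OF _ Seq.estimator_expansion]) (unfold F_eq[symmetric], simp add: root xi)
    show "conv_in_distr (\<lambda>n. distr M borel (\<lambda>w. msqrt (real n *\<^sub>R F) *v (fst (\<upsilon>t n w) - fst \<upsilon>s))) std_gaussian"
      by (rule conv_in_distr_cong[OF _ Seq.estimator_normal]) (unfold F_eq[symmetric], simp add: root)
  qed
qed

end
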